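(* Let $\mathbf b=\{b_j\}_{j\ge1}$ satisfy $0<b_1\le b_2\le\cdots$, and consider the approximation problem $\tilde I=\{\tilde I_d\}_{d\in\mathbb N}$, $\tilde I_d:W_2^{\mathbf b}([0,1]^d)\to L_2([0,1]^d)$, $\tilde I_d f=f$, in the worst case setting. Then: (i) $\tilde I$ is SPT iff $\tilde I$ is PT iff $\sum_{j=1}^\infty b_j^{-1}<\infty$; (ii) $\tilde I$ is QPT iff $\sup_{d\in\mathbb N}\frac{\sum_{j=1}^d b_j^{-1}}{1+\ln d}<\infty$; (iii) UWT holds iff $\lim_{j\to\infty}\frac{b_j}{\ln j}=\infty$; (iv) WT holds iff $\lim_{j\to\infty}\frac{(2\pi)^{2b_j}}{j}=\infty$; (v) $(s,t)$-WT holds for all $s,t>0$ with $\max(s/2,t)>1$; (vi) $(2,1)$-WT holds iff $\lim_{j\to\infty}b_j=\infty$; (vii) for $0<t<1$, $(2,t)$-WT holds iff $\lim_{j\to\infty}\frac{(2\pi)^{2b_j}}{\ln j}=\infty$; (viii) for $0<s<2$ and $0<t\le1$, $(s,t)$-WT holds iff $\lim_{j\to\infty}\frac{(2\pi)^{2b_j}}{j^{(2-s)/s}}=\infty$.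
   Context: For $f\in L_2([0,1]^d)$, $\hat f(\mathbf k)=\int_{[0,1]^d}f(\mathbf x)e^{-2\pi i\mathbf k\cdot\mathbf x}d\mathbf x$. $W_2^{\mathbf b}([0,1]^d)$ is the Hilbert space of $f\in L_2([0,1]^d)$ with norm $\|f\|^2=\sum_{\mathbf k\in\mathbb Z^d}(1+\sum_{j=1}^d|2\pi k_j|^{2b_j})|\hat f(\mathbf k)|^2<\infty$. Approximation numbers $a_n(T)=\inf\{\|T-A\|:\mathrm{rank}A<n\}$; information complexity $n(\varepsilon,\tilde I_d)=\min\{n\ge0:a_{n+1}(\tilde I_d)\le\varepsilon\}$ for $\varepsilon\in(0,1)$. Tractability notions: SPT iff $\exists C,p\ge0$: $n(\varepsilon,\tilde I_d)\le C\varepsilon^{-p}$ for all $d\in\mathbb N,\varepsilon\in(0,1)$; PT iff $\exists C,p,q\ge0$: $n(\varepsilon,\tilde I_d)\le Cd^q\varepsilon^{-p}$; QPT iff $\exists C,t>0$: $n(\varepsilon,\tilde I_d)\le C\exp[t(1+\ln\varepsilon^{-1})(1+\ln d)]$; $(s,t)$-WT iff $\lim_{\varepsilon^{-1}+d\to\infty}\frac{\ln n(\varepsilon,\tilde I_d)}{\varepsilon^{-s}+d^t}=0$; UWT iff $(\alpha,\beta)$-WT for all $\alpha,\beta>0$; WT iff $(1,1)$-WT. *)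

theory Defs
  imports "HOL-Analysis.Analysis"
begin

definition cube :: "nat \<Rightarrow> (nat \<Rightarrow> real) measure" where
  "cube d = PiM {1..d} (\<lambda>_. restrict_space lborel {0..1::real})"

definition freqs :: "nat \<Rightarrow> (nat \<Rightarrow> int) set" where
  "freqs d = {k. \<forall>j. j \<notin> {1..d} \<longrightarrow> k j = 0}"

definition fourier :: "nat \<Rightarrow> ((nat \<Rightarrow> real) \<Rightarrow> complex) \<Rightarrow> (nat \<Rightarrow> int) \<Rightarrow> complex" where
  "fourier d f k = (LINT x|cube d. f x * cis (- 2 * pi * (\<Sum>j=1..d. real_of_int (k j) * x j)))"

definition L2 :: "nat \<Rightarrow> ((nat \<Rightarrow> real) \<Rightarrow> complex) set" where
  "L2 d = {f. f \<in> borel_measurable (cube d) \<and> integrable (cube d) (\<lambda>x. (cmod (f x))\<^sup>2)}"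

definition L2norm :: "nat \<Rightarrow> ((nat \<Rightarrow> real) \<Rightarrow> complex) \<Rightarrow> real" where
  "L2norm d f = sqrt (LINT x|cube d. (cmod (f x))\<^sup>2)"

definition Wweight :: "(nat \<Rightarrow> real) \<Rightarrow> nat \<Rightarrow> (nat \<Rightarrow> int) \<Rightarrow> real" where
  "Wweight b d k = 1 + (\<Sum>j=1..d. (2 * pi * \<bar>real_of_int (k j)\<bar>) powr (2 * b j))"

definition Wspace :: "(nat \<Rightarrow> real) \<Rightarrow> nat \<Rightarrow> ((nat \<Rightarrow> real) \<Rightarrow> complex) set" where
  "Wspace b d = {f \<in> L2 d.
     (\<lambda>k. Wweight b d k * (cmod (fourier d f k))\<^sup>2) summable_on freqs d}"

definition Wnorm :: "(nat \<Rightarrow> real) \<Rightarrow> nat \<Rightarrow> ((nat \<Rightarrow> real) \<Rightarrow> complex) \<Rightarrow> real" where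
  "Wnorm b d f = sqrt (\<Sum>\<^sub>\<infinity>k\<in>freqs d. Wweight b d k * (cmod (fourier d f k))\<^sup>2)"

definition admissible ::
  "(nat \<Rightarrow> real) \<Rightarrow> nat \<Rightarrow> nat \<Rightarrow> (((nat \<Rightarrow> real) \<Rightarrow> complex) \<Rightarrow> ((nat \<Rightarrow> real) \<Rightarrow> complex)) \<Rightarrow> bool" where
  "admissible b d n A \<longleftrightarrow>
     (\<forall>f\<in>Wspace b d. A f \<in> L2 d) \<and>
     (\<forall>f\<in>Wspace b d. \<forall>g\<in>Wspace b d. \<forall>c1 c2::complex.
         A (\<lambda>x. c1 * f x + c2 * g x) = (\<lambda>x. c1 * A f x + c2 * A g x)) \<and>
     (\<exists>m<n. \<exists>G :: nat \<Rightarrow> (nat \<Rightarrow> real) \<Rightarrow> complex. \<forall>f\<in>Wspace b d.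
         \<exists>c :: nat \<Rightarrow> complex. A f = (\<lambda>x. \<Sum>i<m. c i * G i x))"

definition op_err ::
  "(nat \<Rightarrow> real) \<Rightarrow> nat \<Rightarrow> (((nat \<Rightarrow> real) \<Rightarrow> complex) \<Rightarrow> ((nat \<Rightarrow> real) \<Rightarrow> complex)) \<Rightarrow> ereal" where
  "op_err b d A = (SUP f\<in>{f\<in>Wspace b d. Wnorm b d f \<le> 1}. ereal (L2norm d (\<lambda>x. f x - A f x)))"

definition approx_num :: "(nat \<Rightarrow> real) \<Rightarrow> nat \<Rightarrow> nat \<Rightarrow> ereal" where
  "approx_num b d n = (INF A\<in>{A. admissible b d n A}. op_err b d A)"

definition info_compl :: "(nat \<Rightarrow> real) \<Rightarrow> real \<Rightarrow> nat \<Rightarrow> nat" where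
  "info_compl b \<epsilon> d = (LEAST n. approx_num b d (n + 1) \<le> ereal \<epsilon>)"

definition SPT :: "(nat \<Rightarrow> real) \<Rightarrow> bool" where
  "SPT b \<longleftrightarrow> (\<exists>C p. C \<ge> 0 \<and> p \<ge> 0 \<and> (\<forall>d\<ge>1. \<forall>\<epsilon>. 0 < \<epsilon> \<and> \<epsilon> < 1 \<longrightarrow>
      real (info_compl b \<epsilon> d) \<le> C * \<epsilon> powr (- p)))"

definition PT :: "(nat \<Rightarrow> real) \<Rightarrow> bool" where
  "PT b \<longleftrightarrow> (\<exists>C p q. C \<ge> 0 \<and> p \<ge> 0 \<and> q \<ge> 0 \<and> (\<forall>d\<ge>1. \<forall>\<epsilon>. 0 < \<epsilon> \<and> \<epsilon> < 1 \<longrightarrow>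
      real (info_compl b \<epsilon> d) \<le> C * real d powr q * \<epsilon> powr (- p)))"

definition QPT :: "(nat \<Rightarrow> real) \<Rightarrow> bool" where
  "QPT b \<longleftrightarrow> (\<exists>C t. C > 0 \<and> t > 0 \<and> (\<forall>d\<ge>1. \<forall>\<epsilon>. 0 < \<epsilon> \<and> \<epsilon> < 1 \<longrightarrow>
      real (info_compl b \<epsilon> d) \<le> C * exp (t * (1 + ln (1 / \<epsilon>)) * (1 + ln (real d)))))"

text \<open>(s,t)-weak tractability; ln 0 is read as 0 (via max 1 n).\<close>
definition WT_st :: "(nat \<Rightarrow> real) \<Rightarrow> real \<Rightarrow> real \<Rightarrow> bool" where
  "WT_st b s t \<longleftrightarrow> (\<forall>\<delta>>0. \<exists>R. \<forall>d\<ge>1. \<forall>\<epsilon>. 0 < \<epsilon> \<and> \<epsilon> < 1 \<and> 1 / \<epsilon> + real d > R \<longrightarrow>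
      ln (real (max 1 (info_compl b \<epsilon> d))) / (\<epsilon> powr (- s) + real d powr t) \<le> \<delta>)"

definition UWT :: "(nat \<Rightarrow> real) \<Rightarrow> bool" where
  "UWT b \<longleftrightarrow> (\<forall>\<alpha>>0. \<forall>\<beta>>0. WT_st b \<alpha> \<beta>)"

definition WT :: "(nat \<Rightarrow> real) \<Rightarrow> bool" where
  "WT b \<longleftrightarrow> WT_st b 1 1"

end

theory Submission
  imports Defs "HOL-Probability.Probability" "HOL-Real_Asymp.Real_Asymp"
begin

text \<open>The characters form an orthonormal basis that diagonalises the embedding, so the information
  complexity equals the number of frequencies \<open>k\<close> with weight below \<open>1 / \<epsilon>\<^sup>2\<close>; that is, with
  \<open>y = 1 / \<epsilon>\<close>, the number of lattice points with \<open>\<Sum>j. (2 \<pi> \<bar>k j\<bar>) powr (2 b j) < y\<^sup>2 - 1\<close>. Completeness of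
  the characters comes from the algebra of bounded multipliers that preserve their \<open>L2\<close>-closure: it
  contains the characters and is closed under bounded pointwise limits, hence contains all indicators.

  The lattice points are bounded above by the product of the coordinatewise counts, which gives
  \<open>y powr (\<Sum>j\<le>d. 1 / b j)\<close>, and by Rankin's trick with a parameter \<open>\<sigma>\<close> adapted to \<open>s\<close> and \<open>t\<close>. They are bounded
  below by a box (letting \<open>y\<close> tend to infinity for fixed \<open>d\<close>), by \<open>3 ^ d\<close>, and by a binomial coefficient
  counting the frequencies with exactly \<open>r\<close> entries equal to 1.\<close>

subsection \<open>Fourier analysis on the cube\<close>

text \<open>The cube is a product of closed intervals and not a torus: characters do not separate
  the endpoints 0 and 1, and density is wanted in \<open>d\<close> variables at once. Multipliers
  settle both, since they can be treated one coordinate at a time and tolerate almost everywhere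
  limits, so that the endpoints disappear in a null set.

  In the counting part the obstacle is uniformity in \<open>d\<close>: a constant factor per
  coordinate would be raised to the power \<open>d\<close>. The upper count has no such factor
  because \<open>2 * pi\<close> exceeds 3. The finitely many coordinates before a growth condition
  takes hold cost only a multiple of \<open>ln y\<close>.

  The term \<open>\<sigma> * y\<^sup>2\<close> must be affordable against \<open>y powr s\<close>,
  up to a power of \<open>d\<close>. For \<open>s = 2\<close> this allows a constant
  \<open>\<sigma>\<close>, for \<open>s < 2\<close> a multiple of \<open>y powr (s - 2)\<close>, for
  \<open>s > 2\<close> a multiple of \<open>ln (d + 1)\<close>. If the weights grow like
  \<open>j powr \<gamma>\<close>, summing over \<open>j\<close> costs about
  \<open>\<sigma> powr (- 1 / \<gamma>)\<close>; for \<open>s < 2\<close> this is of order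
  \<open>y powr s\<close> exactly when \<open>\<gamma> = (2 - s) / s\<close>, the critical
  exponent.\<close>

lemma prob_space_unit_interval: "prob_space (restrict_space lborel {0..1::real})"
  by (rule prob_space_restrict_space) auto

lemma prob_space_cube: "prob_space (cube d)"
  unfolding cube_def by (intro prob_space_PiM prob_space_unit_interval)

lemma component_measurable [measurable]:
  assumes "j \<in> {1..d}"
  shows "(\<lambda>x. x j) \<in> borel_measurable (cube d)"
proof -
  have "(\<lambda>x. x j) \<in> measurable (cube d) (restrict_space lborel {0..1::real})"
    unfolding cube_def using assms by (rule measurable_component_singleton)
  moreover have "(\<lambda>x. x) \<in> borel_measurable (restrict_space lborel {0..1::real})"
    by (rule measurable_restrict_space1) simp
  ultimately show ?thesis
    using measurable_compose by blast
qed

text \<open>The sign is opposite to the kernel of \<open>fourier\<close>, so Fourier coefficients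
  become inner products with \<open>trig d k\<close>. Entries of \<open>k\<close> outside
  \<open>{1..d}\<close> are ignored; distinct indices give distinct characters only within
  \<open>freqs d\<close>.\<close>

definition trig :: "nat \<Rightarrow> (nat \<Rightarrow> int) \<Rightarrow> (nat \<Rightarrow> real) \<Rightarrow> complex" where
  "trig d k x = cis (2 * pi * (\<Sum>j=1..d. real_of_int (k j) * x j))"

lemma cis_measurable [measurable]: "cis \<in> borel_measurable borel"
  by (intro borel_measurable_continuous_onI continuous_intros)

lemma trig_measurable [measurable]: "trig d k \<in> borel_measurable (cube d)"
proof -
  have "(\<lambda>x. \<Sum>j=1..d. real_of_int (k j) * x j) \<in> borel_measurable (cube d)"
    by (intro borel_measurable_sum borel_measurable_times component_measurable) auto
  then show ?thesis
    unfolding trig_def by measurable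
qed

lemma cmod_trig [simp]: "cmod (trig d k x) = 1"
  by (simp add: trig_def)

lemma trig_add: "trig d (\<lambda>j. k j + l j) x = trig d k x * trig d l x"
  by (simp add: trig_def cis_mult distrib_right distrib_left sum.distrib)

lemma trig_minus: "trig d (\<lambda>j. - k j) x = cnj (trig d k x)"
  by (simp add: trig_def cis_cnj sum_negf)

lemma trig_diff: "trig d (\<lambda>j. k j - l j) x = trig d k x * cnj (trig d l x)"
  using trig_add[of d k "\<lambda>j. - l j" x] by (simp add: trig_minus)

lemma fourier_eq: "fourier d f k = (LINT x|cube d. f x * cnj (trig d k x))"
  by (simp add: fourier_def trig_def cis_cnj)

lemma integral_unit_interval_cis:
  "(LINT x|restrict_space lborel {0..1}. cis (2 * pi * (real_of_int n * x))) = (if n = 0 then 1 else 0)"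
proof (cases "n = 0")
  case True
  interpret prob_space "restrict_space lborel {0..1::real}" by (rule prob_space_unit_interval)
  show ?thesis using True prob_space by simp
next
  case False
  define F where "F x = cis (2 * pi * (real_of_int n * x)) / (2 * pi * \<i> * of_int n)" for x :: real
  have "(F has_vector_derivative cis (2 * pi * (real_of_int n * x))) (at x within {0..1})" for x
    unfolding F_def using False
    by (auto intro!: derivative_eq_intros simp: has_vector_derivative_def has_derivative_cis
        field_simps scaleR_conv_of_real)
  then have "integral\<^sup>L lborel (\<lambda>x. indicator {0..1} x *\<^sub>R cis (2 * pi * (real_of_int n * x))) = F 1 - F 0"
    by (intro integral_FTC_atLeastAtMost continuous_intros) auto
  also have "F 1 - F 0 = 0"
    using cis_multiple_2pi[of "real_of_int n"] by (simp add: F_def)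
  finally show ?thesis
    using False by (simp add: integral_restrict_space)
qed

lemma cis_sum: "cis (\<Sum>i\<in>I. f i) = (\<Prod>i\<in>I. cis (f i))"
  by (induction I rule: infinite_finite_induct) (simp_all flip: cis_mult)

lemma integral_trig:
  "(LINT x|cube d. trig d k x) = (if \<forall>j\<in>{1..d}. k j = 0 then 1 else 0)"
proof -
  interpret P: product_sigma_finite "\<lambda>_::nat. restrict_space lborel {0..1::real}"
    by (rule product_sigma_finite.intro)
      (intro prob_space_imp_sigma_finite prob_space_unit_interval)
  interpret U: prob_space "restrict_space lborel {0..1::real}" by (rule prob_space_unit_interval)
  have trig: "trig d k x = (\<Prod>j\<in>{1..d}. cis (2 * pi * (real_of_int (k j) * x j)))" for x
    unfolding trig_def sum_distrib_left by (rule cis_sum)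
  have meas: "(\<lambda>x. cis (2 * pi * (real_of_int n * x))) \<in> borel_measurable (restrict_space lborel {0..1})" for n
    by (rule measurable_restrict_space1) simp
  have "(LINT x|cube d. trig d k x)
      = (\<Prod>j\<in>{1..d}. LINT x|restrict_space lborel {0..1}. cis (2 * pi * (real_of_int (k j) * x)))"
    unfolding trig cube_def
    by (rule P.product_integral_prod) (auto intro!: U.integrable_const_bound[where B=1] meas)
  also have "\<dots> = (\<Prod>j\<in>{1..d}. if k j = 0 then 1 else 0)"
    by (simp only: integral_unit_interval_cis)
  also have "\<dots> = (if \<forall>j\<in>{1..d}. k j = 0 then 1 else 0)"
    by (auto simp: prod_zero_iff)
  finally show ?thesis .
qed

lemma fourier_trig:
  assumes "k \<in> freqs d" "l \<in> freqs d"
  shows "fourier d (trig d k) l = (if k = l then 1 else 0)"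
proof -
  have "(\<forall>j\<in>{1..d}. k j - l j = 0) \<longleftrightarrow> k = l"
    using assms by (auto simp: freqs_def fun_eq_iff)
  then show ?thesis
    by (simp add: fourier_eq flip: trig_diff) (simp add: integral_trig)
qed

section \<open>Square integrable functions and finite Fourier sums\<close>

lemma L2_measurable: "f \<in> L2 d \<Longrightarrow> f \<in> borel_measurable (cube d)"
  and L2_integrable_square: "f \<in> L2 d \<Longrightarrow> integrable (cube d) (\<lambda>x. (cmod (f x))\<^sup>2)"
  by (simp_all add: L2_def)

lemma norm_add_square_le:
  fixes a b :: "'a::real_normed_vector"
  shows "(norm (a + b))\<^sup>2 \<le> 2 * (norm a)\<^sup>2 + 2 * (norm b)\<^sup>2"
proof -
  have "(norm (a + b))\<^sup>2 \<le> (norm a + norm b)\<^sup>2"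
    by (intro power_mono norm_triangle_ineq) simp
  also have "\<dots> \<le> 2 * (norm a)\<^sup>2 + 2 * (norm b)\<^sup>2"
    using sum_squares_bound[of "norm a" "norm b"] by (simp add: power2_sum)
  finally show ?thesis .
qed

lemma L2_add:
  assumes "f \<in> L2 d" "g \<in> L2 d"
  shows "(\<lambda>x. f x + g x) \<in> L2 d"
proof -
  note [measurable] = assms[THEN L2_measurable]
  have "integrable (cube d) (\<lambda>x. (cmod (f x + g x))\<^sup>2)"
  proof (rule Bochner_Integration.integrable_bound)
    show "integrable (cube d) (\<lambda>x. 2 * (cmod (f x))\<^sup>2 + 2 * (cmod (g x))\<^sup>2)"
      using assms[THEN L2_integrable_square] by simp
    show "AE x in cube d. norm ((cmod (f x + g x))\<^sup>2) \<le> norm (2 * (cmod (f x))\<^sup>2 + 2 * (cmod (g x))\<^sup>2)"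
      using norm_add_square_le by (intro AE_I2) (auto intro: order_trans[OF _ abs_ge_self])
  qed measurable
  then show ?thesis by (simp add: L2_def)
qed

lemma L2_bounded_mult:
  assumes f: "f \<in> L2 d" and h [measurable]: "h \<in> borel_measurable (cube d)"
    and B: "\<And>x. x \<in> space (cube d) \<Longrightarrow> cmod (h x) \<le> B"
  shows "(\<lambda>x. h x * f x) \<in> L2 d"
proof -
  note [measurable] = f[THEN L2_measurable]
  have "integrable (cube d) (\<lambda>x. (cmod (h x * f x))\<^sup>2)"
  proof (rule Bochner_Integration.integrable_bound)
    show "integrable (cube d) (\<lambda>x. B\<^sup>2 * (cmod (f x))\<^sup>2)"
      using f by (auto dest: L2_integrable_square)
    show "AE x in cube d. norm ((cmod (h x * f x))\<^sup>2) \<le> norm (B\<^sup>2 * (cmod (f x))\<^sup>2)"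
      using B by (intro AE_I2) (auto simp: norm_mult power_mult_distrib intro!: mult_right_mono power_mono)
  qed measurable
  then show ?thesis by (simp add: L2_def)
qed

lemma L2_scale: "f \<in> L2 d \<Longrightarrow> (\<lambda>x. c * f x) \<in> L2 d"
  by (rule L2_bounded_mult[where B="cmod c"]) auto

lemma L2_diff: "f \<in> L2 d \<Longrightarrow> g \<in> L2 d \<Longrightarrow> (\<lambda>x. f x - g x) \<in> L2 d"
  using L2_add[of f d "\<lambda>x. - 1 * g x"] L2_scale[of g d "-1"] by simp

lemma L2_bounded:
  assumes [measurable]: "h \<in> borel_measurable (cube d)"
    and B: "\<And>x. x \<in> space (cube d) \<Longrightarrow> cmod (h x) \<le> B"
  shows "h \<in> L2 d"
proof -
  interpret prob_space "cube d" by (rule prob_space_cube)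
  have "(\<lambda>_. 1) \<in> L2 d" by (simp add: L2_def)
  from L2_bounded_mult[OF this assms] show ?thesis by simp
qed

lemma L2_integrable:
  assumes "f \<in> L2 d"
  shows "integrable (cube d) f"
proof -
  interpret prob_space "cube d" by (rule prob_space_cube)
  show ?thesis
  proof (rule Bochner_Integration.integrable_bound)
    show "integrable (cube d) (\<lambda>x. 1 + (cmod (f x))\<^sup>2)"
      using assms by (auto dest: L2_integrable_square)
    have "cmod (f x) \<le> 1 + (cmod (f x))\<^sup>2" for x
      using sum_squares_bound[of 1 "cmod (f x)"] by (simp add: power2_eq_square) 
        (smt (verit) norm_ge_zero mult_nonneg_nonneg)
    then show "AE x in cube d. norm (f x) \<le> norm (1 + (cmod (f x))\<^sup>2)"
      by (intro AE_I2) (auto intro: order_trans[OF _ abs_ge_self])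
  qed (use assms in \<open>auto dest: L2_measurable\<close>)
qed

lemma trig_L2 [simp]: "trig d k \<in> L2 d"
  by (rule L2_bounded[where B=1]) auto

lemma L2_sum: "(\<And>i. i \<in> I \<Longrightarrow> f i \<in> L2 d) \<Longrightarrow> (\<lambda>x. \<Sum>i\<in>I. f i x) \<in> L2 d"
proof (induction I rule: infinite_finite_induct)
  case (insert i I)
  then show ?case by (auto intro: L2_add)
qed (auto intro: L2_bounded[where B=0])

lemma integrable_mult_trig:
  assumes "f \<in> L2 d"
  shows "integrable (cube d) (\<lambda>x. f x * cnj (trig d k x))"
proof -
  have "(\<lambda>x. trig d (\<lambda>j. - k j) x * f x) \<in> L2 d"
    by (rule L2_bounded_mult[OF assms, where B=1]) auto
  then show ?thesis
    by (auto dest!: L2_integrable simp: trig_minus mult.commute)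
qed

lemma fourier_lincomb:
  assumes "f \<in> L2 d" "g \<in> L2 d"
  shows "fourier d (\<lambda>x. a * f x + c * g x) k = a * fourier d f k + c * fourier d g k"
proof -
  have "fourier d (\<lambda>x. a * f x + c * g x) k
      = (LINT x|cube d. a * (f x * cnj (trig d k x)) + c * (g x * cnj (trig d k x)))"
    by (simp add: fourier_eq algebra_simps)
  also have "\<dots> = a * fourier d f k + c * fourier d g k"
    using integrable_mult_trig[OF assms(1)] integrable_mult_trig[OF assms(2)]
    by (simp add: fourier_eq)
  finally show ?thesis .
qed

lemma fourier_trig_sum:
  assumes "finite S" "S \<subseteq> freqs d" "l \<in> freqs d"
  shows "fourier d (\<lambda>x. \<Sum>k\<in>S. c k * trig d k x) l = (if l \<in> S then c l else 0)"
  using assms(1,2)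
proof (induction S)
  case empty
  then show ?case by (simp add: fourier_def)
next
  case (insert k S)
  have "fourier d (\<lambda>x. c k * trig d k x + 1 * (\<Sum>k\<in>S. c k * trig d k x)) l
      = c k * fourier d (trig d k) l + 1 * fourier d (\<lambda>x. \<Sum>k\<in>S. c k * trig d k x) l"
    by (intro fourier_lincomb L2_sum L2_scale trig_L2)
  with insert assms(3) show ?case
    by (auto simp: fourier_trig)
qed

text \<open>Expand the square and complete it separately in every \<open>c k\<close>. Only the last
  sum depends on \<open>c\<close>, so Fourier coefficients give the best approximation with spectrum
  in \<open>S\<close>. The computation runs over the complex numbers because the cross terms are
  real only in pairs.\<close>

lemma integral_square_diff_trig_sum:
  assumes f: "f \<in> L2 d" and S: "finite S" "S \<subseteq> freqs d"
  shows "complex_of_real (LINT x|cube d. (cmod (f x - (\<Sum>k\<in>S. c k * trig d k x)))\<^sup>2)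
    = (LINT x|cube d. (cmod (f x))\<^sup>2) - (\<Sum>k\<in>S. (cmod (fourier d f k))\<^sup>2)
      + (\<Sum>k\<in>S. (cmod (c k - fourier d f k))\<^sup>2)"
proof -
  define p where "p x = (\<Sum>k\<in>S. c k * trig d k x)" for x
  have p: "p \<in> L2 d" unfolding p_def by (intro L2_sum L2_scale trig_L2)
  have int_p: "integrable (cube d) (\<lambda>x. q x * cnj (p x))"
    and val_p: "(LINT x|cube d. q x * cnj (p x)) = (\<Sum>k\<in>S. cnj (c k) * fourier d q k)"
    if q: "q \<in> L2 d" for q
  proof -
    have *: "q x * cnj (p x) = (\<Sum>k\<in>S. cnj (c k) * (q x * cnj (trig d k x)))" for x
      by (simp add: p_def sum_distrib_left mult_ac)
    show "integrable (cube d) (\<lambda>x. q x * cnj (p x))"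
      unfolding * using integrable_mult_trig[OF q] by auto
    show "(LINT x|cube d. q x * cnj (p x)) = (\<Sum>k\<in>S. cnj (c k) * fourier d q k)"
      unfolding * fourier_eq using integrable_mult_trig[OF q]
      by (subst Bochner_Integration.integral_sum) auto
  qed
  have fp: "fourier d p k = c k" if "k \<in> S" for k
    unfolding p_def using fourier_trig_sum[OF S, of k] that S by auto
  have expand: "complex_of_real ((cmod (f x - p x))\<^sup>2)
     = of_real ((cmod (f x))\<^sup>2) - f x * cnj (p x) - cnj (f x * cnj (p x)) + p x * cnj (p x)" for x
    by (simp only: complex_norm_square) (simp add: algebra_simps)
  have "complex_of_real (LINT x|cube d. (cmod (f x - p x))\<^sup>2)
     = (LINT x|cube d. complex_of_real ((cmod (f x - p x))\<^sup>2))"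
    by (rule integral_complex_of_real[symmetric])
  also have "\<dots> = (LINT x|cube d. complex_of_real ((cmod (f x))\<^sup>2)) - (LINT x|cube d. f x * cnj (p x))
      - (LINT x|cube d. cnj (f x * cnj (p x))) + (LINT x|cube d. p x * cnj (p x))"
    unfolding expand using int_p[OF f] int_p[OF p] L2_integrable_square[OF f]
    by (simp del: complex_cnj_mult of_real_power)
  also have "\<dots> = (LINT x|cube d. (cmod (f x))\<^sup>2) - (\<Sum>k\<in>S. cnj (c k) * fourier d f k)
      - cnj (\<Sum>k\<in>S. cnj (c k) * fourier d f k) + (\<Sum>k\<in>S. cnj (c k) * fourier d p k)"
    unfolding val_p[OF f, symmetric] val_p[OF p, symmetric] Bochner_Integration.integral_cnj
    by (simp only: integral_complex_of_real)
  also have "\<dots> = (LINT x|cube d. (cmod (f x))\<^sup>2)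
      + (\<Sum>k\<in>S. - cnj (c k) * fourier d f k - c k * cnj (fourier d f k) + cnj (c k) * c k)"
    using fp by (simp add: sum.distrib sum_subtractf sum_negf algebra_simps)
  also have "(\<Sum>k\<in>S. - cnj (c k) * fourier d f k - c k * cnj (fourier d f k) + cnj (c k) * c k)
      = (\<Sum>k\<in>S. of_real ((cmod (c k - fourier d f k))\<^sup>2) - of_real ((cmod (fourier d f k))\<^sup>2))"
    by (intro sum.cong refl, simp only: complex_norm_square) (simp add: algebra_simps)
  finally show ?thesis
    by (simp add: p_def sum_subtractf)
qed

lemma integral_square_diff_trig_sum_real:
  assumes f: "f \<in> L2 d" and S: "finite S" "S \<subseteq> freqs d"
  shows "(LINT x|cube d. (cmod (f x - (\<Sum>k\<in>S. c k * trig d k x)))\<^sup>2)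
    = (LINT x|cube d. (cmod (f x))\<^sup>2) - (\<Sum>k\<in>S. (cmod (fourier d f k))\<^sup>2)
      + (\<Sum>k\<in>S. (cmod (c k - fourier d f k))\<^sup>2)"
proof -
  have "complex_of_real (LINT x|cube d. (cmod (f x - (\<Sum>k\<in>S. c k * trig d k x)))\<^sup>2)
   = complex_of_real ((LINT x|cube d. (cmod (f x))\<^sup>2) - (\<Sum>k\<in>S. (cmod (fourier d f k))\<^sup>2)
      + (\<Sum>k\<in>S. (cmod (c k - fourier d f k))\<^sup>2))"
    by (subst integral_square_diff_trig_sum[OF assms]) simp
  then show ?thesis
    by (simp only: of_real_eq_iff)
qed

section \<open>Trigonometric polynomials and their closure\<close>

definition trig_poly :: "nat \<Rightarrow> ((nat \<Rightarrow> real) \<Rightarrow> complex) set" where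
  "trig_poly d = {\<lambda>x. \<Sum>k\<in>S. c k * trig d k x | S c. finite S \<and> S \<subseteq> freqs d}"

lemma trig_polyE:
  assumes "p \<in> trig_poly d"
  obtains S c where "finite S" "S \<subseteq> freqs d" "p = (\<lambda>x. \<Sum>k\<in>S. c k * trig d k x)"
  using assms by (auto simp: trig_poly_def)

lemma trig_polyI: "finite S \<Longrightarrow> S \<subseteq> freqs d \<Longrightarrow> (\<lambda>x. \<Sum>k\<in>S. c k * trig d k x) \<in> trig_poly d"
  by (auto simp: trig_poly_def)

lemma trig_poly_L2: "p \<in> trig_poly d \<Longrightarrow> p \<in> L2 d"
  by (elim trig_polyE) (auto intro!: L2_sum L2_scale trig_L2)

lemma trig_poly_add:
  assumes "p \<in> trig_poly d" "q \<in> trig_poly d"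
  shows "(\<lambda>x. p x + q x) \<in> trig_poly d"
proof -
  obtain S c where S: "finite S" "S \<subseteq> freqs d" "p = (\<lambda>x. \<Sum>k\<in>S. c k * trig d k x)"
    using assms(1) by (rule trig_polyE)
  obtain T e where T: "finite T" "T \<subseteq> freqs d" "q = (\<lambda>x. \<Sum>k\<in>T. e k * trig d k x)"
    using assms(2) by (rule trig_polyE)
  have "p x = (\<Sum>k\<in>S \<union> T. (if k \<in> S then c k else 0) * trig d k x)" for x
    unfolding S(3) using S(1) T(1) by (intro sum.mono_neutral_cong_left) auto
  moreover have "q x = (\<Sum>k\<in>S \<union> T. (if k \<in> T then e k else 0) * trig d k x)" for x
    unfolding T(3) using S(1) T(1) by (intro sum.mono_neutral_cong_left) auto
  ultimately have "(\<lambda>x. p x + q x)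
      = (\<lambda>x. \<Sum>k\<in>S \<union> T. ((if k \<in> S then c k else 0) + (if k \<in> T then e k else 0)) * trig d k x)"
    by (simp add: distrib_right sum.distrib)
  then show ?thesis
    using S T trig_polyI[of "S \<union> T" d] by auto
qed

lemma trig_poly_scale:
  assumes "p \<in> trig_poly d"
  shows "(\<lambda>x. a * p x) \<in> trig_poly d"
  using assms
proof (rule trig_polyE)
  fix S c assume "finite S" "S \<subseteq> freqs d" "p = (\<lambda>x. \<Sum>k\<in>S. c k * trig d k x)"
  then show ?thesis
    using trig_polyI[of S d "\<lambda>k. a * c k"] by (simp add: sum_distrib_left mult.assoc)
qed

lemma trig_poly_mult_trig:
  assumes "p \<in> trig_poly d" and l: "l \<in> freqs d"
  shows "(\<lambda>x. trig d l x * p x) \<in> trig_poly d"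
  using assms(1)
proof (rule trig_polyE)
  fix S c assume S: "finite S" "S \<subseteq> freqs d" "p = (\<lambda>x. \<Sum>k\<in>S. c k * trig d k x)"
  define sh where "sh k = (\<lambda>j. k j + l j)" for k :: "nat \<Rightarrow> int"
  have inj: "inj_on sh S" by (auto simp: sh_def inj_on_def fun_eq_iff)
  have "trig d l x * p x = (\<Sum>k\<in>sh ` S. c (\<lambda>j. k j - l j) * trig d k x)" for x
    unfolding sum.reindex[OF inj] S(3)
    by (simp add: sh_def trig_add sum_distrib_left mult_ac)
  moreover have "sh ` S \<subseteq> freqs d" using S(2) l by (auto simp: sh_def freqs_def)
  ultimately show ?thesis
    using trig_polyI[of "sh ` S" d "\<lambda>k. c (\<lambda>j. k j - l j)"] S(1) by simp
qed

text \<open>A triangle inequality for squared norms that avoids square roots. Its factor 2 is why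
  the closure arguments below split \<open>e\<close> into quarters.\<close>

lemma integral_square_add_le:
  assumes "f \<in> L2 d" "g \<in> L2 d"
  shows "(LINT x|cube d. (cmod (f x + g x))\<^sup>2)
    \<le> 2 * (LINT x|cube d. (cmod (f x))\<^sup>2) + 2 * (LINT x|cube d. (cmod (g x))\<^sup>2)"
proof -
  note fg = assms[THEN L2_integrable_square]
  have "(LINT x|cube d. (cmod (f x + g x))\<^sup>2)
      \<le> (LINT x|cube d. 2 * (cmod (f x))\<^sup>2 + 2 * (cmod (g x))\<^sup>2)"
    using fg by (intro integral_mono L2_integrable_square[OF L2_add[OF assms]] norm_add_square_le) auto
  then show ?thesis using fg by simp
qed

definition trig_closure :: "nat \<Rightarrow> ((nat \<Rightarrow> real) \<Rightarrow> complex) set" where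
  "trig_closure d = {f \<in> L2 d. \<forall>e>0. \<exists>p\<in>trig_poly d. (LINT x|cube d. (cmod (f x - p x))\<^sup>2) < e}"

lemma trig_closure_L2: "f \<in> trig_closure d \<Longrightarrow> f \<in> L2 d"
  by (simp add: trig_closure_def)

lemma trig_closureE:
  assumes "f \<in> trig_closure d" "e > 0"
  obtains p where "p \<in> trig_poly d" "(LINT x|cube d. (cmod (f x - p x))\<^sup>2) < e"
  using assms unfolding trig_closure_def by blast

lemma trig_closure_limit:
  assumes f: "f \<in> L2 d"
    and approx: "\<And>e. e > 0 \<Longrightarrow> \<exists>g\<in>trig_closure d. (LINT x|cube d. (cmod (f x - g x))\<^sup>2) < e"
  shows "f \<in> trig_closure d"
  unfolding trig_closure_def
proof (intro CollectI conjI allI impI f)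
  fix e :: real assume "e > 0"
  then have e4: "e / 4 > 0" by simp
  obtain g where g: "g \<in> trig_closure d" "(LINT x|cube d. (cmod (f x - g x))\<^sup>2) < e / 4"
    using approx[OF e4] by auto
  obtain p where p: "p \<in> trig_poly d" "(LINT x|cube d. (cmod (g x - p x))\<^sup>2) < e / 4"
    using g(1) e4 by (rule trig_closureE)
  have "(LINT x|cube d. (cmod (f x - p x))\<^sup>2) < e"
    using integral_square_add_le[of "\<lambda>x. f x - g x" d "\<lambda>x. g x - p x"] g p
      L2_diff[OF f trig_closure_L2[OF g(1)]] L2_diff[OF trig_closure_L2[OF g(1)] trig_poly_L2[OF p(1)]]
    by simp
  with p(1) show "\<exists>p\<in>trig_poly d. (LINT x|cube d. (cmod (f x - p x))\<^sup>2) < e" by blast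
qed

lemma trig_poly_closure: "p \<in> trig_poly d \<Longrightarrow> p \<in> trig_closure d"
  by (auto simp: trig_closure_def trig_poly_L2 intro!: bexI[of _ p])

lemma trig_closure_add:
  assumes f: "f \<in> trig_closure d" and g: "g \<in> trig_closure d"
  shows "(\<lambda>x. f x + g x) \<in> trig_closure d"
  unfolding trig_closure_def
proof (intro CollectI conjI allI impI L2_add trig_closure_L2 f g)
  fix e :: real assume "e > 0"
  then have e4: "e / 4 > 0" by simp
  obtain p where p: "p \<in> trig_poly d" "(LINT x|cube d. (cmod (f x - p x))\<^sup>2) < e / 4"
    using f e4 by (rule trig_closureE)
  obtain q where q: "q \<in> trig_poly d" "(LINT x|cube d. (cmod (g x - q x))\<^sup>2) < e / 4"
    using g e4 by (rule trig_closureE)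
  have "(LINT x|cube d. (cmod (f x + g x - (p x + q x)))\<^sup>2) < e"
    using integral_square_add_le[of "\<lambda>x. f x - p x" d "\<lambda>x. g x - q x"] p q
      L2_diff[OF trig_closure_L2[OF f] trig_poly_L2[OF p(1)]]
      L2_diff[OF trig_closure_L2[OF g] trig_poly_L2[OF q(1)]]
    by (simp add: algebra_simps)
  then show "\<exists>r\<in>trig_poly d. (LINT x|cube d. (cmod (f x + g x - r x))\<^sup>2) < e"
    using trig_poly_add[OF p(1) q(1)] by (intro bexI[of _ "\<lambda>x. p x + q x"]) auto
qed

lemma trig_closure_scale:
  assumes f: "f \<in> trig_closure d"
  shows "(\<lambda>x. a * f x) \<in> trig_closure d"
  unfolding trig_closure_def
proof (intro CollectI conjI allI impI L2_scale trig_closure_L2 f)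
  fix e :: real assume "e > 0"
  \<comment> \<open>The added 1 covers \<open>a = 0\<close>.\<close>
  then have "e / ((cmod a)\<^sup>2 + 1) > 0" by (simp add: add_nonneg_pos)
  then obtain p where p: "p \<in> trig_poly d"
      "(LINT x|cube d. (cmod (f x - p x))\<^sup>2) < e / ((cmod a)\<^sup>2 + 1)"
    using f by (auto elim: trig_closureE)
  have "(LINT x|cube d. (cmod (a * f x - a * p x))\<^sup>2)
      = (cmod a)\<^sup>2 * (LINT x|cube d. (cmod (f x - p x))\<^sup>2)"
    by (simp add: norm_mult power_mult_distrib flip: right_diff_distrib)
  also have "\<dots> \<le> ((cmod a)\<^sup>2 + 1) * (LINT x|cube d. (cmod (f x - p x))\<^sup>2)"
    by (intro mult_right_mono) auto
  also have "\<dots> < e"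
    using p(2) by (simp add: pos_less_divide_eq add_nonneg_pos mult.commute)
  finally show "\<exists>r\<in>trig_poly d. (LINT x|cube d. (cmod (a * f x - r x))\<^sup>2) < e"
    using trig_poly_scale[OF p(1), of a] by (intro bexI[of _ "\<lambda>x. a * p x"])
qed

text \<open>Multiplication by a character shifts the spectrum and preserves the norm, so
  approximants are carried to approximants.\<close>

lemma trig_closure_mult_trig:
  assumes f: "f \<in> trig_closure d" and l: "l \<in> freqs d"
  shows "(\<lambda>x. trig d l x * f x) \<in> trig_closure d"
  unfolding trig_closure_def
proof (intro CollectI conjI allI impI)
  show "(\<lambda>x. trig d l x * f x) \<in> L2 d"
    by (rule L2_bounded_mult[where B=1]) (auto intro: f trig_closure_L2)
  fix e :: real assume "e > 0"
  then obtain p where p: "p \<in> trig_poly d" "(LINT x|cube d. (cmod (f x - p x))\<^sup>2) < e"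
    using f by (auto simp: trig_closure_def)
  have "(LINT x|cube d. (cmod (trig d l x * f x - trig d l x * p x))\<^sup>2)
      = (LINT x|cube d. (cmod (f x - p x))\<^sup>2)"
    by (simp add: norm_mult flip: right_diff_distrib)
  then show "\<exists>r\<in>trig_poly d. (LINT x|cube d. (cmod (trig d l x * f x - r x))\<^sup>2) < e"
    using p trig_poly_mult_trig[OF p(1) l] by (intro bexI[of _ "\<lambda>x. trig d l x * p x"]) auto
qed

text \<open>Dominated convergence with integrable majorant \<open>4 * (cmod (g x))\<^sup>2\<close>.
  The bound is a function \<open>g\<close> rather than a constant so that the lemma also applies to
  bounded multipliers times an unbounded \<open>f\<close>.\<close>

lemma trig_closure_dominated:
  assumes f: "f \<in> borel_measurable (cube d)" and F: "\<And>n. F n \<in> trig_closure d" and g: "g \<in> L2 d"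
    and lim: "AE x in cube d. (\<lambda>n. F n x) \<longlonglongrightarrow> f x"
    and dom: "\<And>n x. x \<in> space (cube d) \<Longrightarrow> cmod (F n x) \<le> cmod (g x)"
  shows "f \<in> trig_closure d"
proof -
  note [measurable] = f L2_measurable[OF g] L2_measurable[OF trig_closure_L2[OF F]]
  have fg: "AE x in cube d. cmod (f x) \<le> cmod (g x)"
    using lim AE_space
  proof eventually_elim
    case (elim x)
    then have "(\<lambda>n. cmod (F n x)) \<longlonglongrightarrow> cmod (f x)" by (intro tendsto_norm)
    then show ?case
      by (rule LIMSEQ_le_const2) (use dom elim in blast)
  qed
  have f_L2: "f \<in> L2 d"
    unfolding L2_def using fg
    by (auto intro!: Bochner_Integration.integrable_bound[OF L2_integrable_square[OF g]] power_mono)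
  have "(\<lambda>n. LINT x|cube d. (cmod (f x - F n x))\<^sup>2) \<longlonglongrightarrow> (LINT x|cube d. 0)"
  proof (rule integral_dominated_convergence)
    show "integrable (cube d) (\<lambda>x. 4 * (cmod (g x))\<^sup>2)"
      using L2_integrable_square[OF g] by simp
    show "AE x in cube d. (\<lambda>n. (cmod (f x - F n x))\<^sup>2) \<longlonglongrightarrow> 0"
      using lim
    proof eventually_elim
      case (elim x)
      then have "(\<lambda>n. (cmod (f x - F n x))\<^sup>2) \<longlonglongrightarrow> (cmod (f x - f x))\<^sup>2"
        by (intro tendsto_intros)
      then show ?case by simp
    qed
    show "AE x in cube d. norm ((cmod (f x - F n x))\<^sup>2) \<le> 4 * (cmod (g x))\<^sup>2" for n
      using fg AE_space
    proof eventually_elim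
      case (elim x)
      have "cmod (f x - F n x) \<le> 2 * cmod (g x)"
        using norm_triangle_ineq4[of "f x" "F n x"] elim(1) dom[OF elim(2), of n] by linarith
      then have "(cmod (f x - F n x))\<^sup>2 \<le> (2 * cmod (g x))\<^sup>2" by (intro power_mono) auto
      then show ?case by (simp add: power_mult_distrib)
    qed
  qed measurable
  then have "(\<lambda>n. LINT x|cube d. (cmod (f x - F n x))\<^sup>2) \<longlonglongrightarrow> 0" by simp
  then have "\<exists>n. (LINT x|cube d. (cmod (f x - F n x))\<^sup>2) < e" if "e > 0" for e
    using order_tendstoD(2)[OF _ that] eventually_happens' sequentially_bot by blast
  then show ?thesis
    using F by (intro trig_closure_limit[OF f_L2]) blast
qed

text \<open>The closure itself is only a vector space; its multipliers form an algebra. Products are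
  what lets indicators be combined across coordinates.\<close>

definition trig_mult :: "nat \<Rightarrow> ((nat \<Rightarrow> real) \<Rightarrow> complex) set" where
  "trig_mult d = {h \<in> borel_measurable (cube d). (\<exists>B. \<forall>x\<in>space (cube d). cmod (h x) \<le> B) \<and>
     (\<forall>f\<in>trig_closure d. (\<lambda>x. h x * f x) \<in> trig_closure d)}"

lemma trig_mult_measurable: "h \<in> trig_mult d \<Longrightarrow> h \<in> borel_measurable (cube d)"
  by (simp add: trig_mult_def)

lemma trig_mult_trig: "l \<in> freqs d \<Longrightarrow> trig d l \<in> trig_mult d"
  by (auto simp: trig_mult_def trig_closure_mult_trig intro: exI[of _ 1])

lemma trig_mult_const: "(\<lambda>_. a) \<in> trig_mult d"
  by (auto simp: trig_mult_def intro: trig_closure_scale)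

lemma trig_mult_add:
  assumes h: "h \<in> trig_mult d" and k: "k \<in> trig_mult d"
  shows "(\<lambda>x. h x + k x) \<in> trig_mult d"
proof -
  obtain A B where "\<forall>x\<in>space (cube d). cmod (h x) \<le> A" "\<forall>x\<in>space (cube d). cmod (k x) \<le> B"
    using h k by (auto simp: trig_mult_def)
  then have "\<forall>x\<in>space (cube d). cmod (h x + k x) \<le> A + B"
    by (auto intro: norm_triangle_mono)
  with h k show ?thesis
    by (auto simp: trig_mult_def distrib_right intro: trig_closure_add)
qed

lemma trig_mult_mult:
  assumes h: "h \<in> trig_mult d" and k: "k \<in> trig_mult d"
  shows "(\<lambda>x. h x * k x) \<in> trig_mult d"
proof -
  obtain A B where AB: "\<forall>x\<in>space (cube d). cmod (h x) \<le> A" "\<forall>x\<in>space (cube d). cmod (k x) \<le> B"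
    using h k by (auto simp: trig_mult_def)
  then have "\<forall>x\<in>space (cube d). cmod (h x * k x) \<le> A * B"
    by (auto simp: norm_mult intro!: mult_mono intro: order_trans[OF norm_ge_zero])
  with h k show ?thesis
    by (auto simp: trig_mult_def mult.assoc)
qed

lemma trig_mult_diff:
  assumes "h \<in> trig_mult d" "k \<in> trig_mult d"
  shows "(\<lambda>x. h x - k x) \<in> trig_mult d"
  using trig_mult_add[OF assms(1) trig_mult_mult[OF trig_mult_const[of "-1"] assms(2)]] by simp

lemma trig_mult_limit:
  assumes h: "h \<in> borel_measurable (cube d)" and H: "\<And>n. H n \<in> trig_mult d"
    and lim: "AE x in cube d. (\<lambda>n. H n x) \<longlonglongrightarrow> h x"
    and bdd: "\<And>n x. x \<in> space (cube d) \<Longrightarrow> cmod (H n x) \<le> B"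
      "\<And>x. x \<in> space (cube d) \<Longrightarrow> cmod (h x) \<le> B"
  shows "h \<in> trig_mult d"
  unfolding trig_mult_def
proof (intro CollectI conjI ballI h)
  show "\<exists>B. \<forall>x\<in>space (cube d). cmod (h x) \<le> B" using bdd(2) by blast
  fix f assume f: "f \<in> trig_closure d"
  show "(\<lambda>x. h x * f x) \<in> trig_closure d"
  proof (rule trig_closure_dominated)
    show "(\<lambda>x. h x * f x) \<in> borel_measurable (cube d)"
      using h L2_measurable[OF trig_closure_L2[OF f]] by measurable
    show "(\<lambda>x. H n x * f x) \<in> trig_closure d" for n
      using H f by (auto simp: trig_mult_def)
    show "(\<lambda>x. complex_of_real \<bar>B\<bar> * f x) \<in> L2 d" by (intro L2_scale trig_closure_L2 f)
    show "AE x in cube d. (\<lambda>n. H n x * f x) \<longlonglongrightarrow> h x * f x"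
      using lim by eventually_elim (auto intro: tendsto_intros)
    show "cmod (H n x * f x) \<le> cmod (complex_of_real \<bar>B\<bar> * f x)" if "x \<in> space (cube d)" for n x
      using bdd(1)[OF that, of n] by (auto simp: norm_mult intro!: mult_right_mono)
  qed
qed

lemma trig_single:
  assumes "j \<in> {1..d}"
  shows "trig d (\<lambda>i. if i = j then m else 0) x = cis (2 * pi * (real_of_int m * x j))"
proof -
  have "(\<Sum>i=1..d. real_of_int (if i = j then m else 0) * x i)
      = (\<Sum>i\<in>{1..d}. if i = j then real_of_int m * x i else 0)"
    by (intro sum.cong) auto
  then show ?thesis
    using assms by (simp add: trig_def)
qed

context
  fixes d j :: nat
  assumes j: "j \<in> {1..d}"
begin

lemma trig_mult_cis:
  "(\<lambda>x. cis (2 * pi * x j)) \<in> trig_mult d" "(\<lambda>x. cnj (cis (2 * pi * x j))) \<in> trig_mult d"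
proof -
  have "(\<lambda>i. if i = j then m else 0) \<in> freqs d" for m :: int
    using j by (auto simp: freqs_def)
  note * = trig_mult_trig[OF this]
  show "(\<lambda>x. cis (2 * pi * x j)) \<in> trig_mult d"
    using *[of 1] unfolding trig_single[OF j, abs_def] by simp
  show "(\<lambda>x. cnj (cis (2 * pi * x j))) \<in> trig_mult d"
    using *[of "-1"] unfolding trig_single[OF j, abs_def] by (simp add: cis_cnj)
qed

text \<open>A real polynomial on the plane is a polynomial in \<open>z\<close> and
  \<open>cnj z\<close>, and at \<open>z = cis (2 * pi * x j)\<close> these two are the characters of
  frequency 1 and -1 in coordinate \<open>j\<close>.\<close>

lemma trig_mult_polynomial:
  fixes p :: "complex \<Rightarrow> real"
  assumes "real_polynomial_function p"
  shows "(\<lambda>x. complex_of_real (p (cis (2 * pi * x j)))) \<in> trig_mult d"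
  using assms
proof induction
  case (linear f)
  have *: "f z = Re z * f 1 + Im z * f \<i>" for z
  proof -
    have "f z = f (Re z *\<^sub>R 1 + Im z *\<^sub>R \<i>)"
      by (rule arg_cong[of _ _ f]) (simp add: complex_eq_iff)
    also have "\<dots> = Re z * f 1 + Im z * f \<i>"
      using linear by (simp add: linear_simps)
    finally show ?thesis .
  qed
  define a c where "a = f 1" and "c = f \<i>"
  \<comment> \<open>Substitute \<open>Re z = (z + cnj z) / 2\<close> and
    \<open>Im z = (z - cnj z) / (2 * \<i>)\<close>.\<close>
  have "complex_of_real (f z) = (a / 2 + c / (2 * \<i>)) * z + (a / 2 - c / (2 * \<i>)) * cnj z" for z
    unfolding *[of z] a_def[symmetric] c_def[symmetric] by (simp add: complex_eq_iff field_simps)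
  moreover have "(\<lambda>x. (a / 2 + c / (2 * \<i>)) * cis (2 * pi * x j)
      + (a / 2 - c / (2 * \<i>)) * cnj (cis (2 * pi * x j))) \<in> trig_mult d"
    by (intro trig_mult_add trig_mult_mult[OF trig_mult_const] trig_mult_cis)
  ultimately show ?case by simp
next
  case (const c)
  then show ?case by (rule trig_mult_const)
next
  case (add f g)
  then show ?case using trig_mult_add by fastforce
next
  case (mult f g)
  then show ?case using trig_mult_mult by fastforce
qed

text \<open>Stone-Weierstrass is applied on the unit circle rather than on the interval: composing
  with \<open>cis\<close> makes every function periodic, so no condition at the endpoints
  arises.\<close>

lemma trig_mult_continuous:
  fixes \<phi> :: "complex \<Rightarrow> real"
  assumes "continuous_on UNIV \<phi>"
  shows "(\<lambda>x. complex_of_real (\<phi> (cis (2 * pi * x j)))) \<in> trig_mult d"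
proof -
  have cont: "continuous_on (sphere 0 1) \<phi>"
    using assms continuous_on_subset by blast
  have "\<forall>n. \<exists>p. real_polynomial_function p \<and> (\<forall>z\<in>sphere 0 1. \<bar>\<phi> z - p z\<bar> < 1 / real (Suc n))"
  proof
    fix n
    show "\<exists>p. real_polynomial_function p \<and> (\<forall>z\<in>sphere 0 1. \<bar>\<phi> z - p z\<bar> < 1 / real (Suc n))"
      by (rule Stone_Weierstrass_real_polynomial_function[OF compact_sphere cont, of "1 / real (Suc n)"])
        (simp, blast)
  qed
  then obtain p where "\<forall>n. real_polynomial_function (p n) \<and> (\<forall>z\<in>sphere 0 1. \<bar>\<phi> z - p n z\<bar> < 1 / real (Suc n))"
    by (rule choice[THEN exE])
  then have p: "\<And>n. real_polynomial_function (p n)"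
      "\<And>n z. z \<in> sphere 0 1 \<Longrightarrow> \<bar>\<phi> z - p n z\<bar> < 1 / real (Suc n)"
    by blast+
  obtain B where B: "\<And>z. z \<in> sphere 0 1 \<Longrightarrow> \<bar>\<phi> z\<bar> \<le> B"
    using compact_imp_bounded[OF compact_continuous_image[OF cont compact_sphere]]
    by (metis bounded_iff imageI real_norm_def)
  \<comment> \<open>Approximation errors are at most 1, which yields one bound for all
    \<open>p n\<close>, as bounded convergence requires.\<close>
  have pB: "\<bar>p n z\<bar> \<le> B + 1" if "z \<in> sphere 0 1" for n z
  proof -
    have "1 / real (Suc n) \<le> 1" by simp
    then show ?thesis using p(2)[OF that, of n] B[OF that] by linarith
  qed
  have lim: "(\<lambda>n. p n z) \<longlonglongrightarrow> \<phi> z" if "z \<in> sphere 0 1" for z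
  proof (rule LIMSEQ_I)
    fix r :: real assume "0 < r"
    then obtain N where N: "inverse (real (Suc N)) < r" using reals_Archimedean by blast
    show "\<exists>no. \<forall>n\<ge>no. norm (p n z - \<phi> z) < r"
    proof (intro exI allI impI)
      fix n assume "n \<ge> N"
      then have "1 / real (Suc n) \<le> inverse (real (Suc N))" by (simp add: field_simps)
      then show "norm (p n z - \<phi> z) < r" using p(2)[OF that, of n] N by simp
    qed
  qed
  show ?thesis
  proof (rule trig_mult_limit)
    have "\<phi> \<in> borel_measurable borel"
      using assms by (rule borel_measurable_continuous_onI)
    moreover have "(\<lambda>x. cis (2 * pi * x j)) \<in> borel_measurable (cube d)"
      using trig_mult_cis(1) by (rule trig_mult_measurable)
    ultimately show "(\<lambda>x. complex_of_real (\<phi> (cis (2 * pi * x j)))) \<in> borel_measurable (cube d)"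
      by measurable
    show "(\<lambda>x. complex_of_real (p n (cis (2 * pi * x j)))) \<in> trig_mult d" for n
      by (rule trig_mult_polynomial[OF p(1)])
    show "AE x in cube d. (\<lambda>n. complex_of_real (p n (cis (2 * pi * x j)))) \<longlonglongrightarrow> complex_of_real (\<phi> (cis (2 * pi * x j)))"
      by (intro AE_I2 tendsto_of_real lim) simp
    show "cmod (complex_of_real (p n (cis (2 * pi * x j)))) \<le> B + 1" for n x
      using pB by simp
    show "cmod (complex_of_real (\<phi> (cis (2 * pi * x j)))) \<le> B + 1" for x
      using B[of "cis (2 * pi * x j)"] by simp
  qed
qed

text \<open>The indicator of a closed set is the bounded pointwise limit of the continuous functions
  \<open>max 0 (1 - n * infdist z C)\<close>.\<close>

lemma trig_mult_closed_arc:
  fixes C :: "complex set"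
  assumes C: "closed C"
  shows "(\<lambda>x. indicator C (cis (2 * pi * x j))) \<in> trig_mult d"
\<comment> \<open>By convention \<open>infdist z {} = 0\<close>, so for empty \<open>C\<close> the
  approximating functions would tend to 1.\<close>
proof (cases "C = {}")
  case True
  then show ?thesis using trig_mult_const[of 0 d] by simp
next
  case False
  define \<phi> where "\<phi> n z = max 0 (1 - real n * infdist z C)" for n z
  show ?thesis
  proof (rule trig_mult_limit)
    have "(\<lambda>x. cis (2 * pi * x j)) \<in> borel_measurable (cube d)"
      using trig_mult_cis(1) by (rule trig_mult_measurable)
    moreover have "C \<in> sets borel" using C by simp
    ultimately show "(\<lambda>x. indicator C (cis (2 * pi * x j)) :: complex) \<in> borel_measurable (cube d)"
      by measurable
    show "(\<lambda>x. complex_of_real (\<phi> n (cis (2 * pi * x j)))) \<in> trig_mult d" for n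
      unfolding \<phi>_def by (intro trig_mult_continuous continuous_intros)
    have "(\<lambda>n. \<phi> n z) \<longlonglongrightarrow> indicator C z" for z
    proof (cases "z \<in> C")
      case True
      then show ?thesis by (simp add: \<phi>_def)
    next
      case z: False
      then have pos: "infdist z C > 0"
        using C False by (simp add: infdist_pos_not_in_closed)
      have "eventually (\<lambda>n. \<phi> n z = 0) sequentially"
        using eventually_ge_at_top[of "nat \<lceil>1 / infdist z C\<rceil>"]
      proof eventually_elim
        case (elim n)
        then have "1 / infdist z C \<le> real n" by linarith
        then show ?case using pos by (simp add: \<phi>_def field_simps)
      qed
      then show ?thesis using z by (simp add: tendsto_eventually)
    qed
    then have "(\<lambda>n. complex_of_real (\<phi> n z)) \<longlonglongrightarrow> complex_of_real (indicator C z)" for z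
      by (intro tendsto_of_real)
    then show "AE x in cube d. (\<lambda>n. complex_of_real (\<phi> n (cis (2 * pi * x j)))) \<longlonglongrightarrow> indicator C (cis (2 * pi * x j))"
      by (simp add: indicator_def of_bool_def if_distrib cong: if_cong)
    show "cmod (complex_of_real (\<phi> n (cis (2 * pi * x j)))) \<le> 1" for n x
      by (auto simp: \<phi>_def infdist_nonneg)
    show "cmod (indicator C (cis (2 * pi * x j))) \<le> 1" for x
      by (simp add: indicator_def)
  qed
qed

end

section \<open>From one coordinate to all measurable sets\<close>

lemma space_cube: "space (cube d) = (\<Pi>\<^sub>E j\<in>{1..d}. {0..1})"
  by (simp add: cube_def space_PiM space_restrict_space)

lemma AE_cube_interior:
  assumes "j \<in> {1..d}"
  shows "AE x in cube d. 0 < x j \<and> x j < 1"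
  unfolding cube_def
proof (rule AE_PiM_component[OF prob_space_unit_interval assms])
  have "AE x in lborel. x \<noteq> (0::real)" "AE x in lborel. x \<noteq> (1::real)"
    by (rule AE_lborel_singleton)+
  then have "AE x in lborel. x \<in> {0..1} \<longrightarrow> 0 < x \<and> x < (1::real)"
    by eventually_elim auto
  then show "AE x in restrict_space lborel {0..1}. 0 < x \<and> x < (1::real)"
    by (subst AE_restrict_space_iff) auto
qed

lemma cis_2pi_inj:
  assumes "cis (2 * pi * x) = cis (2 * pi * y)" "0 < x" "x < 1" "0 < y" "y < 1"
  shows "x = y"
proof -
  have "cis (2 * pi * (x - y)) = 1"
    using assms(1) by (simp add: right_diff_distrib flip: cis_divide)
  then have "cos (2 * pi * (x - y)) = 1"
    by (simp add: complex_eq_iff)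
  then obtain n :: int where "2 * pi * (x - y) = of_int n * 2 * pi"
    unfolding cos_one_2pi_int by blast
  then have n: "x - y = of_int n" by simp
  with assms have "of_int n < (1::real)" "of_int n > (-1::real)" by linarith+
  then have "n = 0" by linarith
  with n show ?thesis by simp
qed

text \<open>The indicator of a closed set of coordinate values is not continuous on the torus;
  exhausting the open interval by the compact intervals from \<open>1/n\<close> to \<open>1 - 1/n\<close> avoids the
  identification of the endpoints.\<close>

lemma trig_mult_coordinate_closed:
  fixes C :: "real set"
  assumes C: "closed C" and j: "j \<in> {1..d}"
  shows "(\<lambda>x. indicator C (x j)) \<in> trig_mult d"
proof (rule trig_mult_limit)
  define K where "K n = C \<inter> {1 / real (Suc n)..1 - 1 / real (Suc n)}" for n
  define D where "D n = (\<lambda>t. cis (2 * pi * t)) ` K n" for n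
  have "compact (K n)" for n
    unfolding K_def using C by (intro closed_Int_compact) auto
  then have "compact (D n)" for n
    unfolding D_def by (intro compact_continuous_image continuous_intros)
  then have "closed (D n)" for n by (rule compact_imp_closed)
  then show "(\<lambda>x. indicator (D n) (cis (2 * pi * x j))) \<in> trig_mult d" for n
    by (rule trig_mult_closed_arc[OF j])
  have "C \<in> sets borel" using C by simp
  then show "(\<lambda>x. indicator C (x j) :: complex) \<in> borel_measurable (cube d)"
    using component_measurable[OF j] by measurable
  show "AE x in cube d. (\<lambda>n. indicator (D n) (cis (2 * pi * x j)) :: complex) \<longlonglongrightarrow> indicator C (x j)"
    using AE_cube_interior[OF j]
  proof eventually_elim
    case (elim x)
    have D_iff: "cis (2 * pi * x j) \<in> D n \<longleftrightarrow> x j \<in> K n" for n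
    proof
      assume "cis (2 * pi * x j) \<in> D n"
      then obtain t where t: "t \<in> K n" "cis (2 * pi * x j) = cis (2 * pi * t)"
        by (auto simp: D_def)
      have "0 < 1 / real (Suc n)" by simp
      moreover have "1 / real (Suc n) \<le> t" "t \<le> 1 - 1 / real (Suc n)" using t(1) unfolding K_def by auto
      ultimately have "0 < t" "t < 1" by linarith+
      with t elim show "x j \<in> K n" using cis_2pi_inj[of "x j" t] by simp
    qed (auto simp: D_def)
    have "eventually (\<lambda>n. 1 / real (Suc n) < x j) sequentially"
      "eventually (\<lambda>n. 1 / real (Suc n) < 1 - x j) sequentially"
      using elim by real_asymp+
    then have "eventually (\<lambda>n. (indicator (D n) (cis (2 * pi * x j)) :: complex) = indicator C (x j)) sequentially"
      by eventually_elim (auto simp: indicator_def D_iff K_def)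
    then show ?case by (rule tendsto_eventually)
  qed
  show "cmod (indicator (D n) (cis (2 * pi * x j))) \<le> 1" "cmod (indicator C (x j)) \<le> 1" for n x
    by (simp_all add: indicator_def)
qed

lemma trig_mult_cong:
  assumes "h \<in> trig_mult d" "\<And>x. x \<in> space (cube d) \<Longrightarrow> h x = k x"
  shows "k \<in> trig_mult d"
proof -
  obtain B where B: "\<And>x. x \<in> space (cube d) \<Longrightarrow> cmod (h x) \<le> B"
    using assms(1) by (auto simp: trig_mult_def)
  show ?thesis
  proof (rule trig_mult_limit[where H="\<lambda>_. h" and B=B])
    show "k \<in> borel_measurable (cube d)"
      using trig_mult_measurable[OF assms(1)] assms(2) by (simp cong: measurable_cong)
  qed (use assms B in auto)
qed

text \<open>Finite unions follow from inclusion-exclusion, which uses products of multipliers; the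
  countable union is a bounded pointwise limit of these.\<close>

lemma trig_mult_indicator_Union:
  fixes A :: "nat \<Rightarrow> (nat \<Rightarrow> real) set"
  assumes A: "\<And>n. indicator (A n) \<in> trig_mult d"
  shows "indicator (\<Union>n. A n) \<in> trig_mult d"
proof (rule trig_mult_limit)
  have *: "(indicator (\<Union>i\<le>n. A i) :: _ \<Rightarrow> complex) \<in> trig_mult d" for n
  proof (induction n)
    case 0
    then show ?case using A[of 0] by simp
  next
    case (Suc n)
    have "indicator (\<Union>i\<le>Suc n. A i)
      = (\<lambda>x. (indicator (\<Union>i\<le>n. A i) x + indicator (A (Suc n)) x :: complex)
          - indicator (\<Union>i\<le>n. A i) x * indicator (A (Suc n)) x)"
      by (auto simp: fun_eq_iff indicator_def atMost_Suc)
    then show ?case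
      using trig_mult_diff[OF trig_mult_add[OF Suc A[of "Suc n"]] trig_mult_mult[OF Suc A[of "Suc n"]]]
      by simp
  qed
  show "indicator (\<Union>i\<le>n. A i) \<in> trig_mult d" for n by (rule *)
  have lim: "(\<lambda>n. indicator (\<Union>i\<le>n. A i) x :: complex) \<longlonglongrightarrow> indicator (\<Union>i. A i) x" for x
    using LIMSEQ_Suc[OF LIMSEQ_indicator_UN[of A x]] by (simp add: lessThan_Suc_atMost)
  then show "AE x in cube d. (\<lambda>n. indicator (\<Union>i\<le>n. A i) x :: complex) \<longlonglongrightarrow> indicator (\<Union>i. A i) x"
    by simp
  show "(indicator (\<Union>i. A i) :: _ \<Rightarrow> complex) \<in> borel_measurable (cube d)"
    by (rule borel_measurable_LIMSEQ_metric[OF trig_mult_measurable[OF *] lim])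
  show "cmod (indicator (\<Union>i\<le>n. A i) x) \<le> 1" "cmod (indicator (\<Union>i. A i) x) \<le> 1" for n x
    by (simp_all add: indicator_def)
qed

text \<open>Sets whose indicator is a multiplier are closed under complement and arbitrary countable
  union, hence induction over the generated sigma-algebra works directly, without a Dynkin
  system.\<close>

lemma trig_mult_coordinate_borel:
  fixes B :: "real set"
  assumes "B \<in> sets borel" and j: "j \<in> {1..d}"
  shows "(\<lambda>x. indicator B (x j)) \<in> trig_mult d"
proof -
  have "B \<in> sigma_sets UNIV (Collect closed)"
    using assms(1) unfolding borel_eq_closed by simp
  then have "indicator ((\<lambda>x. x j) -` B) \<in> trig_mult d"
  proof induction
    case (Basic C)
    then have "(\<lambda>x. indicator C (x j)) \<in> trig_mult d" by (intro trig_mult_coordinate_closed j) auto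
    then show ?case by (rule trig_mult_cong) (simp add: indicator_def)
  next
    case Empty
    then show ?case using trig_mult_const[of 0] by (simp add: indicator_def)
  next
    case (Compl C)
    have "(\<lambda>x. 1 - indicator ((\<lambda>x. x j) -` C) x) \<in> trig_mult d"
      by (rule trig_mult_diff[OF trig_mult_const Compl.IH])
    also have "(\<lambda>x. 1 - indicator ((\<lambda>x. x j) -` C) x)
        = (indicator ((\<lambda>x. x j) -` (UNIV - C)) :: (nat \<Rightarrow> real) \<Rightarrow> complex)"
      by (auto simp: indicator_def fun_eq_iff)
    finally show ?case .
  next
    case (Union C)
    then show ?case using trig_mult_indicator_Union[of "\<lambda>n. (\<lambda>x. x j) -` C n"] by (simp add: vimage_UN)
  qed
  then show ?thesis
    by (rule trig_mult_cong) (simp add: indicator_def)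
qed

text \<open>The product sigma-algebra is generated by conditions on a single coordinate. Sets
  involving several coordinates arise from the closure properties, so no rectangles have to be
  treated.\<close>

lemma trig_mult_indicator:
  assumes "A \<in> sets (cube d)"
  shows "indicator A \<in> trig_mult d"
proof -
  let ?\<Omega> = "\<Pi>\<^sub>E j\<in>{1..d}. {0..1::real}"
  have "A \<in> sigma_sets ?\<Omega> {{f\<in>?\<Omega>. f j \<in> B} | j B. j \<in> {1..d} \<and> B \<in> sets (restrict_space lborel {0..1})}"
    using assms unfolding cube_def sets_PiM_single by (simp add: space_restrict_space)
  then show ?thesis
  proof induction
    case (Basic A)
    then obtain j B where jB: "j \<in> {1..d}" "B \<in> sets (restrict_space lborel {0..1})"
        "A = {f\<in>?\<Omega>. f j \<in> B}"
      by blast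
    have "B \<in> sets borel" using jB(2) by (auto simp: sets_restrict_space)
    then have "(\<lambda>x. indicator B (x j)) \<in> trig_mult d" using jB(1) by (rule trig_mult_coordinate_borel)
    then show ?case
      by (rule trig_mult_cong) (simp add: jB(3) space_cube indicator_def)
  next
    case Empty
    then show ?case using trig_mult_const[of 0] by (simp add: indicator_def)
  next
    case (Compl A)
    have "(\<lambda>x. 1 - indicator A x) \<in> trig_mult d"
      by (rule trig_mult_diff[OF trig_mult_const Compl.IH])
    then show ?case
      by (rule trig_mult_cong) (auto simp: space_cube indicator_def)
  next
    case (Union A)
    then show ?case by (intro trig_mult_indicator_Union)
  qed
qed

section \<open>Completeness of the characters\<close>

lemma trig_closure_cong:
  assumes "f \<in> trig_closure d" "\<And>x. x \<in> space (cube d) \<Longrightarrow> f x = g x"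
  shows "g \<in> trig_closure d"
proof (rule trig_closure_dominated[where F="\<lambda>_. f" and g=f])
  show "g \<in> borel_measurable (cube d)"
    using L2_measurable[OF trig_closure_L2[OF assms(1)]] assms(2) by (simp cong: measurable_cong)
qed (use assms trig_closure_L2 in auto)

text \<open>The function on which multipliers act: a multiplier applied to 1 is itself in the
  closure.\<close>

lemma one_trig_closure: "(\<lambda>_. 1) \<in> trig_closure d"
proof (rule trig_poly_closure)
  have "(\<lambda>x. \<Sum>k\<in>{\<lambda>_. 0}. 1 * trig d k x) \<in> trig_poly d"
    by (rule trig_polyI) (auto simp: freqs_def)
  then show "(\<lambda>_. 1) \<in> trig_poly d" by (simp add: trig_def)
qed

lemma trig_closure_indicator: "A \<in> sets (cube d) \<Longrightarrow> indicator A \<in> trig_closure d"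
  using trig_mult_indicator[of A d] one_trig_closure[of d] by (fastforce simp: trig_mult_def)

lemma trig_closure_sum:
  "(\<And>i. i \<in> I \<Longrightarrow> f i \<in> trig_closure d) \<Longrightarrow> (\<lambda>x. \<Sum>i\<in>I. f i x) \<in> trig_closure d"
proof (induction I rule: infinite_finite_induct)
  case (insert i I)
  then show ?case by (auto intro: trig_closure_add)
qed (use trig_closure_scale[OF one_trig_closure, of 0] in auto)

lemma trig_closure_simple:
  assumes "simple_function (cube d) s"
  shows "s \<in> trig_closure d"
proof -
  have fin: "finite (s ` space (cube d))"
    and meas: "\<And>y. s -` {y} \<inter> space (cube d) \<in> sets (cube d)"
    using assms by (auto intro: simple_functionD)
  have "(\<lambda>x. \<Sum>y\<in>s ` space (cube d). y * indicator (s -` {y} \<inter> space (cube d)) x) \<in> trig_closure d"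
    by (intro trig_closure_sum trig_closure_scale trig_closure_indicator meas)
  then show ?thesis
  proof (rule trig_closure_cong)
    fix x assume x: "x \<in> space (cube d)"
    have "(\<Sum>y\<in>s ` space (cube d). y * indicator (s -` {y} \<inter> space (cube d)) x)
        = (\<Sum>y\<in>s ` space (cube d). if s x = y then y else 0)"
      using x by (intro sum.cong) auto
    also have "\<dots> = s x" using fin x by simp
    finally show "(\<Sum>y\<in>s ` space (cube d). y * indicator (s -` {y} \<inter> space (cube d)) x) = s x" .
  qed
qed

text \<open>Simple functions can be chosen to converge pointwise to \<open>f\<close> with modulus at
  most twice that of \<open>f\<close>, a square integrable majorant.\<close>

theorem L2_eq_trig_closure: "L2 d = trig_closure d"
proof (intro equalityI subsetI trig_closure_L2)
  fix f assume f: "f \<in> L2 d"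
  obtain s where s: "\<And>i. simple_function (cube d) (s i)"
      "\<And>x. x \<in> space (cube d) \<Longrightarrow> (\<lambda>i. s i x) \<longlonglongrightarrow> f x"
      "\<And>i x. x \<in> space (cube d) \<Longrightarrow> dist (s i x) 0 \<le> 2 * dist (f x) 0"
    using borel_measurable_implies_sequence_metric[OF L2_measurable[OF f], of 0] by blast
  show "f \<in> trig_closure d"
  proof (rule trig_closure_dominated[OF L2_measurable[OF f]])
    show "s i \<in> trig_closure d" for i by (rule trig_closure_simple[OF s(1)])
    show "(\<lambda>x. 2 * f x) \<in> L2 d" by (rule L2_scale[OF f])
    show "AE x in cube d. (\<lambda>i. s i x) \<longlonglongrightarrow> f x" using s(2) by (rule AE_I2)
    show "cmod (s i x) \<le> cmod (2 * f x)" if "x \<in> space (cube d)" for i x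
      using s(3)[OF that, of i] by (simp add: norm_mult)
  qed
qed

text \<open>The part of Parseval's identity that the error estimate uses, phrased through finite
  sets. Completeness supplies a polynomial with some finite spectrum \<open>T\<close> close to
  \<open>f\<close>; projecting onto \<open>S \<union> T\<close> is at least as good, and the
  coefficients in \<open>T - S\<close> contribute at most \<open>B\<close>.\<close>

lemma parseval_remainder:
  assumes f: "f \<in> L2 d" and S: "finite S" "S \<subseteq> freqs d"
    and bound: "\<And>T. finite T \<Longrightarrow> T \<subseteq> freqs d - S \<Longrightarrow> (\<Sum>k\<in>T. (cmod (fourier d f k))\<^sup>2) \<le> B"
  shows "(LINT x|cube d. (cmod (f x - (\<Sum>k\<in>S. fourier d f k * trig d k x)))\<^sup>2) \<le> B"
proof (rule field_le_epsilon)
  fix e :: real assume "e > 0"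
  with f obtain p where p: "p \<in> trig_poly d" "(LINT x|cube d. (cmod (f x - p x))\<^sup>2) < e"
    unfolding L2_eq_trig_closure by (rule trig_closureE)
  obtain T c where T: "finite T" "T \<subseteq> freqs d" "p = (\<lambda>x. \<Sum>k\<in>T. c k * trig d k x)"
    using p(1) by (rule trig_polyE)
  let ?c = "\<lambda>k. (cmod (fourier d f k))\<^sup>2"
  have "(LINT x|cube d. (cmod (f x))\<^sup>2) - sum ?c T \<le> (LINT x|cube d. (cmod (f x - p x))\<^sup>2)"
    unfolding T(3) integral_square_diff_trig_sum_real[OF f T(1,2)] by (simp add: sum_nonneg)
  moreover have "sum ?c T \<le> sum ?c (S \<union> (T - S))"
    using S T by (intro sum_mono2) auto
  moreover have "sum ?c (S \<union> (T - S)) = sum ?c S + sum ?c (T - S)"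
    using S T by (intro sum.union_disjoint) auto
  moreover have "sum ?c (T - S) \<le> B" using T by (intro bound) auto
  ultimately have "(LINT x|cube d. (cmod (f x))\<^sup>2) - sum ?c S \<le> B + e" using p(2) by linarith
  then show "(LINT x|cube d. (cmod (f x - (\<Sum>k\<in>S. fourier d f k * trig d k x)))\<^sup>2) \<le> B + e"
    unfolding integral_square_diff_trig_sum_real[OF f S] by simp
qed

subsection \<open>Information complexity as a lattice point count\<close>

text \<open>More unknowns than equations, solved by Gaussian elimination. Either the last equation
  is void, or a pivot \<open>k0\<close> removes one unknown together with that equation.\<close>

lemma homogeneous_system_nontrivial:
  fixes M :: "'a \<Rightarrow> nat \<Rightarrow> 'f::field"
  assumes "finite S" "m < card S"
  shows "\<exists>c. (\<exists>k\<in>S. c k \<noteq> 0) \<and> (\<forall>i<m. (\<Sum>k\<in>S. c k * M k i) = 0)"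
  using assms
proof (induction m arbitrary: S M)
  case 0
  then have "S \<noteq> {}" by auto
  then show ?case by (intro exI[of _ "\<lambda>_. 1"]) auto
next
  case (Suc m)
  show ?case
  proof (cases "\<forall>k\<in>S. M k m = 0")
    case True
    obtain c where "\<exists>k\<in>S. c k \<noteq> 0" "\<forall>i<m. (\<Sum>k\<in>S. c k * M k i) = 0"
      using Suc.IH[of S M] Suc.prems by auto
    with True show ?thesis by (intro exI[of _ c]) (auto simp: less_Suc_eq)
  next
    case False
    then obtain k0 where k0: "k0 \<in> S" "M k0 m \<noteq> 0" by blast
    define T where "T = S - {k0}"
    have T: "finite T" "m < card T" "k0 \<notin> T" "S = insert k0 T"
      using Suc.prems k0(1) by (auto simp: T_def)
    obtain c where c: "\<exists>k\<in>T. c k \<noteq> 0"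
        "\<forall>i<m. (\<Sum>k\<in>T. c k * (M k i - M k m / M k0 m * M k0 i)) = 0"
      using Suc.IH[OF T(1,2), of "\<lambda>k i. M k i - M k m / M k0 m * M k0 i"] by blast
    \<comment> \<open>Back substitution: the value at the pivot is the one that makes the eliminated
      equation hold.\<close>
    define e where "e = c(k0 := - (\<Sum>k\<in>T. c k * (M k m / M k0 m)))"
    have e: "(\<Sum>k\<in>S. e k * M k i) = (\<Sum>k\<in>T. c k * (M k i - M k m / M k0 m * M k0 i))" for i
    proof -
      have "(\<Sum>k\<in>T. e k * M k i) = (\<Sum>k\<in>T. c k * M k i)"
        using T(3) by (intro sum.cong) (auto simp: e_def)
      moreover have "e k0 = - (\<Sum>k\<in>T. c k * (M k m / M k0 m))" by (simp add: e_def)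
      ultimately show ?thesis
        using T by (simp add: right_diff_distrib sum_subtractf sum_distrib_right mult.assoc)
    qed
    show ?thesis
    proof (intro exI[of _ e] conjI allI impI)
      show "\<exists>k\<in>S. e k \<noteq> 0" using c(1) T(3,4) by (auto simp: e_def)
      fix i assume "i < Suc m"
      then show "(\<Sum>k\<in>S. e k * M k i) = 0"
        unfolding e using c(2) k0(2) by (cases "i = m") auto
    qed
  qed
qed

section \<open>Errors of operators of finite rank\<close>

lemma Wweight_ge_1: "1 \<le> Wweight b d k"
  by (simp add: Wweight_def sum_nonneg)

lemma Wweight_pos: "0 < Wweight b d k"
  using Wweight_ge_1[of b d k] by linarith

lemma trig_sum_Wspace:
  assumes S: "finite S" "S \<subseteq> freqs d"
  shows "(\<lambda>x. \<Sum>k\<in>S. c k * trig d k x) \<in> Wspace b d"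
    and "Wnorm b d (\<lambda>x. \<Sum>k\<in>S. c k * trig d k x) = sqrt (\<Sum>k\<in>S. Wweight b d k * (cmod (c k))\<^sup>2)"
    and "L2norm d (\<lambda>x. \<Sum>k\<in>S. c k * trig d k x) = sqrt (\<Sum>k\<in>S. (cmod (c k))\<^sup>2)"
proof -
  let ?f = "\<lambda>x. \<Sum>k\<in>S. c k * trig d k x"
  have L2: "?f \<in> L2 d" by (intro L2_sum L2_scale trig_L2)
  have "(\<lambda>k. Wweight b d k * (cmod (fourier d ?f k))\<^sup>2) summable_on S"
    using S(1) by (rule summable_on_finite)
  also have "?this \<longleftrightarrow> (\<lambda>k. Wweight b d k * (cmod (fourier d ?f k))\<^sup>2) summable_on freqs d"
    using S by (intro summable_on_cong_neutral) (auto simp: fourier_trig_sum)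
  finally show "?f \<in> Wspace b d" using L2 by (simp add: Wspace_def)
  have "(\<Sum>\<^sub>\<infinity>k\<in>freqs d. Wweight b d k * (cmod (fourier d ?f k))\<^sup>2)
      = (\<Sum>\<^sub>\<infinity>k\<in>S. Wweight b d k * (cmod (c k))\<^sup>2)"
    using S by (intro infsum_cong_neutral) (auto simp: fourier_trig_sum subset_iff)
  then show "Wnorm b d ?f = sqrt (\<Sum>k\<in>S. Wweight b d k * (cmod (c k))\<^sup>2)"
    using S(1) by (simp add: Wnorm_def)
  have "(\<Sum>k\<in>S. (cmod (fourier d ?f k))\<^sup>2) = (\<Sum>k\<in>S. (cmod (c k))\<^sup>2)"
    using S by (intro sum.cong) (auto simp: fourier_trig_sum subset_iff)
  moreover have "(\<Sum>k\<in>S. (cmod (c k - fourier d ?f k))\<^sup>2) = 0"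
    using S by (intro sum.neutral) (auto simp: fourier_trig_sum subset_iff)
  ultimately show "L2norm d ?f = sqrt (\<Sum>k\<in>S. (cmod (c k))\<^sup>2)"
    using integral_square_diff_trig_sum_real[OF L2 S, of c] by (simp add: L2norm_def)
qed

lemma trig_Wspace: "k \<in> freqs d \<Longrightarrow> trig d k \<in> Wspace b d"
  using trig_sum_Wspace(1)[of "{k}" d "\<lambda>_. 1" b] by simp

lemma admissible_trig_sum:
  assumes A: "admissible b d n A" and S: "finite S" "S \<subseteq> freqs d"
  shows "A (\<lambda>x. \<Sum>k\<in>S. c k * trig d k x) = (\<lambda>x. \<Sum>k\<in>S. c k * A (trig d k) x)"
proof -
  have lin: "A (\<lambda>x. a * f x + e * g x) = (\<lambda>x. a * A f x + e * A g x)"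
    if "f \<in> Wspace b d" "g \<in> Wspace b d" for f g a e
    using A that by (auto simp: admissible_def)
  show ?thesis
    using S
  proof (induction S)
    case empty
    \<comment> \<open>That \<open>A\<close> sends 0 to 0 is linearity with both coefficients 0,
      which needs some element of the space; the constant character serves.\<close>
    have "(\<lambda>_. 0) \<in> freqs d" by (simp add: freqs_def)
    from lin[OF this[THEN trig_Wspace] this[THEN trig_Wspace], of 0 0] show ?case by simp
  next
    case (insert k S)
    have "A (\<lambda>x. c k * trig d k x + 1 * (\<Sum>k\<in>S. c k * trig d k x))
        = (\<lambda>x. c k * A (trig d k) x + 1 * A (\<lambda>x. \<Sum>k\<in>S. c k * trig d k x) x)"
      using insert by (intro lin trig_Wspace trig_sum_Wspace) auto
    with insert show ?case by simp
  qed
qed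

text \<open>An operator of rank below \<open>card S\<close> annihilates a nonzero sum of characters
  from \<open>S\<close>. On it the error is the whole \<open>L2\<close> norm, and the Sobolev norm
  is at most \<open>sqrt w\<close> times that.\<close>

lemma op_err_lower:
  assumes A: "admissible b d n A" and S: "finite S" "S \<subseteq> freqs d" "n \<le> card S"
    and w: "\<And>k. k \<in> S \<Longrightarrow> Wweight b d k \<le> w" "w > 0"
  shows "ereal (1 / sqrt w) \<le> op_err b d A"
proof -
  obtain m G where mG: "m < n" "\<forall>f\<in>Wspace b d. \<exists>c. A f = (\<lambda>x. \<Sum>i<m. c i * G i x)"
    using A unfolding admissible_def by blast
  have "\<forall>k\<in>S. \<exists>c. A (trig d k) = (\<lambda>x. \<Sum>i<m. c i * G i x)"
    using mG(2) trig_Wspace S(2) by blast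
  then obtain M where M: "\<And>k. k \<in> S \<Longrightarrow> A (trig d k) = (\<lambda>x. \<Sum>i<m. M k i * G i x)"
    using bchoice[of S] by metis
  obtain a where a: "\<exists>k\<in>S. a k \<noteq> 0" "\<And>i. i < m \<Longrightarrow> (\<Sum>k\<in>S. a k * M k i) = 0"
    using homogeneous_system_nontrivial[of S m M] S mG(1) by auto
  \<comment> \<open>Normalisation: dividing by \<open>sqrt r\<close> makes the squared
    \<open>L2\<close> norm equal to \<open>1 / w\<close>, which puts the function into the Sobolev
    unit ball.\<close>
  define r where "r = w * (\<Sum>k\<in>S. (cmod (a k))\<^sup>2)"
  have apos: "(\<Sum>k\<in>S. (cmod (a k))\<^sup>2) > 0"
    using a(1) S(1) by (auto intro!: sum_pos2)
  then have r: "r > 0" using w(2) by (simp add: r_def)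
  define c where "c k = a k / of_real (sqrt r)" for k
  have cmod_c: "(cmod (c k))\<^sup>2 = (cmod (a k))\<^sup>2 / r" for k
    using r by (simp add: c_def norm_divide power_divide)
  have sum_c: "(\<Sum>k\<in>S. (cmod (c k))\<^sup>2) = 1 / w"
    using apos w(2) by (simp add: cmod_c r_def flip: sum_divide_distrib)
  define f where "f = (\<lambda>x. \<Sum>k\<in>S. c k * trig d k x)"
  have "A f x = 0" for x
  proof -
    have "A f x = (\<Sum>k\<in>S. c k * (\<Sum>i<m. M k i * G i x))"
      unfolding f_def admissible_trig_sum[OF A S(1,2)] using M by simp
    also have "\<dots> = (\<Sum>k\<in>S. \<Sum>i<m. G i x / of_real (sqrt r) * (a k * M k i))"
      by (simp add: sum_distrib_left c_def mult_ac)
    also have "\<dots> = (\<Sum>i<m. G i x / of_real (sqrt r) * (\<Sum>k\<in>S. a k * M k i))"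
      by (subst sum.swap) (simp add: sum_distrib_left)
    also have "\<dots> = 0" using a(2) by simp
    finally show ?thesis .
  qed
  then have "L2norm d (\<lambda>x. f x - A f x) = L2norm d f" by simp
  also have "\<dots> = 1 / sqrt w"
    unfolding f_def trig_sum_Wspace(3)[OF S(1,2)] sum_c by (simp add: real_sqrt_divide)
  finally have err: "L2norm d (\<lambda>x. f x - A f x) = 1 / sqrt w" .
  have "(\<Sum>k\<in>S. Wweight b d k * (cmod (c k))\<^sup>2) \<le> (\<Sum>k\<in>S. w * (cmod (c k))\<^sup>2)"
    using w(1) by (intro sum_mono mult_right_mono) auto
  also have "\<dots> = 1" using sum_c w(2) by (simp flip: sum_distrib_left)
  finally have "Wnorm b d f \<le> 1"
    unfolding f_def trig_sum_Wspace(2)[OF S(1,2)] by simp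
  moreover have "f \<in> Wspace b d" unfolding f_def by (rule trig_sum_Wspace(1)[OF S(1,2)])
  ultimately show ?thesis
    unfolding op_err_def err[symmetric] by (intro SUP_upper) simp
qed

lemma fourier_projection_admissible:
  assumes S: "finite S" "S \<subseteq> freqs d"
  shows "admissible b d (card S + 1) (\<lambda>f x. \<Sum>k\<in>S. fourier d f k * trig d k x)"
  unfolding admissible_def
proof (intro conjI ballI allI)
  show "(\<lambda>x. \<Sum>k\<in>S. fourier d f k * trig d k x) \<in> L2 d" for f
    by (intro L2_sum L2_scale trig_L2)
  fix f g c1 c2 assume "f \<in> Wspace b d" "g \<in> Wspace b d"
  then have "f \<in> L2 d" "g \<in> L2 d" by (auto simp: Wspace_def)
  then show "(\<lambda>x. \<Sum>k\<in>S. fourier d (\<lambda>x. c1 * f x + c2 * g x) k * trig d k x) =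
      (\<lambda>x. c1 * (\<Sum>k\<in>S. fourier d f k * trig d k x) + c2 * (\<Sum>k\<in>S. fourier d g k * trig d k x))"
    by (simp add: fourier_lincomb distrib_right sum.distrib sum_distrib_left mult.assoc)
next
  obtain h where h: "bij_betw h {..<card S} S"
    using ex_bij_betw_nat_finite[OF S(1)] by (auto simp: atLeast0LessThan)
  show "\<exists>m<card S + 1. \<exists>G. \<forall>f\<in>Wspace b d. \<exists>c. (\<lambda>x. \<Sum>k\<in>S. fourier d f k * trig d k x) = (\<lambda>x. \<Sum>i<m. c i * G i x)"
  proof (intro exI[of _ "card S"] conjI exI[of _ "\<lambda>i. trig d (h i)"] ballI)
    fix f
    show "\<exists>c. (\<lambda>x. \<Sum>k\<in>S. fourier d f k * trig d k x) = (\<lambda>x. \<Sum>i<card S. c i * trig d (h i) x)"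
      by (intro exI[of _ "\<lambda>i. fourier d f (h i)"])
        (simp add: sum.reindex_bij_betw[OF h, of "\<lambda>k. fourier d f k * trig d k _"] fun_eq_iff)
  qed simp
qed

text \<open>Outside \<open>S\<close> the weight is at least \<open>1 / e\<^sup>2\<close>, so the
  tail of squared coefficients is at most \<open>e\<^sup>2\<close> times the squared Sobolev
  norm.\<close>

lemma fourier_projection_error:
  assumes S: "finite S" "S \<subseteq> freqs d" and e: "e > 0"
    and w: "\<And>k. k \<in> freqs d - S \<Longrightarrow> 1 / e\<^sup>2 \<le> Wweight b d k"
  shows "op_err b d (\<lambda>f x. \<Sum>k\<in>S. fourier d f k * trig d k x) \<le> ereal e"
  unfolding op_err_def
proof (rule SUP_least)
  fix f assume "f \<in> {f \<in> Wspace b d. Wnorm b d f \<le> 1}"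
  then have f: "f \<in> L2 d" "(\<lambda>k. Wweight b d k * (cmod (fourier d f k))\<^sup>2) summable_on freqs d"
    and "Wnorm b d f \<le> 1" by (auto simp: Wspace_def)
  then have le1: "(\<Sum>\<^sub>\<infinity>k\<in>freqs d. Wweight b d k * (cmod (fourier d f k))\<^sup>2) \<le> 1"
    by (simp add: Wnorm_def)
  have "(LINT x|cube d. (cmod (f x - (\<Sum>k\<in>S. fourier d f k * trig d k x)))\<^sup>2) \<le> e\<^sup>2"
  proof (rule parseval_remainder[OF f(1) S])
    fix T assume T: "finite T" "T \<subseteq> freqs d - S"
    have "(\<Sum>k\<in>T. (cmod (fourier d f k))\<^sup>2)
        \<le> (\<Sum>k\<in>T. e\<^sup>2 * (Wweight b d k * (cmod (fourier d f k))\<^sup>2))"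
    proof (rule sum_mono)
      fix k assume "k \<in> T"
      then have "1 \<le> e\<^sup>2 * Wweight b d k"
        using w[of k] T(2) e by (auto simp: field_simps)
      then show "(cmod (fourier d f k))\<^sup>2 \<le> e\<^sup>2 * (Wweight b d k * (cmod (fourier d f k))\<^sup>2)"
        using mult_right_mono[of 1 "e\<^sup>2 * Wweight b d k" "(cmod (fourier d f k))\<^sup>2"]
        by (simp add: mult.assoc)
    qed
    also have "\<dots> = e\<^sup>2 * (\<Sum>k\<in>T. Wweight b d k * (cmod (fourier d f k))\<^sup>2)"
      by (simp add: sum_distrib_left)
    also have "\<dots> \<le> e\<^sup>2 * 1"
    proof (intro mult_left_mono order_trans[OF _ le1])
      show "(\<Sum>k\<in>T. Wweight b d k * (cmod (fourier d f k))\<^sup>2)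
          \<le> (\<Sum>\<^sub>\<infinity>k\<in>freqs d. Wweight b d k * (cmod (fourier d f k))\<^sup>2)"
        using T by (intro finite_sum_le_infsum f(2)) (auto intro!: mult_nonneg_nonneg less_imp_le[OF Wweight_pos])
    qed simp
    finally show "(\<Sum>k\<in>T. (cmod (fourier d f k))\<^sup>2) \<le> e\<^sup>2" by simp
  qed
  then have "L2norm d (\<lambda>x. f x - (\<Sum>k\<in>S. fourier d f k * trig d k x)) \<le> e"
    unfolding L2norm_def using e by (intro real_le_lsqrt) auto
  then show "ereal (L2norm d (\<lambda>x. f x - (\<Sum>k\<in>S. fourier d f k * trig d k x))) \<le> ereal e"
    by simp
qed

text \<open>The singular values of the embedding are \<open>1 / sqrt (Wweight b d k)\<close>, and
  the set counts those exceeding \<open>e\<close>. The strict inequality matches the condition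
  \<open>\<le>\<close> on the approximation number.\<close>

theorem info_compl_eq_card:
  assumes e: "0 < e" and fin: "finite {k \<in> freqs d. Wweight b d k < 1 / e\<^sup>2}"
  shows "info_compl b e d = card {k \<in> freqs d. Wweight b d k < 1 / e\<^sup>2}"
proof -
  define S where "S = {k \<in> freqs d. Wweight b d k < 1 / e\<^sup>2}"
  have S: "finite S" "S \<subseteq> freqs d" using fin by (auto simp: S_def)
  have upper: "approx_num b d (card S + 1) \<le> ereal e"
    unfolding approx_num_def
  proof (rule INF_lower2)
    show "(\<lambda>f x. \<Sum>k\<in>S. fourier d f k * trig d k x) \<in> {A. admissible b d (card S + 1) A}"
      using fourier_projection_admissible[OF S] by simp
    show "op_err b d (\<lambda>f x. \<Sum>k\<in>S. fourier d f k * trig d k x) \<le> ereal e"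
      using S e by (intro fourier_projection_error) (auto simp: S_def)
  qed
  have lower: "card S \<le> n" if n: "approx_num b d (n + 1) \<le> ereal e" for n
  proof (rule ccontr)
    assume "\<not> card S \<le> n"
    then have "n + 1 \<le> card S" and "S \<noteq> {}" by auto
    \<comment> \<open>The largest weight in the finite set is still strictly below
      \<open>1 / e\<^sup>2\<close>. Using \<open>1 / e\<^sup>2\<close> itself would only give an
      error of at least \<open>e\<close>, which is no contradiction.\<close>
    define w where "w = Max (Wweight b d ` S)"
    have w_ge: "\<And>k. k \<in> S \<Longrightarrow> Wweight b d k \<le> w" unfolding w_def using S(1) by simp
    have "w \<in> Wweight b d ` S" unfolding w_def using S(1) \<open>S \<noteq> {}\<close> by (intro Max_in) auto
    then have w: "0 < w" "w < 1 / e\<^sup>2" using Wweight_pos[of b d] by (auto simp: S_def)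
    have "ereal (1 / sqrt w) \<le> approx_num b d (n + 1)"
      unfolding approx_num_def
      using op_err_lower[OF _ S \<open>n + 1 \<le> card S\<close> w_ge w(1)] by (intro INF_greatest) simp
    with n have "ereal (1 / sqrt w) \<le> ereal e" by (rule order_trans[rotated])
    then have "1 \<le> e * sqrt w" using w(1) by (simp add: field_simps)
    then have "1\<^sup>2 \<le> (e * sqrt w)\<^sup>2" by (intro power_mono) auto
    then show False using w e by (simp add: power_mult_distrib field_simps)
  qed
  show ?thesis
    unfolding info_compl_def S_def[symmetric]
    using upper lower by (intro Least_equality)
qed

subsection \<open>Counting lattice points\<close>

definition wt :: "(nat \<Rightarrow> real) \<Rightarrow> nat \<Rightarrow> int \<Rightarrow> real" where
  "wt b j m = (2 * pi * \<bar>real_of_int m\<bar>) powr (2 * b j)"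

text \<open>The summand 1 of \<open>Wweight\<close> is moved to the threshold, so \<open>X\<close>
  will stand for \<open>(1 / \<epsilon>)\<^sup>2 - 1\<close>, and the zero frequency lies in the set
  as soon as \<open>X\<close> is positive.\<close>

definition level :: "(nat \<Rightarrow> real) \<Rightarrow> nat \<Rightarrow> real \<Rightarrow> (nat \<Rightarrow> int) set" where
  "level b d X = {k \<in> freqs d. (\<Sum>j=1..d. wt b j (k j)) < X}"

lemma wt_nonneg [simp]: "0 \<le> wt b j m"
  by (simp add: wt_def)

lemma wt_0 [simp]: "wt b j 0 = 0"
  by (simp add: wt_def)

lemma wt_1 [simp]: "wt b j 1 = (2 * pi) powr (2 * b j)" "wt b j (-1) = (2 * pi) powr (2 * b j)"
  by (simp_all add: wt_def)

lemma int_abs_less_eq: "{m::int. \<bar>real_of_int m\<bar> < Y} = {- \<lceil>Y\<rceil> + 1..\<lceil>Y\<rceil> - 1}"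
proof (intro set_eqI)
  fix m :: int
  have "\<bar>real_of_int m\<bar> < Y \<longleftrightarrow> \<bar>m\<bar> < \<lceil>Y\<rceil>"
    by (metis less_ceiling_iff of_int_abs)
  then show "m \<in> {m. \<bar>real_of_int m\<bar> < Y} \<longleftrightarrow> m \<in> {- \<lceil>Y\<rceil> + 1..\<lceil>Y\<rceil> - 1}"
    by auto
qed

lemma two_pi_gt_6: "2 * pi > 6"
  using pi_gt3 by simp

lemma powr_less_iff_base:
  fixes u v p :: real
  assumes "0 \<le> u" "0 \<le> v" "0 < p"
  shows "u powr p < v powr p \<longleftrightarrow> u < v"
proof (cases "u < v")
  case True
  then show ?thesis using powr_less_mono2[of p u v] assms by simp
next
  case False
  then show ?thesis using powr_mono2[of p v u] assms by simp
qed

lemma coordinate_level_eq: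
  assumes "0 < b j" "0 < X"
  shows "{m. wt b j m < X} = {m. \<bar>real_of_int m\<bar> < X powr (1 / (2 * b j)) / (2 * pi)}"
proof (intro Collect_cong)
  fix m :: int
  let ?t = "2 * pi * \<bar>real_of_int m\<bar>"
  have "?t powr (2 * b j) < X \<longleftrightarrow> ?t powr (2 * b j) < (X powr (1 / (2 * b j))) powr (2 * b j)"
    using assms by (simp add: powr_powr)
  also have "\<dots> \<longleftrightarrow> ?t < X powr (1 / (2 * b j))"
    using assms by (intro powr_less_iff_base) auto
  also have "\<dots> \<longleftrightarrow> \<bar>real_of_int m\<bar> < X powr (1 / (2 * b j)) / (2 * pi)"
    by (simp add: field_simps)
  finally show "wt b j m < X \<longleftrightarrow> \<bar>real_of_int m\<bar> < X powr (1 / (2 * b j)) / (2 * pi)"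
    by (simp add: wt_def)
qed

lemma finite_coordinate_level: "0 < b j \<Longrightarrow> 0 < X \<Longrightarrow> finite {m. wt b j m < X}"
  by (simp add: coordinate_level_eq int_abs_less_eq)

text \<open>The count is \<open>2 * \<lceil>Y\<rceil> - 1\<close> with
  \<open>Y = X powr (1 / (2 * b j)) / (2 * pi)\<close>. For \<open>Y > 1\<close> this is at most
  \<open>3 * Y\<close>, and the 3 is absorbed by \<open>2 * pi\<close>, which leaves an upper bound
  with constant 1. The lower bound may lose a constant because it is used for fixed \<open>d\<close>
  only.\<close>

lemma card_coordinate_level:
  assumes "0 < b j" "0 < X"
  shows "real (card {m. wt b j m < X}) \<le> max 1 (X powr (1 / (2 * b j)))"
    and "X powr (1 / (2 * b j)) / (2 * pi) \<le> real (card {m. wt b j m < X})"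
proof -
  define Y where "Y = X powr (1 / (2 * b j)) / (2 * pi)"
  have Y: "0 < Y" "2 * pi * Y = X powr (1 / (2 * b j))" using assms by (simp_all add: Y_def)
  have c: "\<lceil>Y\<rceil> \<ge> 1" using Y(1) by simp
  have card: "card {m. wt b j m < X} = nat (2 * \<lceil>Y\<rceil> - 1)"
    unfolding coordinate_level_eq[of b j X, OF assms] Y_def[symmetric] int_abs_less_eq by simp
  then have real_card: "real (card {m. wt b j m < X}) = 2 * real_of_int \<lceil>Y\<rceil> - 1"
    using c by simp
  have "Y \<le> real_of_int \<lceil>Y\<rceil>" by linarith
  then show "X powr (1 / (2 * b j)) / (2 * pi) \<le> real (card {m. wt b j m < X})"
    using c unfolding real_card Y_def[symmetric] by linarith
  show "real (card {m. wt b j m < X}) \<le> max 1 (X powr (1 / (2 * b j)))"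
  proof (cases "Y \<le> 1")
    case True
    then have "\<lceil>Y\<rceil> = 1" using c by linarith
    then show ?thesis unfolding real_card by simp
  next
    case False
    have "real_of_int \<lceil>Y\<rceil> < Y + 1" by linarith
    then have "2 * real_of_int \<lceil>Y\<rceil> - 1 \<le> 3 * Y" using False by linarith
    also have "\<dots> \<le> 2 * pi * Y" using Y(1) two_pi_gt_6 by (intro mult_right_mono) auto
    finally show ?thesis unfolding real_card Y(2) by simp
  qed
qed

text \<open>The distributive law for functions with a fixed value outside \<open>A\<close>, as
  needed for frequencies, which vanish outside \<open>{1..d}\<close>; restriction to
  \<open>A\<close> translates it to the usual product of sets.\<close>

lemma sum_PiE_dflt_prod:
  fixes g :: "'a \<Rightarrow> 'b \<Rightarrow> 'c::comm_semiring_1"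
  assumes "finite A" "\<And>x. x \<in> A \<Longrightarrow> finite (B x)"
  shows "(\<Sum>h\<in>PiE_dflt A z B. \<Prod>x\<in>A. g x (h x)) = (\<Prod>x\<in>A. \<Sum>y\<in>B x. g x y)"
proof -
  have inj: "inj_on (\<lambda>h. restrict h A) (PiE_dflt A z B)"
    by (force simp: inj_on_def restrict_def fun_eq_iff PiE_dflt_def)
  have "(\<Prod>x\<in>A. \<Sum>y\<in>B x. g x y) = (\<Sum>h\<in>PiE A B. \<Prod>x\<in>A. g x (h x))"
    using assms by (rule prod_sum_PiE)
  also have "\<dots> = (\<Sum>h\<in>PiE_dflt A z B. \<Prod>x\<in>A. g x (restrict h A x))"
    unfolding restrict_PiE_dflt[symmetric, of A B z] sum.reindex[OF inj] by simp
  also have "\<dots> = (\<Sum>h\<in>PiE_dflt A z B. \<Prod>x\<in>A. g x (h x))"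
    by (intro sum.cong prod.cong) auto
  finally show ?thesis by simp
qed

lemma level_subset_box: "level b d X \<subseteq> PiE_dflt {1..d} 0 (\<lambda>j. {m. wt b j m < X})"
proof
  fix k assume k: "k \<in> level b d X"
  have "wt b j (k j) < X" if "j \<in> {1..d}" for j
  proof -
    have "wt b j (k j) \<le> (\<Sum>j=1..d. wt b j (k j))"
      using that by (intro member_le_sum) auto
    then show ?thesis using k by (simp add: level_def)
  qed
  then show "k \<in> PiE_dflt {1..d} 0 (\<lambda>j. {m. wt b j m < X})"
    using k by (auto simp: PiE_dflt_def level_def freqs_def)
qed

context
  fixes b :: "nat \<Rightarrow> real" and d :: nat and X :: real
  assumes b: "\<And>j. j \<in> {1..d} \<Longrightarrow> 0 < b j" and X: "0 < X"
begin

lemma finite_box: "finite (PiE_dflt {1..d} (0::int) (\<lambda>j. {m. wt b j m < X}))"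
  by (intro finite_PiE_dflt finite_coordinate_level b X) auto

lemma finite_level: "finite (level b d X)"
  using level_subset_box finite_box by (rule finite_subset)

lemma card_level_ge_1: "1 \<le> card (level b d X)"
proof -
  have "(\<lambda>_. 0) \<in> level b d X" using X by (simp add: level_def freqs_def)
  then have "card {(\<lambda>_. 0) :: nat \<Rightarrow> int} \<le> card (level b d X)" by (intro card_mono finite_level) auto
  then show ?thesis by simp
qed

text \<open>Rankin's trick: each \<open>k\<close> in the level set contributes at least 1 to
  \<open>\<Sum> exp (\<sigma> (X - \<Sum> wt))\<close>, and this sum over a box factorises.\<close>

lemma card_level_rankin:
  assumes "0 \<le> \<sigma>"
  shows "real (card (level b d X)) \<le> exp (\<sigma> * X) * (\<Prod>j=1..d. \<Sum>m | wt b j m < X. exp (- \<sigma> * wt b j m))"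
proof -
  let ?P = "PiE_dflt {1..d} 0 (\<lambda>j. {m. wt b j m < X})"
  have "real (card (level b d X)) = (\<Sum>k\<in>level b d X. 1)" by simp
  also have "\<dots> \<le> (\<Sum>k\<in>level b d X. exp (\<sigma> * (X - (\<Sum>j=1..d. wt b j (k j)))))"
    using assms by (intro sum_mono) (auto simp: level_def)
  also have "\<dots> \<le> (\<Sum>k\<in>?P. exp (\<sigma> * (X - (\<Sum>j=1..d. wt b j (k j)))))"
    by (intro sum_mono2 finite_box level_subset_box) auto
  also have "\<dots> = (\<Sum>k\<in>?P. exp (\<sigma> * X) * (\<Prod>j=1..d. exp (- \<sigma> * wt b j (k j))))"
  proof (intro sum.cong refl)
    fix k :: "nat \<Rightarrow> int"
    have "\<sigma> * (X - (\<Sum>j=1..d. wt b j (k j))) = \<sigma> * X + (\<Sum>j=1..d. - \<sigma> * wt b j (k j))"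
      by (simp add: right_diff_distrib sum_negf flip: sum_distrib_left)
    then show "exp (\<sigma> * (X - (\<Sum>j=1..d. wt b j (k j))))
        = exp (\<sigma> * X) * (\<Prod>j=1..d. exp (- \<sigma> * wt b j (k j)))"
      by (simp only: exp_add exp_sum finite_atLeastAtMost)
  qed
  also have "\<dots> = exp (\<sigma> * X) * (\<Sum>k\<in>?P. \<Prod>j=1..d. exp (- \<sigma> * wt b j (k j)))"
    by (simp add: sum_distrib_left)
  also have "(\<Sum>k\<in>?P. \<Prod>j=1..d. exp (- \<sigma> * wt b j (k j)))
      = (\<Prod>j=1..d. \<Sum>m | wt b j m < X. exp (- \<sigma> * wt b j m))"
    by (intro sum_PiE_dflt_prod finite_coordinate_level b X) auto
  finally show ?thesis .
qed

lemma ln_card_level_le: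
  assumes "0 \<le> \<sigma>" and c: "\<And>j. j \<in> {1..d} \<Longrightarrow> (\<Sum>m | wt b j m < X. exp (- \<sigma> * wt b j m)) \<le> exp (c j)"
  shows "ln (real (card (level b d X))) \<le> \<sigma> * X + (\<Sum>j=1..d. c j)"
proof -
  have "real (card (level b d X)) \<le> exp (\<sigma> * X) * (\<Prod>j=1..d. exp (c j))"
    by (rule order_trans[OF card_level_rankin[OF assms(1)]])
      (intro mult_left_mono prod_mono conjI c sum_nonneg; simp)
  also have "\<dots> = exp (\<sigma> * X + (\<Sum>j=1..d. c j))" by (simp add: exp_add exp_sum)
  finally show ?thesis
    using card_level_ge_1 ln_mono[of "real (card (level b d X))"] by fastforce
qed

text \<open>The exponential factors are bounded by 1, which leaves the plain count. This serves
  \<open>\<sigma> = 0\<close> and the initial coordinates, about which nothing but positivity of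
  \<open>b j\<close> is used.\<close>

lemma coordinate_rankin_card:
  assumes "j \<in> {1..d}" "0 \<le> \<sigma>" "1 \<le> y" "X \<le> y\<^sup>2"
  shows "(\<Sum>m | wt b j m < X. exp (- \<sigma> * wt b j m)) \<le> exp (ln y / b j)"
proof -
  have bj: "b j > 0" by (rule b[OF assms(1)])
  have "(\<Sum>m | wt b j m < X. exp (- \<sigma> * wt b j m)) \<le> (\<Sum>m | wt b j m < X. 1)"
    using assms(2) by (intro sum_mono) auto
  also have "\<dots> \<le> max 1 (X powr (1 / (2 * b j)))"
    using card_coordinate_level(1)[of b j X, OF bj X] by simp
  also have "\<dots> \<le> exp (ln y / b j)"
  proof -
    have "X powr (1 / (2 * b j)) \<le> (y\<^sup>2) powr (1 / (2 * b j))"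
      using X bj assms by (intro powr_mono2) auto
    also have "\<dots> = exp (ln y / b j)"
      using assms(3) by (simp add: powr_def ln_realpow)
    finally show ?thesis using assms(3) bj by simp
  qed
  finally show ?thesis .
qed

text \<open>The entry 0 contributes 1, the entries \<open>m\<close> and \<open>-m\<close> contribute
  equally, and \<open>1 + x \<le> exp x\<close> turns the product over coordinates into a sum of
  exponents. The cutoff \<open>M\<close> keeps all sums finite.\<close>

lemma coordinate_rankin_sum:
  assumes "j \<in> {1..d}" and M: "\<And>m. wt b j m < X \<Longrightarrow> \<bar>m\<bar> \<le> int M"
  shows "(\<Sum>m | wt b j m < X. exp (- \<sigma> * wt b j m)) \<le> exp (2 * (\<Sum>m=1..M. exp (- \<sigma> * wt b j (int m))))"
proof -
  let ?g = "\<lambda>m. exp (- \<sigma> * wt b j m)"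
  have pos: "(\<Sum>m\<in>int ` {1..M}. ?g m) = (\<Sum>m=1..M. ?g (int m))"
    by (subst sum.reindex) (auto simp: inj_on_def)
  have neg: "(\<Sum>m\<in>(\<lambda>m. - int m) ` {1..M}. ?g m) = (\<Sum>m=1..M. ?g (int m))"
    by (subst sum.reindex) (auto simp: inj_on_def wt_def)
  have "{m. wt b j m < X} \<subseteq> {0} \<union> (int ` {1..M} \<union> (\<lambda>m. - int m) ` {1..M})"
  proof
    fix m assume "m \<in> {m. wt b j m < X}"
    then have "\<bar>m\<bar> \<le> int M" using M by simp
    then have "m = 0 \<or> (m > 0 \<and> nat m \<in> {1..M}) \<or> (m < 0 \<and> nat (- m) \<in> {1..M})" by auto
    then show "m \<in> {0} \<union> (int ` {1..M} \<union> (\<lambda>m. - int m) ` {1..M})"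
      by (elim disjE conjE) (auto intro: image_eqI[of _ _ "nat m"] image_eqI[of _ _ "nat (- m)"])
  qed
  then have "(\<Sum>m | wt b j m < X. ?g m) \<le> sum ?g ({0} \<union> (int ` {1..M} \<union> (\<lambda>m. - int m) ` {1..M}))"
    by (intro sum_mono2) auto
  also have "\<dots> = 1 + (sum ?g (int ` {1..M}) + sum ?g ((\<lambda>m. - int m) ` {1..M}))"
    by (subst sum.union_disjoint; (subst sum.union_disjoint)?) auto
  also have "\<dots> = 1 + 2 * (\<Sum>m=1..M. ?g (int m))" unfolding pos neg by simp
  also have "\<dots> \<le> exp (2 * (\<Sum>m=1..M. ?g (int m)))" by (rule exp_ge_add_one_self)
  finally show ?thesis .
qed

text \<open>Coordinates up to \<open>J\<close> are charged with their plain count, later ones with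
  their exponential sum. Since \<open>Q\<close> bounds the sums for every cutoff, no convergence
  question arises.\<close>

lemma ln_card_level_rankin:
  assumes "0 \<le> \<sigma>" "1 \<le> y" "X \<le> y\<^sup>2" and b1: "0 < b 1" "\<And>j. j \<in> {1..d} \<Longrightarrow> b 1 \<le> b j"
    and Q: "\<And>M. (\<Sum>j\<in>{J<..d}. \<Sum>m=1..M. exp (- \<sigma> * wt b j (int m))) \<le> Q"
  shows "ln (real (card (level b d X))) \<le> \<sigma> * y\<^sup>2 + real J * (ln y / b 1) + 2 * Q"
proof -
  have "finite (\<Union>j\<in>{1..d}. {m. wt b j m < X})"
    by (intro finite_UN_I finite_coordinate_level b X) auto
  then have "finite ((\<lambda>m. nat \<bar>m\<bar>) ` (\<Union>j\<in>{1..d}. {m. wt b j m < X}))" by (rule finite_imageI)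
  then obtain M where "\<forall>n\<in>(\<lambda>m. nat \<bar>m\<bar>) ` (\<Union>j\<in>{1..d}. {m. wt b j m < X}). n \<le> M"
    unfolding finite_nat_set_iff_bounded_le by blast
  then have M: "\<bar>m\<bar> \<le> int M" if "j \<in> {1..d}" "wt b j m < X" for j m
    using that by fastforce
  define c where "c j = (if j \<le> J then ln y / b 1 else 2 * (\<Sum>m=1..M. exp (- \<sigma> * wt b j (int m))))" for j
  have "ln (real (card (level b d X))) \<le> \<sigma> * X + (\<Sum>j=1..d. c j)"
  proof (rule ln_card_level_le[OF assms(1)])
    fix j assume j: "j \<in> {1..d}"
    have "ln y / b j \<le> ln y / b 1"
      using b1(2)[OF j] b1(1) assms(2) by (intro divide_left_mono) auto
    then show "(\<Sum>m | wt b j m < X. exp (- \<sigma> * wt b j m)) \<le> exp (c j)"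
      using coordinate_rankin_card[OF j assms(1-3)] coordinate_rankin_sum[OF j M[OF j]]
      unfolding c_def by (auto intro: order_trans)
  qed
  \<comment> \<open>The index set is enlarged to cover the case \<open>J > d\<close>.\<close>
  also have "(\<Sum>j=1..d. c j) \<le> (\<Sum>j\<in>{1..J} \<union> {J<..d}. c j)"
    using assms(2) b1(1) by (intro sum_mono2) (auto simp: c_def intro!: divide_nonneg_pos sum_nonneg)
  also have "(\<Sum>j\<in>{1..J} \<union> {J<..d}. c j) = (\<Sum>j\<in>{1..J}. c j) + (\<Sum>j\<in>{J<..d}. c j)"
    by (intro sum.union_disjoint) auto
  also have "(\<Sum>j\<in>{1..J}. c j) = real J * (ln y / b 1)" by (simp add: c_def)
  also have "(\<Sum>j\<in>{J<..d}. c j) = 2 * (\<Sum>j\<in>{J<..d}. \<Sum>m=1..M. exp (- \<sigma> * wt b j (int m)))"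
    by (simp add: c_def sum_distrib_left)
  also have "\<dots> \<le> 2 * Q" using Q[of M] by simp
  also have "\<sigma> * X \<le> \<sigma> * y\<^sup>2" using assms by (intro mult_left_mono)
  finally show ?thesis by simp
qed

text \<open>Every coordinate receives the share \<open>X / d\<close> of the threshold, so a whole
  box fits into the level set. The loss depends on \<open>d\<close> alone.\<close>

lemma card_level_ge_prod:
  assumes "1 \<le> d"
  shows "(\<Prod>j=1..d. card {m. wt b j m < X / real d}) \<le> card (level b d X)"
proof -
  have X': "0 < X / real d" using X assms by simp
  have fin: "finite {m. wt b j m < X / real d}" if "j \<in> {1..d}" for j
    by (rule finite_coordinate_level[of b, OF b[OF that] X'])
  have "PiE_dflt {1..d} 0 (\<lambda>j. {m. wt b j m < X / real d}) \<subseteq> level b d X"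
  proof
    fix k assume k: "k \<in> PiE_dflt {1..d} 0 (\<lambda>j. {m. wt b j m < X / real d})"
    have "(\<Sum>j=1..d. wt b j (k j)) < (\<Sum>j=1..d. X / real d)"
      using k assms by (intro sum_strict_mono) (auto simp: PiE_dflt_def)
    then show "k \<in> level b d X"
      using k assms by (auto simp: level_def freqs_def PiE_dflt_def)
  qed
  then have "card (PiE_dflt {1..d} (0::int) (\<lambda>j. {m. wt b j m < X / real d})) \<le> card (level b d X)"
    by (intro card_mono finite_level)
  then show ?thesis by (subst (asm) card_PiE_dflt) (use fin in auto)
qed

lemma card_level_ge_powr:
  assumes "1 \<le> d"
  shows "(\<Prod>j=1..d. (X / real d) powr (1 / (2 * b j)) / (2 * pi)) \<le> real (card (level b d X))"
proof -
  have "(\<Prod>j=1..d. (X / real d) powr (1 / (2 * b j)) / (2 * pi))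
      \<le> (\<Prod>j=1..d. real (card {m. wt b j m < X / real d}))"
    using assms X by (intro prod_mono conjI card_coordinate_level(2) b) auto
  also have "\<dots> \<le> real (card (level b d X))"
    using card_level_ge_prod[OF assms] by (simp flip: of_nat_prod)
  finally show ?thesis .
qed

lemma card_level_ge_3_power:
  assumes "1 \<le> d" and "\<And>j. j \<in> {1..d} \<Longrightarrow> b j \<le> b d" and "real d * (2 * pi) powr (2 * b d) < X"
  shows "3 ^ d \<le> card (level b d X)"
proof -
  have "3 \<le> card {m. wt b j m < X / real d}" if j: "j \<in> {1..d}" for j
  proof -
    have "(2 * pi) powr (2 * b j) \<le> (2 * pi) powr (2 * b d)"
      using assms(2)[OF j] two_pi_gt_6 by (intro powr_mono) auto
    then have "real d * (2 * pi) powr (2 * b j) \<le> real d * (2 * pi) powr (2 * b d)"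
      by (intro mult_left_mono) auto
    with assms(3) have "real d * (2 * pi) powr (2 * b j) < X" by simp
    then have "{-1, 0, 1} \<subseteq> {m. wt b j m < X / real d}"
      using X assms(1) by (auto simp: field_simps)
    then have "card {-1, 0, 1::int} \<le> card {m. wt b j m < X / real d}"
      using X assms(1) by (intro card_mono finite_coordinate_level b[OF j]) auto
    then show ?thesis by simp
  qed
  then have "(\<Prod>j=1..d. 3) \<le> (\<Prod>j=1..d. card {m. wt b j m < X / real d})"
    by (intro prod_mono) auto
  with card_level_ge_prod[OF assms(1)] show ?thesis by simp
qed

lemma card_level_ge_binomial:
  assumes "\<And>j. j \<in> {1..d} \<Longrightarrow> b j \<le> b d" and "real r * (2 * pi) powr (2 * b d) < X"
  shows "d choose r \<le> card (level b d X)"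
proof -
  have "(\<lambda>B j. if j \<in> B then 1 else 0::int) ` {B. B \<subseteq> {1..d} \<and> card B = r} \<subseteq> level b d X"
  proof (rule image_subsetI)
    fix B assume "B \<in> {B. B \<subseteq> {1..d} \<and> card B = r}"
    then have B: "B \<subseteq> {1..d}" "card B = r" by auto
    have "(\<Sum>j=1..d. wt b j (if j \<in> B then 1 else 0)) = (\<Sum>j\<in>B. (2 * pi) powr (2 * b j))"
      using B(1) by (intro sum.mono_neutral_cong_right) auto
    also have "\<dots> \<le> (\<Sum>j\<in>B. (2 * pi) powr (2 * b d))"
      using B(1) assms(1) two_pi_gt_6 by (intro sum_mono powr_mono) auto
    also have "\<dots> < X" using B(2) assms(2) by simp
    finally show "(\<lambda>j. if j \<in> B then 1 else 0) \<in> level b d X"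
      using B(1) by (auto simp: level_def freqs_def)
  qed
  moreover have "inj_on (\<lambda>B j. if j \<in> B then 1 else 0::int) {B. B \<subseteq> {1..d} \<and> card B = r}"
    by (auto simp: inj_on_def fun_eq_iff split: if_splits)
  ultimately have "card {B. B \<subseteq> {1..d} \<and> card B = r} \<le> card (level b d X)"
    using card_inj_on_le finite_level by blast
  then show ?thesis by (simp add: n_subsets)
qed

end

subsection \<open>Tractability\<close>

text \<open>Trades the stretched exponential for a quadratic decay that can be summed explicitly.
  Only the existence of \<open>K\<close> matters: a limit handles large \<open>x\<close>,
  monotonicity the rest.\<close>

lemma exp_powr_decay:
  fixes c p :: real
  assumes "0 < c" "0 < p"
  shows "\<exists>K>0. \<forall>x\<ge>0. exp (- c * x powr p) \<le> K / (1 + x\<^sup>2)"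
proof -
  have "((\<lambda>x. (1 + x\<^sup>2) * exp (- c * x powr p)) \<longlongrightarrow> 0) at_top"
    using assms by real_asymp
  then have "eventually (\<lambda>x. (1 + x\<^sup>2) * exp (- c * x powr p) < 1) at_top"
    by (rule order_tendstoD) simp
  then obtain x0 where x0: "\<And>x. x0 \<le> x \<Longrightarrow> (1 + x\<^sup>2) * exp (- c * x powr p) < 1"
    unfolding eventually_at_top_linorder by blast
  have "exp (- c * x powr p) \<le> (1 + x0\<^sup>2) / (1 + x\<^sup>2)" if "0 \<le> x" for x
  proof -
    have "(1 + x\<^sup>2) * exp (- c * x powr p) \<le> 1 + x0\<^sup>2"
    proof (cases "x0 \<le> x")
      case True
      then show ?thesis using x0[OF True] zero_le_power2[of x0] by linarith
    next
      case False
      then have "x\<^sup>2 \<le> x0\<^sup>2" using that by (intro power_mono) auto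
      moreover have "(1 + x\<^sup>2) * exp (- c * x powr p) \<le> (1 + x\<^sup>2) * 1"
        using assms by (intro mult_left_mono) auto
      ultimately show ?thesis by simp
    qed
    then show ?thesis by (simp add: pos_le_divide_eq add_pos_nonneg mult.commute)
  qed
  then show ?thesis by (intro exI[of _ "1 + x0\<^sup>2"]) (auto simp: add_pos_nonneg)
qed

text \<open>Telescoping proves the sharper bound \<open>2 - 1 / M\<close>, which is what the
  induction carries.\<close>

lemma sum_inverse_squares_le: "(\<Sum>m=1..M. 1 / (real m)\<^sup>2) \<le> 2"
proof (cases "M = 0")
  case False
  then have "1 \<le> M" by simp
  then have "(\<Sum>m=1..M. 1 / (real m)\<^sup>2) \<le> 2 - 1 / real M"
  proof (induction M rule: nat_induct_at_least)
    case (Suc n)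
    have "1 / (real (Suc n))\<^sup>2 \<le> 1 / (real n * real (Suc n))"
      using Suc.hyps unfolding power2_eq_square by (intro divide_left_mono mult_right_mono) auto
    also have "\<dots> = 1 / real n - 1 / real (Suc n)"
      using Suc.hyps by (simp add: field_simps)
    finally have "1 / (real (Suc n))\<^sup>2 \<le> 1 / real n - 1 / real (Suc n)" .
    with Suc.IH show ?case by simp
  qed simp
  then show ?thesis by (rule order_trans) simp
qed simp

lemma sum_exp_squares_le:
  assumes "0 < v"
  shows "(\<Sum>m=1..M. exp (- v * (real m)\<^sup>2)) \<le> 2 / v"
proof -
  have "(\<Sum>m=1..M. exp (- v * (real m)\<^sup>2)) \<le> (\<Sum>m=1..M. 1 / v * (1 / (real m)\<^sup>2))"
  proof (rule sum_mono)
    fix m assume "m \<in> {1..M}"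
    then have "0 < v * (real m)\<^sup>2" using assms by simp
    moreover have "v * (real m)\<^sup>2 \<le> exp (v * (real m)\<^sup>2)"
      using exp_ge_add_one_self[of "v * (real m)\<^sup>2"] by linarith
    ultimately show "exp (- v * (real m)\<^sup>2) \<le> 1 / v * (1 / (real m)\<^sup>2)"
      by (simp add: exp_minus field_simps)
  qed
  also have "\<dots> = 1 / v * (\<Sum>m=1..M. 1 / (real m)\<^sup>2)" by (rule sum_distrib_left[symmetric])
  also have "\<dots> \<le> 1 / v * 2" using assms sum_inverse_squares_le by (intro mult_left_mono) auto
  finally show ?thesis by simp
qed

text \<open>A right-endpoint Riemann sum of step \<open>h\<close> for the decreasing derivative of
  \<open>arctan\<close>. The bound is uniform in \<open>d\<close>.\<close>

lemma sum_lorentzian_le: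
  assumes "0 < h"
  shows "(\<Sum>j=1..d. 1 / (1 + (h * real j)\<^sup>2)) \<le> pi / 2 / h"
proof -
  have "h * (\<Sum>j=1..d. 1 / (1 + (h * real j)\<^sup>2)) \<le> arctan (h * real d)"
  proof (induction d)
    case (Suc d)
    have lt: "h * real d < h * real (Suc d)" using assms by simp
    have "\<exists>z. h * real d < z \<and> z < h * real (Suc d) \<and>
        arctan (h * real (Suc d)) - arctan (h * real d) = (h * real (Suc d) - h * real d) * (1 / (1 + z\<^sup>2))"
      by (rule MVT2[OF lt]) (auto intro!: derivative_eq_intros simp: divide_inverse)
    then obtain z where z: "h * real d < z" "z < h * real (Suc d)"
        "arctan (h * real (Suc d)) - arctan (h * real d) = h * (1 / (1 + z\<^sup>2))"
      by (auto simp: algebra_simps)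
    have "0 \<le> h * real d" using assms by simp
    then have "z\<^sup>2 \<le> (h * real (Suc d))\<^sup>2" using z by (intro power_mono) auto
    then have "h * (1 / (1 + (h * real (Suc d))\<^sup>2)) \<le> h * (1 / (1 + z\<^sup>2))"
      using assms by (intro mult_left_mono divide_left_mono) (auto simp: add_pos_nonneg)
    then show ?case using Suc z(3) by (simp add: distrib_left)
  qed simp
  also have "\<dots> \<le> pi / 2" using arctan_ubound less_imp_le by blast
  finally show ?thesis using assms by (simp add: field_simps)
qed

lemma wt_of_nat: "wt b j (int m) = (2 * pi) powr (2 * b j) * real m powr (2 * b j)"
  by (simp add: wt_def powr_mult)

lemma ln_two_pi_ge_1: "1 \<le> ln (2 * pi)"
proof -
  have "ln 3 \<le> ln (2 * pi)" using two_pi_gt_6 by simp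
  then show ?thesis using ln3_gt_1 by linarith
qed

lemma two_pi_powr_ge: "0 \<le> x \<Longrightarrow> x \<le> (2 * pi) powr x"
proof -
  assume "0 \<le> x"
  then have "x * 1 \<le> x * ln (2 * pi)" using ln_two_pi_ge_1 by (intro mult_left_mono) auto
  also have "\<dots> \<le> exp (x * ln (2 * pi))" using exp_ge_add_one_self[of "x * ln (2 * pi)"] by linarith
  finally show ?thesis by (simp add: powr_def mult.commute)
qed

lemma two_pi_powr_mono_iff: "(2 * pi) powr x \<le> (2 * pi) powr y \<longleftrightarrow> x \<le> y"
  using two_pi_gt_6 by (intro powr_le_cancel_iff) auto

text \<open>Converts an asymptotic comparison into one valid on all of \<open>x \<ge> 1\<close>;
  monotonicity of \<open>f\<close> bounds the initial segment.\<close>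

lemma eventually_le_imp_le_add:
  fixes f g :: "real \<Rightarrow> real"
  assumes "eventually (\<lambda>x. f x \<le> g x) at_top" and g: "\<And>x. 1 \<le> x \<Longrightarrow> 0 \<le> g x"
    and f: "\<And>x y. 1 \<le> x \<Longrightarrow> x \<le> y \<Longrightarrow> f x \<le> f y"
  shows "\<exists>C\<ge>0. \<forall>x\<ge>1. f x \<le> g x + C"
proof -
  obtain x0 where x0: "\<And>x. x0 \<le> x \<Longrightarrow> f x \<le> g x"
    using assms(1) unfolding eventually_at_top_linorder by blast
  show ?thesis
  proof (intro exI[of _ "\<bar>f (max 1 x0)\<bar>"] conjI allI impI)
    fix x :: real assume x: "1 \<le> x"
    show "f x \<le> g x + \<bar>f (max 1 x0)\<bar>"
    proof (cases "x0 \<le> x")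
      case True
      then show ?thesis using x0[of x] by linarith
    next
      case False
      then have "f x \<le> f (max 1 x0)" using x by (intro f) auto
      then show ?thesis using g[OF x] by linarith
    qed
  qed simp
qed

text \<open>Either \<open>c * ln y\<close> is at most \<open>\<delta> * x powr (t - 1)\<close>, and
  the left side is at most \<open>\<delta> * x powr t\<close>; or \<open>x\<close> is bounded by a
  power of \<open>ln y\<close>, and the left side is polylogarithmic in \<open>y\<close>. The
  exponent \<open>p\<close> inverts \<open>t - 1\<close>.\<close>

lemma dim_ln_tradeoff:
  fixes c \<delta> s t :: real
  assumes "0 < c" "0 < \<delta>" "0 < s" "1 < t"
  shows "\<exists>C\<ge>0. \<forall>x\<ge>1. \<forall>y\<ge>1. c * x * ln y \<le> \<delta> * (y powr s + x powr t) + C"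
proof -
  define p where "p = 1 / (t - 1)"
  have p: "p > 0" using assms by (simp add: p_def)
  define f where "f y = c * (c * ln y / \<delta>) powr p * ln y" for y
  have "((\<lambda>y. c * (c * ln y / \<delta>) powr p * ln y / y powr s) \<longlongrightarrow> 0) at_top"
    using assms p by real_asymp
  then have "eventually (\<lambda>y. c * (c * ln y / \<delta>) powr p * ln y / y powr s < \<delta>) at_top"
    using assms by (intro order_tendstoD)
  then have "eventually (\<lambda>y. f y \<le> \<delta> * y powr s) at_top"
    using eventually_gt_at_top[of 0]
    by eventually_elim (simp add: f_def pos_divide_less_eq less_imp_le)
  moreover have "f x \<le> f y" if "1 \<le> x" "x \<le> y" for x y
    using that assms p unfolding f_def by (intro mult_mono powr_mono2 divide_right_mono) auto
  moreover have "0 \<le> \<delta> * y powr s" for y using assms by simp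
  ultimately obtain C where C: "C \<ge> 0" "\<And>y. 1 \<le> y \<Longrightarrow> f y \<le> \<delta> * y powr s + C"
    using eventually_le_imp_le_add[of f "\<lambda>y. \<delta> * y powr s"] by blast
  have "c * x * ln y \<le> \<delta> * (y powr s + x powr t) + C" if xy: "1 \<le> x" "1 \<le> y" for x y
  proof (cases "c * ln y \<le> \<delta> * x powr (t - 1)")
    case True
    then have "x * (c * ln y) \<le> x * (\<delta> * x powr (t - 1))" using xy by (intro mult_left_mono) auto
    also have "\<dots> = \<delta> * x powr (1 + (t - 1))" using xy by (subst powr_add) simp
    finally have "x * (c * ln y) \<le> \<delta> * x powr t" by simp
    moreover have "0 \<le> \<delta> * y powr s" using assms by simp
    ultimately show ?thesis using C(1) by (simp add: distrib_left mult_ac)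
  next
    case False
    then have "x powr (t - 1) \<le> c * ln y / \<delta>" using assms by (simp add: field_simps)
    then have "(x powr (t - 1)) powr p \<le> (c * ln y / \<delta>) powr p" using p by (intro powr_mono2) auto
    then have "x \<le> (c * ln y / \<delta>) powr p" using assms xy by (simp add: powr_powr p_def)
    then have "c * x * ln y \<le> f y"
      unfolding f_def using assms xy by (intro mult_right_mono mult_left_mono) auto
    moreover have "0 \<le> \<delta> * x powr t" using assms by simp
    ultimately show ?thesis using C(2)[OF xy(2)] by (simp add: distrib_left)
  qed
  with C(1) show ?thesis by blast
qed

text \<open>The mirror image: either \<open>y powr (s - 2)\<close> dominates the logarithm of the
  dimension, or \<open>y\<^sup>2\<close> is bounded by a power of that logarithm. The exponent
  \<open>p\<close> turns \<open>y powr (s - 2)\<close> into \<open>y\<^sup>2\<close>.\<close>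

lemma ln_dim_tradeoff:
  fixes c \<delta> s t :: real
  assumes "0 < c" "0 < \<delta>" "2 < s" "0 < t"
  shows "\<exists>C\<ge>0. \<forall>x\<ge>1. \<forall>y\<ge>1. c * ln (x + 1) * y\<^sup>2 \<le> \<delta> * (y powr s + x powr t) + C"
proof -
  define p where "p = 2 / (s - 2)"
  have p: "p > 0" using assms by (simp add: p_def)
  define f where "f x = c * ln (x + 1) * (c * ln (x + 1) / \<delta>) powr p" for x
  have "((\<lambda>x. c * ln (x + 1) * (c * ln (x + 1) / \<delta>) powr p / x powr t) \<longlongrightarrow> 0) at_top"
    using assms p by real_asymp
  then have "eventually (\<lambda>x. c * ln (x + 1) * (c * ln (x + 1) / \<delta>) powr p / x powr t < \<delta>) at_top"
    using assms by (intro order_tendstoD)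
  then have "eventually (\<lambda>x. f x \<le> \<delta> * x powr t) at_top"
    using eventually_gt_at_top[of 0]
    by eventually_elim (simp add: f_def pos_divide_less_eq less_imp_le)
  moreover have "f x \<le> f y" if "1 \<le> x" "x \<le> y" for x y
    using that assms p unfolding f_def by (intro mult_mono powr_mono2 divide_right_mono) auto
  moreover have "0 \<le> \<delta> * x powr t" for x using assms by simp
  ultimately obtain C where C: "C \<ge> 0" "\<And>x. 1 \<le> x \<Longrightarrow> f x \<le> \<delta> * x powr t + C"
    using eventually_le_imp_le_add[of f "\<lambda>x. \<delta> * x powr t"] by blast
  have "c * ln (x + 1) * y\<^sup>2 \<le> \<delta> * (y powr s + x powr t) + C" if xy: "1 \<le> x" "1 \<le> y" for x y
  proof (cases "c * ln (x + 1) \<le> \<delta> * y powr (s - 2)")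
    case True
    then have "c * ln (x + 1) * y\<^sup>2 \<le> \<delta> * y powr (s - 2) * y\<^sup>2" by (intro mult_right_mono) auto
    also have "\<dots> = \<delta> * y powr ((s - 2) + 2)" using xy by (subst powr_add) simp
    finally show ?thesis using assms C(1) by (simp add: distrib_left add_increasing2)
  next
    case False
    then have "y powr (s - 2) \<le> c * ln (x + 1) / \<delta>" using assms by (simp add: field_simps)
    then have "(y powr (s - 2)) powr p \<le> (c * ln (x + 1) / \<delta>) powr p" using p by (intro powr_mono2) auto
    moreover have "(s - 2) * p = 2" using assms by (simp add: p_def field_simps)
    ultimately have "y\<^sup>2 \<le> (c * ln (x + 1) / \<delta>) powr p" using xy by (simp add: powr_powr)
    then have "c * ln (x + 1) * y\<^sup>2 \<le> f x"
      unfolding f_def using assms xy by (intro mult_left_mono) auto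
    moreover have "0 \<le> \<delta> * y powr s" using assms by simp
    ultimately show ?thesis using C(2)[OF xy(1)] by (simp add: distrib_left)
  qed
  with C(1) show ?thesis by blast
qed

section \<open>Tractability as growth of the lattice point count\<close>

lemma Wweight_less_iff:
  assumes "k \<in> freqs d"
  shows "Wweight b d k < X \<longleftrightarrow> k \<in> level b d (X - 1)"
  using assms by (auto simp: Wweight_def level_def wt_def)

locale smoothness =
  fixes b :: "nat \<Rightarrow> real"
  assumes pos: "0 < b 1" and mono: "\<And>j. 1 \<le> j \<Longrightarrow> b j \<le> b (Suc j)"
begin

lemma b_mono:
  assumes "1 \<le> i" "i \<le> j"
  shows "b i \<le> b j"
  using assms(2)
proof (induction j rule: dec_induct)
  case (step n)
  then show ?case using mono[of n] assms(1) by simp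
qed simp

lemma b_pos: "1 \<le> j \<Longrightarrow> 0 < b j"
  using b_mono[of 1 j] pos by simp

lemma info_compl_eq:
  assumes "0 < \<epsilon>" "\<epsilon> < 1"
  shows "info_compl b \<epsilon> d = card (level b d ((1 / \<epsilon>)\<^sup>2 - 1))"
proof -
  have eq: "{k \<in> freqs d. Wweight b d k < 1 / \<epsilon>\<^sup>2} = level b d ((1 / \<epsilon>)\<^sup>2 - 1)"
    using Wweight_less_iff[of _ d b "1 / \<epsilon>\<^sup>2"] by (auto simp: power_divide level_def)
  have "(1 / \<epsilon>)\<^sup>2 > 1" using assms by (intro one_less_power) auto
  then have "finite (level b d ((1 / \<epsilon>)\<^sup>2 - 1))"
    by (intro finite_level b_pos) auto
  then show ?thesis using info_compl_eq_card[OF assms(1), of d b] unfolding eq by simp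
qed

definition cnt :: "nat \<Rightarrow> real \<Rightarrow> real" where
  "cnt d y = real (card (level b d (y\<^sup>2 - 1)))"

lemma X_pos: "1 < y \<Longrightarrow> 0 < y\<^sup>2 - (1::real)"
  using one_less_power[of y 2] by simp

lemma cnt_ge_1: "1 < y \<Longrightarrow> 1 \<le> cnt d y"
  using card_level_ge_1[of d b "y\<^sup>2 - 1"] b_pos X_pos by (simp add: cnt_def)

lemma info_compl_cnt: "1 < y \<Longrightarrow> real (info_compl b (1 / y) d) = cnt d y"
  by (simp add: info_compl_eq cnt_def)

lemma all_eps_iff: "(\<forall>\<epsilon>::real. 0 < \<epsilon> \<and> \<epsilon> < 1 \<longrightarrow> P \<epsilon>) \<longleftrightarrow> (\<forall>y>1. P (1 / y))"
proof safe
  fix \<epsilon> :: real assume "\<forall>y>1. P (1 / y)" "0 < \<epsilon>" "\<epsilon> < 1"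
  then show "P \<epsilon>" by (metis divide_divide_eq_right less_divide_eq_1_pos mult_1 div_by_1)
qed auto

lemma inverse_powr_minus: "1 < y \<Longrightarrow> (1 / y) powr (- p) = y powr p" for y p :: real
  by (simp add: powr_minus powr_divide)

lemma SPT_iff: "SPT b \<longleftrightarrow> (\<exists>C p. 0 \<le> C \<and> 0 \<le> p \<and> (\<forall>d\<ge>1. \<forall>y>1. cnt d y \<le> C * y powr p))"
  unfolding SPT_def all_eps_iff by (simp add: info_compl_cnt inverse_powr_minus)

lemma PT_iff: "PT b \<longleftrightarrow> (\<exists>C p q. 0 \<le> C \<and> 0 \<le> p \<and> 0 \<le> q \<and>
    (\<forall>d\<ge>1. \<forall>y>1. cnt d y \<le> C * real d powr q * y powr p))"
  unfolding PT_def all_eps_iff by (simp add: info_compl_cnt inverse_powr_minus)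

lemma QPT_iff: "QPT b \<longleftrightarrow> (\<exists>C t. 0 < C \<and> 0 < t \<and>
    (\<forall>d\<ge>1. \<forall>y>1. cnt d y \<le> C * exp (t * (1 + ln y) * (1 + ln (real d)))))"
  unfolding QPT_def all_eps_iff by (simp add: info_compl_cnt)

lemma WT_st_iff: "WT_st b s t \<longleftrightarrow> (\<forall>\<delta>>0. \<exists>R. \<forall>d\<ge>1. \<forall>y>1. R < y + real d \<longrightarrow>
    ln (cnt d y) \<le> \<delta> * (y powr s + real d powr t))"
proof -
  have "0 < y powr s + real d powr t" if "1 < y" for y d
    using that by (intro add_pos_nonneg) auto
  moreover have "real (max 1 (info_compl b (1 / y) d)) = cnt d y" if "1 < y" for y d
    using cnt_ge_1[OF that, of d] info_compl_cnt[OF that, of d] by simp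
  moreover have "(\<forall>\<epsilon>. 0 < \<epsilon> \<and> \<epsilon> < 1 \<and> A \<epsilon> \<longrightarrow> B \<epsilon>) \<longleftrightarrow> (\<forall>y>1. A (1 / y) \<longrightarrow> B (1 / y))"
    for A B :: "real \<Rightarrow> bool"
    using all_eps_iff[of "\<lambda>\<epsilon>. A \<epsilon> \<longrightarrow> B \<epsilon>"] by (simp only: imp_conjL)
  ultimately show ?thesis
    unfolding WT_st_def by (simp add: inverse_powr_minus pos_divide_le_eq)
qed

lemma WT_st_mono:
  assumes "WT_st b s t" "s \<le> s'" "t \<le> t'"
  shows "WT_st b s' t'"
  unfolding WT_st_iff
proof (intro allI impI)
  fix \<delta> :: real assume "\<delta> > 0"
  then obtain R where R: "\<And>d y. 1 \<le> d \<Longrightarrow> 1 < y \<Longrightarrow> R < y + real d \<Longrightarrow>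
      ln (cnt d y) \<le> \<delta> * (y powr s + real d powr t)"
    using assms(1) unfolding WT_st_iff by meson
  show "\<exists>R. \<forall>d\<ge>1. \<forall>y>1. R < y + real d \<longrightarrow> ln (cnt d y) \<le> \<delta> * (y powr s' + real d powr t')"
  proof (intro exI[of _ R] allI impI)
    fix d :: nat and y :: real assume dy: "1 \<le> d" "1 < y" "R < y + real d"
    have "\<delta> * (y powr s + real d powr t) \<le> \<delta> * (y powr s' + real d powr t')"
      using dy \<open>\<delta> > 0\<close> assms(2,3) by (intro mult_left_mono add_mono powr_mono) auto
    with R[OF dy] show "ln (cnt d y) \<le> \<delta> * (y powr s' + real d powr t')" by simp
  qed
qed

text \<open>Large \<open>y + d\<close> forces \<open>y powr s + d powr t\<close> to be large, which
  absorbs the constant \<open>C\<close>; the term \<open>D * ln y\<close> is absorbed by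
  \<open>y powr s\<close>. Each of the three contributions gets a third of
  \<open>\<delta>\<close>.\<close>

lemma WT_stI:
  assumes st: "0 < s" "0 < t"
    and H: "\<And>\<delta>. 0 < \<delta> \<Longrightarrow> \<exists>C D. 0 \<le> D \<and>
      (\<forall>d\<ge>1. \<forall>y>1. ln (cnt d y) \<le> \<delta> * (y powr s + real d powr t) + C + D * ln y)"
  shows "WT_st b s t"
  unfolding WT_st_iff
proof (intro allI impI)
  fix \<delta> :: real assume \<delta>: "\<delta> > 0"
  then obtain C D where CD: "0 \<le> D" "\<And>d y. 1 \<le> d \<Longrightarrow> 1 < y \<Longrightarrow>
      ln (cnt d y) \<le> \<delta> / 3 * (y powr s + real d powr t) + C + D * ln y"
    using H[of "\<delta> / 3"] by auto
  \<comment> \<open>Chosen so that \<open>D / s * \<eta> \<le> \<delta> / 3\<close> in the estimate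
    from \<open>ln (\<eta> * y powr s) \<le> \<eta> * y powr s\<close>; the \<open>+ 1\<close>
    covers \<open>D = 0\<close>.\<close>
  define \<eta> where "\<eta> = \<delta> * s / (3 * (D + 1))"
  have \<eta>: "\<eta> > 0" using \<delta> st CD(1) by (simp add: \<eta>_def)
  define C' where "C' = \<bar>C\<bar> + \<bar>D / s * ln \<eta>\<bar>"
  define z where "z = 3 * C' / \<delta>"
  have z: "z \<ge> 0" "C' = \<delta> / 3 * z" using \<delta> by (auto simp: z_def C'_def)
  have ln_le: "D * ln y \<le> \<delta> / 3 * y powr s + \<bar>D / s * ln \<eta>\<bar>" if "1 < y" for y
  proof -
    have "ln (\<eta> * y powr s) \<le> \<eta> * y powr s"
      using \<eta> that ln_le_minus_one[of "\<eta> * y powr s"] by simp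
    then have "s * ln y \<le> \<eta> * y powr s - ln \<eta>"
      using \<eta> that by (simp add: ln_mult ln_powr)
    then have "D / s * (s * ln y) \<le> D / s * (\<eta> * y powr s - ln \<eta>)"
      using CD(1) st by (intro mult_left_mono) auto
    then have "D * ln y \<le> D / s * \<eta> * y powr s - D / s * ln \<eta>"
      using st by (simp add: algebra_simps)
    also have "D / s * \<eta> * y powr s \<le> \<delta> / 3 * y powr s"
    proof (intro mult_right_mono)
      have "D / s * \<eta> = \<delta> / 3 * (D / (D + 1))" using st CD(1) by (simp add: \<eta>_def)
      also have "\<dots> \<le> \<delta> / 3 * 1" using \<delta> CD(1) by (intro mult_left_mono) auto
      finally show "D / s * \<eta> \<le> \<delta> / 3" by simp
    qed simp
    finally show ?thesis by linarith
  qed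
  \<comment> \<open>If the sum \<open>y + d\<close> exceeds \<open>R\<close>, one of its terms
    exceeds \<open>R / 2\<close>, and the corresponding power reaches \<open>z\<close>.\<close>
  define R where "R = 2 * max (z powr (1 / s)) (z powr (1 / t))"
  show "\<exists>R. \<forall>d\<ge>1. \<forall>y>1. R < y + real d \<longrightarrow> ln (cnt d y) \<le> \<delta> * (y powr s + real d powr t)"
  proof (intro exI[of _ R] allI impI)
    fix d :: nat and y :: real assume dy: "1 \<le> d" "1 < y" "R < y + real d"
    have "z \<le> y powr s + real d powr t"
    proof (cases "z powr (1 / s) \<le> y")
      case True
      then have "(z powr (1 / s)) powr s \<le> y powr s" using st by (intro powr_mono2) auto
      then show ?thesis using z st by (simp add: powr_powr add_increasing2)
    next
      case False
      then have "z powr (1 / t) \<le> real d" using dy(3) unfolding R_def by linarith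
      then have "(z powr (1 / t)) powr t \<le> real d powr t" using st by (intro powr_mono2) auto
      then show ?thesis using z st by (simp add: powr_powr add_increasing)
    qed
    then have "\<delta> / 3 * z \<le> \<delta> / 3 * (y powr s + real d powr t)"
      using \<delta> by (intro mult_left_mono) auto
    moreover have "\<delta> / 3 * y powr s \<le> \<delta> / 3 * (y powr s + real d powr t)"
      using \<delta> by (intro mult_left_mono) auto
    ultimately show "ln (cnt d y) \<le> \<delta> * (y powr s + real d powr t)"
      using CD(2)[OF dy(1,2)] ln_le[OF dy(2)] z(2) unfolding C'_def by linarith
  qed
qed

lemma ln_cnt_le_sum:
  assumes "1 < y"
  shows "ln (cnt d y) \<le> ln y * (\<Sum>j=1..d. 1 / b j)"
proof -
  have "ln (cnt d y) \<le> 0 * (y\<^sup>2 - 1) + (\<Sum>j=1..d. ln y / b j)"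
    unfolding cnt_def
  proof (rule ln_card_level_le)
    fix j assume "j \<in> {1..d}"
    then show "(\<Sum>m | wt b j m < y\<^sup>2 - 1. exp (- 0 * wt b j m)) \<le> exp (ln y / b j)"
      by (rule coordinate_rankin_card[rotated 2]) (use assms b_pos X_pos in auto)
  qed (use assms b_pos X_pos in auto)
  then show ?thesis by (simp add: sum_distrib_left)
qed

lemma ln_cnt_le_rankin:
  assumes "1 < y" "0 \<le> \<sigma>"
    and Q: "\<And>M. (\<Sum>j\<in>{J<..d}. \<Sum>m=1..M. exp (- \<sigma> * wt b j (int m))) \<le> Q"
  shows "ln (cnt d y) \<le> \<sigma> * y\<^sup>2 + real J * (ln y / b 1) + 2 * Q"
  unfolding cnt_def
  by (intro ln_card_level_rankin) (use assms pos b_mono b_pos X_pos in auto)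

text \<open>The order of quantifiers is the point: \<open>C\<close> and \<open>J\<close> depend on
  \<open>\<delta>\<close> only, whereas \<open>\<sigma>\<close> and \<open>Q\<close> may vary with
  \<open>d\<close> and \<open>y\<close>. The first \<open>J\<close> coordinates enter as the
  coefficient of \<open>ln y\<close>.\<close>

lemma WT_st_rankin:
  assumes st: "0 < s" "0 < t"
    and H: "\<And>\<delta>. 0 < \<delta> \<Longrightarrow> \<exists>C J. \<forall>d\<ge>1. \<forall>y>1. \<exists>\<sigma>\<ge>0. \<exists>Q. \<sigma> * y\<^sup>2 + 2 * Q \<le> \<delta> * (y powr s + real d powr t) + C \<and>
      (\<forall>M. (\<Sum>j\<in>{J<..d}. \<Sum>m=1..M. exp (- \<sigma> * wt b j (int m))) \<le> Q)"
  shows "WT_st b s t"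
proof (rule WT_stI[OF st])
  fix \<delta> :: real assume "\<delta> > 0"
  from H[OF this] obtain C J where CJ: "\<And>d y. 1 \<le> d \<Longrightarrow> 1 < y \<Longrightarrow>
      \<exists>\<sigma>\<ge>0. \<exists>Q. \<sigma> * y\<^sup>2 + 2 * Q \<le> \<delta> * (y powr s + real d powr t) + C \<and>
      (\<forall>M. (\<Sum>j\<in>{J<..d}. \<Sum>m=1..M. exp (- \<sigma> * wt b j (int m))) \<le> Q)"
    by metis
  show "\<exists>C D. 0 \<le> D \<and>
      (\<forall>d\<ge>1. \<forall>y>1. ln (cnt d y) \<le> \<delta> * (y powr s + real d powr t) + C + D * ln y)"
  proof (rule exI[of _ C], rule exI[of _ "real J / b 1"], intro conjI allI impI)
    show "0 \<le> real J / b 1" using pos by simp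
    fix d :: nat and y :: real assume dy: "1 \<le> d" "1 < y"
    obtain \<sigma> Q where "0 \<le> \<sigma>" "\<sigma> * y\<^sup>2 + 2 * Q \<le> \<delta> * (y powr s + real d powr t) + C"
        "\<forall>M. (\<Sum>j\<in>{J<..d}. \<Sum>m=1..M. exp (- \<sigma> * wt b j (int m))) \<le> Q"
      using CJ[OF dy] by auto
    then show "ln (cnt d y) \<le> \<delta> * (y powr s + real d powr t) + C + real J / b 1 * ln y"
      using ln_cnt_le_rankin[OF dy(2), of \<sigma> J d Q] by simp
  qed
qed

section \<open>Polynomial and quasi-polynomial tractability\<close>

lemma cnt_le_powr:
  assumes "1 < y" "(\<Sum>j=1..d. 1 / b j) \<le> p"
  shows "cnt d y \<le> y powr p"
proof -
  have "ln (cnt d y) \<le> ln y * (\<Sum>j=1..d. 1 / b j)" by (rule ln_cnt_le_sum[OF assms(1)])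
  also have "\<dots> \<le> ln y * p" using assms by (intro mult_left_mono) auto
  finally have "exp (ln (cnt d y)) \<le> exp (ln y * p)" by simp
  then show ?thesis
    using cnt_ge_1[OF assms(1), of d] assms(1) by (simp add: powr_def mult.commute)
qed

text \<open>For fixed \<open>d\<close> a box inside the level set already grows like
  \<open>y powr (\<Sum>j=1..d. 1 / b j)\<close>. The factor \<open>K\<close> may depend on
  \<open>d\<close>, so the same lemma serves PT, with \<open>K = C * d powr q\<close>, and
  QPT.\<close>

lemma sum_le_exponent:
  assumes d: "1 \<le> d" and K: "\<And>y. 1 < y \<Longrightarrow> cnt d y \<le> K * y powr p"
  shows "(\<Sum>j=1..d. 1 / b j) \<le> p"
proof (rule ccontr)
  define q where "q = (\<Sum>j=1..d. 1 / b j)"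
  assume "\<not> (\<Sum>j=1..d. 1 / b j) \<le> p"
  then have "p < q" by (simp add: q_def)
  \<comment> \<open>The \<open>1 / (2 * d)\<close> combines the share \<open>1 / d\<close> of each
    coordinate with \<open>y\<^sup>2 - 1 \<ge> y\<^sup>2 / 2\<close> for
    \<open>y \<ge> 2\<close>.\<close>
  define c where "c = (\<Prod>j=1..d. (1 / (2 * real d)) powr (1 / (2 * b j)) / (2 * pi))"
  have c: "c > 0" using d unfolding c_def by (intro prod_pos) auto
  have lower: "c * y powr q \<le> K * y powr p" if "2 \<le> y" for y
  proof -
    have "c * y powr q = c * (\<Prod>j=1..d. y powr (1 / b j))"
      using that unfolding q_def by (simp add: powr_sum)
    also have "\<dots> = (\<Prod>j=1..d. (1 / (2 * real d)) powr (1 / (2 * b j)) / (2 * pi) * (y powr (1 / b j)))"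
      unfolding c_def by (rule prod.distrib[symmetric])
    also have "\<dots> \<le> (\<Prod>j=1..d. ((y\<^sup>2 - 1) / real d) powr (1 / (2 * b j)) / (2 * pi))"
    proof (intro prod_mono conjI)
      fix j assume "j \<in> {1..d}"
      then have bj: "0 < b j" by (intro b_pos) auto
      have "y powr (1 / b j) = (y\<^sup>2) powr (1 / (2 * b j))"
        using that by (simp add: powr_powr flip: powr_numeral)
      then have "(1 / (2 * real d)) powr (1 / (2 * b j)) * y powr (1 / b j)
          = (1 / (2 * real d) * y\<^sup>2) powr (1 / (2 * b j))"
        by (simp only: powr_mult)
      also have "\<dots> \<le> ((y\<^sup>2 - 1) / real d) powr (1 / (2 * b j))"
      proof (intro powr_mono2)
        have "2\<^sup>2 \<le> y\<^sup>2" using that by (intro power_mono) auto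
        then show "1 / (2 * real d) * y\<^sup>2 \<le> (y\<^sup>2 - 1) / real d"
          using d by (simp add: field_simps)
      qed (use bj d in auto)
      finally show "(1 / (2 * real d)) powr (1 / (2 * b j)) / (2 * pi) * y powr (1 / b j)
          \<le> ((y\<^sup>2 - 1) / real d) powr (1 / (2 * b j)) / (2 * pi)"
        by (simp add: divide_right_mono)
    qed auto
    also have "\<dots> \<le> cnt d y"
      unfolding cnt_def using that d X_pos[of y] by (intro card_level_ge_powr b_pos) auto
    also have "\<dots> \<le> K * y powr p" using that by (intro K) auto
    finally show ?thesis .
  qed
  \<comment> \<open>Large enough that \<open>y powr (q - p)\<close> exceeds
    \<open>K / c\<close>.\<close>
  define y where "y = max 2 ((\<bar>K\<bar> / c + 1) powr (1 / (q - p)))"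
  have y: "2 \<le> y" by (simp add: y_def)
  have "\<bar>K\<bar> / c + 1 = ((\<bar>K\<bar> / c + 1) powr (1 / (q - p))) powr (q - p)"
    using \<open>p < q\<close> c by (simp add: powr_powr add_nonneg_pos)
  also have "\<dots> \<le> y powr (q - p)" using \<open>p < q\<close> by (intro powr_mono2) (auto simp: y_def)
  also have "\<dots> = y powr q / y powr p" by (rule powr_diff)
  also have "\<dots> \<le> K / c" using lower[OF y] y c by (simp add: field_simps)
  also have "\<dots> \<le> \<bar>K\<bar> / c" using c by (intro divide_right_mono) auto
  finally show False by simp
qed

lemma summable_iff_bounded:
  "summable (\<lambda>j. 1 / b (Suc j)) \<longleftrightarrow> (\<exists>p. \<forall>d\<ge>1. (\<Sum>j=1..d. 1 / b j) \<le> p)"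
proof -
  have nonneg: "0 \<le> 1 / b (Suc j)" for j using b_pos[of "Suc j"] by simp
  have eq: "(\<Sum>j=1..d. 1 / b j) = (\<Sum>j<d. 1 / b (Suc j))" for d
    by (rule sum.reindex_bij_witness[of _ Suc "\<lambda>j. j - 1"]) auto
  show ?thesis
  proof
    assume "summable (\<lambda>j. 1 / b (Suc j))"
    then show "\<exists>p. \<forall>d\<ge>1. (\<Sum>j=1..d. 1 / b j) \<le> p"
      unfolding eq using nonneg sum_le_suminf[of "\<lambda>j. 1 / b (Suc j)"] by blast
  next
    assume "\<exists>p. \<forall>d\<ge>1. (\<Sum>j=1..d. 1 / b j) \<le> p"
    then obtain p where p: "\<And>d. 1 \<le> d \<Longrightarrow> (\<Sum>j<d. 1 / b (Suc j)) \<le> p" unfolding eq by blast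
    have "0 \<le> (\<Sum>j<1. 1 / b (Suc j))" by (intro sum_nonneg nonneg)
    then have "0 \<le> p" using p[of 1] by linarith
    show "summable (\<lambda>j. 1 / b (Suc j))"
    proof (rule summableI_nonneg_bounded[where x=p])
      show "(\<Sum>j<n. 1 / b (Suc j)) \<le> p" for n
        using p[of n] \<open>0 \<le> p\<close> by (cases "n = 0") auto
    qed (rule nonneg)
  qed
qed

lemma SPT_if_summable:
  assumes "summable (\<lambda>j. 1 / b (Suc j))"
  shows "SPT b"
proof -
  obtain p where p: "\<And>d. 1 \<le> d \<Longrightarrow> (\<Sum>j=1..d. 1 / b j) \<le> p"
    using assms unfolding summable_iff_bounded by blast
  have "0 \<le> p" using p[of 1] pos by (auto intro: order_trans[rotated])
  moreover have "\<forall>d\<ge>1. \<forall>y>1. cnt d y \<le> 1 * y powr p"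
    using cnt_le_powr p by simp
  ultimately show ?thesis unfolding SPT_iff by (intro exI[of _ 1] exI[of _ p]) auto
qed

lemma PT_if_SPT: "SPT b \<Longrightarrow> PT b"
  unfolding SPT_iff PT_iff
proof (elim exE conjE)
  fix C p assume Cp: "0 \<le> C" "0 \<le> p" "\<forall>d\<ge>1. \<forall>y>1. cnt d y \<le> C * y powr p"
  then show "\<exists>C p q. 0 \<le> C \<and> 0 \<le> p \<and> 0 \<le> q \<and> (\<forall>d\<ge>1. \<forall>y>1. cnt d y \<le> C * real d powr q * y powr p)"
    by (intro exI[of _ C] exI[of _ p] exI[of _ 0]) auto
qed

lemma summable_if_PT:
  assumes "PT b"
  shows "summable (\<lambda>j. 1 / b (Suc j))"
proof -
  obtain C p q where "\<And>d y. 1 \<le> d \<Longrightarrow> 1 < y \<Longrightarrow> cnt d y \<le> C * real d powr q * y powr p"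
    using assms unfolding PT_iff by blast
  then have "\<forall>d\<ge>1. (\<Sum>j=1..d. 1 / b j) \<le> p"
    using sum_le_exponent[of _ "C * real _ powr q" p] by blast
  then show ?thesis unfolding summable_iff_bounded by blast
qed

lemma QPT_iff_bdd:
  "QPT b \<longleftrightarrow> bdd_above {(\<Sum>j=1..d. 1 / b j) / (1 + ln (real d)) | d. d \<ge> 1}"
proof
  assume "QPT b"
  then obtain C t where Ct: "\<And>d y. 1 \<le> d \<Longrightarrow> 1 < y \<Longrightarrow>
      cnt d y \<le> C * exp (t * (1 + ln y) * (1 + ln (real d)))"
    unfolding QPT_iff by blast
  have "(\<Sum>j=1..d. 1 / b j) / (1 + ln (real d)) \<le> t" if d: "1 \<le> d" for d
  proof -
    let ?l = "1 + ln (real d)"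
    have "(\<Sum>j=1..d. 1 / b j) \<le> t * ?l"
    proof (rule sum_le_exponent[OF d])
      fix y :: real assume y: "1 < y"
      \<comment> \<open>For fixed \<open>d\<close> the bound is a power of \<open>y\<close> with
        exponent \<open>t * ?l\<close>; the remaining factor is a constant.\<close>
      have "exp (t * (1 + ln y) * ?l) = exp (t * ?l) * y powr (t * ?l)"
        using y by (simp add: powr_def algebra_simps flip: exp_add)
      then show "cnt d y \<le> (C * exp (t * ?l)) * y powr (t * ?l)"
        using Ct[OF d y] by (simp add: mult.assoc)
    qed
    moreover have "0 < ?l" using d by (simp add: add_pos_nonneg)
    ultimately show ?thesis by (simp add: pos_divide_le_eq)
  qed
  then show "bdd_above {(\<Sum>j=1..d. 1 / b j) / (1 + ln (real d)) | d. d \<ge> 1}"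
    by (intro bdd_aboveI[where M=t]) auto
next
  assume "bdd_above {(\<Sum>j=1..d. 1 / b j) / (1 + ln (real d)) | d. d \<ge> 1}"
  then obtain B where B: "\<And>d. 1 \<le> d \<Longrightarrow> (\<Sum>j=1..d. 1 / b j) / (1 + ln (real d)) \<le> B"
    unfolding bdd_above_def by blast
  define t where "t = max 1 B"
  have "cnt d y \<le> 1 * exp (t * (1 + ln y) * (1 + ln (real d)))" if d: "1 \<le> d" and y: "1 < y" for d y
  proof -
    have l: "0 < 1 + ln (real d)" using d by (simp add: add_pos_nonneg)
    have "(\<Sum>j=1..d. 1 / b j) \<le> B * (1 + ln (real d))"
      using B[OF d] l by (simp add: pos_divide_le_eq)
    also have "\<dots> \<le> t * (1 + ln (real d))" using l by (intro mult_right_mono) (auto simp: t_def)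
    finally have "cnt d y \<le> y powr (t * (1 + ln (real d)))" by (rule cnt_le_powr[OF y])
    also have "\<dots> = exp (ln y * (t * (1 + ln (real d))))" using y by (simp add: powr_def mult.commute)
    also have "\<dots> \<le> exp (t * (1 + ln y) * (1 + ln (real d)))"
    proof -
      have "0 \<le> t * (1 + ln (real d))" using l by (simp add: t_def)
      then show ?thesis by (simp add: algebra_simps)
    qed
    finally show ?thesis by simp
  qed
  then show "QPT b"
    unfolding QPT_iff by (intro exI[of _ 1] exI[of _ t]) (auto simp: t_def)
qed

section \<open>Necessary growth conditions for weak tractability\<close>

text \<open>If the growth condition fails along some \<open>d\<close>, then all frequencies with entries in \<open>{-1, 0, 1}\<close>
  lie below the level \<open>y\<^sup>2 - 1 = Z d powr (2 / s)\<close>, while \<open>y powr s\<close> is only of order \<open>d\<close>.\<close>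

lemma necessary_power_growth:
  assumes wt: "WT_st b s t" and s: "0 < s" "s \<le> 2" and t: "0 < t" "t \<le> 1"
  shows "filterlim (\<lambda>j. (2 * pi) powr (2 * b j) / real j powr ((2 - s) / s)) at_top sequentially"
proof (rule ccontr)
  assume "\<not> ?thesis"
  then obtain Z0 where "\<not> eventually (\<lambda>j. Z0 \<le> (2 * pi) powr (2 * b j) / real j powr ((2 - s) / s)) sequentially"
    unfolding filterlim_at_top by blast
  define Z where "Z = max 1 Z0"
  have freq: "\<exists>d\<ge>N. (2 * pi) powr (2 * b d) / real d powr ((2 - s) / s) < Z" for N
    using \<open>\<not> eventually _ _\<close> unfolding eventually_sequentially Z_def
    by (metis less_max_iff_disj linorder_not_less)
  \<comment> \<open>The constant in \<open>y powr s + d powr t \<le> c * d\<close>. Weak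
    tractability with \<open>1 / (2 * c)\<close> then bounds \<open>ln (cnt d y)\<close> by
    \<open>d / 2\<close>, whereas \<open>3 ^ d\<close> points and \<open>ln 3 > 1\<close> force it
    to be at least \<open>d\<close>.\<close>
  define c where "c = (Z + 1) powr (s / 2) + 1"
  have c: "c > 0" by (simp add: c_def add_nonneg_pos)
  obtain R where R: "\<And>d y. 1 \<le> d \<Longrightarrow> 1 < y \<Longrightarrow> R < y + real d \<Longrightarrow>
      ln (cnt d y) \<le> 1 / (2 * c) * (y powr s + real d powr t)"
    using wt c unfolding WT_st_iff by (metis mult_pos_pos zero_less_divide_1_iff zero_less_numeral)
  obtain d where d: "d \<ge> max 1 (nat \<lceil>R\<rceil>)" "(2 * pi) powr (2 * b d) / real d powr ((2 - s) / s) < Z"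
    using freq by blast
  have d1: "1 \<le> d" "R \<le> real d" using d(1) by linarith+
  define D where "D = real d powr (2 / s)"
  have D1: "1 \<le> D" using d1 s unfolding D_def by (intro ge_one_powr_ge_zero) auto
  have "(2 * pi) powr (2 * b d) < Z * real d powr ((2 - s) / s)"
    using d(2) d1 by (simp add: pos_divide_less_eq)
  then have "real d * (2 * pi) powr (2 * b d) < real d * (Z * real d powr ((2 - s) / s))"
    using d1 by (intro mult_strict_left_mono) auto
  also have "\<dots> = Z * real d powr (1 + (2 - s) / s)"
    using d1 by (simp add: powr_add)
  also have "1 + (2 - s) / s = 2 / s" using s by (simp add: field_simps)
  finally have lt: "real d * (2 * pi) powr (2 * b d) < Z * D" by (simp add: D_def)
  define y where "y = sqrt (Z * D + 1)"
  have ZD: "0 < Z * D" using D1 by (simp add: Z_def)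
  then have y: "1 < y" "y\<^sup>2 - 1 = Z * D" by (simp_all add: y_def)
  have "3 ^ d \<le> card (level b d (y\<^sup>2 - 1))"
    using d1 b_mono b_pos lt X_pos[OF y(1)] unfolding y(2)[symmetric]
    by (intro card_level_ge_3_power) auto
  then have "real (3 ^ d) \<le> cnt d y" unfolding cnt_def by (simp only: of_nat_le_iff)
  then have "ln (3 ^ d) \<le> ln (cnt d y)" by (simp add: ln_mono)
  moreover have "ln (3 ^ d) = real d * ln (3::real)" by (simp add: ln_realpow)
  moreover have "real d * 1 \<le> real d * ln 3" using ln3_gt_1 by (intro mult_left_mono) auto
  ultimately have "real d \<le> ln (cnt d y)" by simp
  also have "\<dots> \<le> 1 / (2 * c) * (y powr s + real d powr t)"
    using d1 y by (intro R) auto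
  also have "y powr s + real d powr t \<le> c * real d"
  proof -
    have "y powr s = (Z * D + 1) powr (s / 2)"
      using ZD by (simp add: y_def powr_half_sqrt[symmetric] powr_powr)
    also have "\<dots> \<le> ((Z + 1) * D) powr (s / 2)"
      using s ZD D1 by (intro powr_mono2) (auto simp: algebra_simps)
    also have "\<dots> = (Z + 1) powr (s / 2) * real d"
      using s d1 by (simp add: powr_mult D_def powr_powr Z_def)
    finally have "y powr s \<le> (Z + 1) powr (s / 2) * real d" .
    moreover have "real d powr t \<le> real d powr 1" using d1 t by (intro powr_mono) auto
    ultimately show ?thesis by (simp add: c_def algebra_simps)
  qed
  then have "1 / (2 * c) * (y powr s + real d powr t) \<le> 1 / (2 * c) * (c * real d)"
    using c by (intro mult_left_mono) auto
  also have "\<dots> = real d / 2" using c by simp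
  finally show False using d1 by simp
qed

text \<open>With weights up to \<open>Z * ln d\<close>, admitting all vectors over
  \<open>{-1, 0, 1}\<close> would need \<open>y\<^sup>2\<close> of order \<open>d * ln d\<close> and
  give only \<open>d * ln 3\<close>. Sparse vectors regain the logarithm: choosing \<open>r\<close>
  of \<open>d\<close> entries has log-count at least \<open>r * ln (d / r)\<close>, of the same
  order \<open>r * ln d\<close> as \<open>y\<^sup>2\<close> when \<open>r\<close> is about
  \<open>d powr \<tau>\<close>.\<close>

lemma necessary_log_growth:
  assumes wt: "WT_st b 2 t" and t: "0 < t" "t < 1"
  shows "filterlim (\<lambda>j. (2 * pi) powr (2 * b j) / ln (real j)) at_top sequentially"
proof (rule ccontr)
  assume "\<not> ?thesis"
  then obtain Z0 where "\<not> eventually (\<lambda>j. Z0 \<le> (2 * pi) powr (2 * b j) / ln (real j)) sequentially"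
    unfolding filterlim_at_top by blast
  define Z where "Z = max 1 Z0"
  have freq: "\<exists>d\<ge>N. (2 * pi) powr (2 * b d) / ln (real d) < Z" for N
    using \<open>\<not> eventually _ _\<close> unfolding eventually_sequentially Z_def
    by (metis less_max_iff_disj linorder_not_less)
  \<comment> \<open>Above \<open>t\<close>, so that \<open>d powr t\<close> is dominated by
    \<open>r\<close>; below 1, so that \<open>ln (d / r)\<close> keeps a fixed fraction of
    \<open>ln d\<close>.\<close>
  define \<tau> where "\<tau> = (1 + t) / 2"
  have \<tau>: "t < \<tau>" "\<tau> < 1" "0 < \<tau>" using t by (simp_all add: \<tau>_def)
  have Z: "Z \<ge> 1" by (simp add: Z_def)
  \<comment> \<open>\<open>Z + 3\<close> collects \<open>Z\<close> and 1 from
    \<open>y\<^sup>2\<close> and 2 from \<open>d powr t \<le> 2 * r\<close>. With this choice the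
    upper bound is half the lower one.\<close>
  define \<delta> where "\<delta> = (1 - \<tau>) / (2 * (Z + 3))"
  have "\<delta> > 0" using \<tau> Z by (simp add: \<delta>_def)
  then obtain R where R: "\<And>d y. 1 \<le> d \<Longrightarrow> 1 < y \<Longrightarrow> R < y + real d \<Longrightarrow>
      ln (cnt d y) \<le> \<delta> * (y powr 2 + real d powr t)"
    using wt unfolding WT_st_iff by blast
  obtain d where d: "d \<ge> max 3 (nat \<lceil>R\<rceil>)" "(2 * pi) powr (2 * b d) / ln (real d) < Z"
    using freq by blast
  have d3: "3 \<le> d" "R \<le> real d" using d(1) by linarith+
  have "ln 3 \<le> ln (real d)" using d3 by simp
  then have ln_d: "1 < ln (real d)" using ln3_gt_1 by linarith
  define r where "r = nat \<lfloor>real d powr \<tau>\<rfloor>"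
  have dt1: "1 \<le> real d powr \<tau>" using d3 \<tau> by (intro ge_one_powr_ge_zero) auto
  then have fl: "1 \<le> \<lfloor>real d powr \<tau>\<rfloor>" by simp
  then have "1 \<le> r" unfolding r_def by linarith
  moreover have "real r = real_of_int \<lfloor>real d powr \<tau>\<rfloor>" using fl unfolding r_def by simp
  moreover have "real_of_int \<lfloor>real d powr \<tau>\<rfloor> \<le> real d powr \<tau>"
      "real d powr \<tau> < real_of_int \<lfloor>real d powr \<tau>\<rfloor> + 1" by linarith+
  ultimately have r: "1 \<le> r" "real r \<le> real d powr \<tau>" "real d powr \<tau> \<le> 2 * real r"
    by linarith+
  have "real d powr \<tau> \<le> real d powr 1" using d3 \<tau> by (intro powr_mono) auto
  then have "r \<le> d" using r(2) d3 by simp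
  define y where "y = sqrt (real r * (Z * ln (real d)) + 1)"
  have rZ: "0 < real r * (Z * ln (real d))" using r Z ln_d by (intro mult_pos_pos) auto
  then have y: "1 < y" "y\<^sup>2 = real r * (Z * ln (real d)) + 1" by (simp_all add: y_def)
  have "(2 * pi) powr (2 * b d) < Z * ln (real d)"
    using d(2) ln_d by (simp add: pos_divide_less_eq)
  then have "real r * (2 * pi) powr (2 * b d) < y\<^sup>2 - 1"
    using r unfolding y(2) by simp
  then have "d choose r \<le> card (level b d (y\<^sup>2 - 1))"
    using b_mono b_pos X_pos[OF y(1)] by (intro card_level_ge_binomial) auto
  then have "real (d choose r) \<le> cnt d y" unfolding cnt_def by (simp only: of_nat_le_iff)
  moreover have "(real d / real r) ^ r \<le> real (d choose r)"
    using binomial_ge_n_over_k_pow_k[OF \<open>r \<le> d\<close>, where 'a=real] by simp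
  moreover have dr: "0 < real d / real r" using r d3 by simp
  ultimately have "ln ((real d / real r) ^ r) \<le> ln (cnt d y)"
    by (intro ln_mono) auto
  then have "real r * ln (real d / real r) \<le> ln (cnt d y)"
    using dr by (simp add: ln_realpow)
  moreover have "(1 - \<tau>) * ln (real d) \<le> ln (real d / real r)"
  proof -
    have "ln (real r) \<le> ln (real d powr \<tau>)" using r by (intro ln_mono) auto
    then have "ln (real r) \<le> \<tau> * ln (real d)" using d3 by (simp add: ln_powr)
    moreover have "ln (real d / real r) = ln (real d) - ln (real r)"
      using r d3 by (simp add: ln_div)
    ultimately show ?thesis by (simp add: algebra_simps)
  qed
  then have "real r * ((1 - \<tau>) * ln (real d)) \<le> real r * ln (real d / real r)"
    by (intro mult_left_mono) auto
  ultimately have "real r * ((1 - \<tau>) * ln (real d)) \<le> ln (cnt d y)" by linarith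
  also have "\<dots> \<le> \<delta> * (y powr 2 + real d powr t)" using d3 y by (intro R) auto
  also have "\<dots> \<le> \<delta> * ((Z + 3) * (real r * ln (real d)))"
  proof (intro mult_left_mono)
    have rl: "real r * 1 \<le> real r * ln (real d)" using ln_d by (intro mult_left_mono) auto
    have "real d powr t \<le> real d powr \<tau>" using d3 \<tau> by (intro powr_mono) auto
    then have "real d powr t \<le> 2 * (real r * ln (real d))" using r(3) rl by linarith
    moreover have "1 \<le> real r * ln (real d)" using r(1) rl by linarith
    moreover have "y powr 2 = y\<^sup>2" using y(1) by simp
    ultimately show "y powr 2 + real d powr t \<le> (Z + 3) * (real r * ln (real d))"
      unfolding y(2) by (simp add: algebra_simps)
  qed (use \<open>\<delta> > 0\<close> in auto)
  also have "\<dots> = real r * ((1 - \<tau>) * ln (real d)) / 2"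
    using Z by (simp add: \<delta>_def field_simps)
  finally have "real r * ((1 - \<tau>) * ln (real d)) \<le> 0" by linarith
  moreover have "0 < real r * ((1 - \<tau>) * ln (real d))" using r \<tau> ln_d by (intro mult_pos_pos) auto
  ultimately show False by linarith
qed

section \<open>Sufficient growth conditions for weak tractability\<close>

lemma wt_ge_power:
  assumes "1 \<le> m" "q \<le> 2 * b j"
  shows "(2 * pi) powr (2 * b j) * real m powr q \<le> wt b j (int m)"
  unfolding wt_of_nat using assms by (intro mult_left_mono powr_mono) auto

lemma coordinate_sum_le:
  assumes "1 \<le> b j" "0 < \<sigma>"
  shows "(\<Sum>m=1..M. exp (- \<sigma> * wt b j (int m))) \<le> (\<Sum>m=1..M. exp (- (\<sigma> * (2 * pi) powr (2 * b j)) * (real m)\<^sup>2))"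
proof (rule sum_mono)
  fix m assume m: "m \<in> {1..M}"
  then have "(2 * pi) powr (2 * b j) * (real m)\<^sup>2 \<le> wt b j (int m)"
    using wt_ge_power[of m 2 j] assms by (simp add: powr_numeral)
  then have "\<sigma> * ((2 * pi) powr (2 * b j) * (real m)\<^sup>2) \<le> \<sigma> * wt b j (int m)"
    using assms(2) by (intro mult_left_mono) auto
  then show "exp (- \<sigma> * wt b j (int m)) \<le> exp (- (\<sigma> * (2 * pi) powr (2 * b j)) * (real m)\<^sup>2)"
    by (simp add: mult.assoc)
qed

text \<open>Taking \<open>\<sigma> = \<delta>\<close> spends exactly
  \<open>\<delta> * y\<^sup>2\<close>. Each late coordinate costs at most
  \<open>\<delta> / 2\<close>, which the linear term in \<open>d\<close> can pay for.\<close>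

lemma WT_2_1_if_unbounded:
  assumes lim: "filterlim b at_top sequentially"
  shows "WT_st b 2 1"
proof (rule WT_st_rankin)
  fix \<delta> :: real assume \<delta>: "0 < \<delta>"
  \<comment> \<open>The threshold \<open>4 / \<delta>\<^sup>2\<close> makes the Gaussian parameter
    \<open>v\<close> at least \<open>4 / \<delta>\<close>, so the coordinate sum
    \<open>2 / v\<close> is at most \<open>\<delta> / 2\<close>; the 1 makes the weights at least
    quadratic in \<open>m\<close>.\<close>
  obtain J where J: "\<And>j. J \<le> j \<Longrightarrow> max 1 (4 / \<delta>\<^sup>2) \<le> b j"
    using lim unfolding filterlim_at_top eventually_sequentially by meson
  have coord: "(\<Sum>m=1..M. exp (- \<delta> * wt b j (int m))) \<le> \<delta> / 2" if "J < j" for j M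
  proof -
    have bj: "1 \<le> b j" "4 / \<delta>\<^sup>2 \<le> b j" using J[of j] that by auto
    define v where "v = \<delta> * (2 * pi) powr (2 * b j)"
    have "b j \<le> (2 * pi) powr (2 * b j)" using two_pi_powr_ge[of "2 * b j"] bj by simp
    then have "\<delta> * (4 / \<delta>\<^sup>2) \<le> v" using bj \<delta> unfolding v_def by (intro mult_left_mono) auto
    then have v: "4 / \<delta> \<le> v" using \<delta> by (simp add: power2_eq_square)
    then have "0 < v" using \<delta> by (meson divide_pos_pos less_le_trans zero_less_numeral)
    have "(\<Sum>m=1..M. exp (- \<delta> * wt b j (int m))) \<le> 2 / v"
      using coordinate_sum_le[OF bj(1) \<delta>, of M] sum_exp_squares_le[OF \<open>0 < v\<close>, of M]
      unfolding v_def by linarith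
    also have "\<dots> \<le> \<delta> / 2" using v \<delta> \<open>0 < v\<close> by (simp add: field_simps)
    finally show ?thesis .
  qed
  show "\<exists>C J. \<forall>d\<ge>1. \<forall>y>1. \<exists>\<sigma>\<ge>0. \<exists>Q. \<sigma> * y\<^sup>2 + 2 * Q \<le> \<delta> * (y powr 2 + real d powr 1) + C \<and>
      (\<forall>M. (\<Sum>j\<in>{J<..d}. \<Sum>m=1..M. exp (- \<sigma> * wt b j (int m))) \<le> Q)"
  proof (rule exI[of _ 0], rule exI[of _ J], intro allI impI)
    fix d :: nat and y :: real assume dy: "1 \<le> d" "1 < y"
    have "(\<Sum>j\<in>{J<..d}. \<Sum>m=1..M. exp (- \<delta> * wt b j (int m))) \<le> real d * (\<delta> / 2)" for M
    proof -
      have "(\<Sum>j\<in>{J<..d}. \<Sum>m=1..M. exp (- \<delta> * wt b j (int m))) \<le> real (card {J<..d}) * (\<delta> / 2)"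
        by (rule sum_bounded_above, rule coord) simp
      also have "\<dots> \<le> real d * (\<delta> / 2)" using \<delta> by (intro mult_right_mono) auto
      finally show ?thesis .
    qed
    then show "\<exists>\<sigma>\<ge>0. \<exists>Q. \<sigma> * y\<^sup>2 + 2 * Q \<le> \<delta> * (y powr 2 + real d powr 1) + 0 \<and>
        (\<forall>M. (\<Sum>j\<in>{J<..d}. \<Sum>m=1..M. exp (- \<sigma> * wt b j (int m))) \<le> Q)"
      using \<delta> dy by (intro exI[of _ \<delta>] exI[of _ "real d * (\<delta> / 2)"] conjI)
        (auto simp: algebra_simps)
  qed
qed auto

text \<open>For small \<open>t\<close> a fixed cost per coordinate is too much. Logarithmic growth
  of the weights lowers it to \<open>1 / j\<^sup>2\<close>, and the total stays bounded in
  \<open>d\<close>.\<close>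

lemma WT_2_t_if_log_growth:
  assumes lim: "filterlim (\<lambda>j. (2 * pi) powr (2 * b j) / ln (real j)) at_top sequentially"
    and t: "0 < t"
  shows "WT_st b 2 t"
proof (rule WT_st_rankin)
  fix \<delta> :: real assume \<delta>: "0 < \<delta>"
  \<comment> \<open>The bound \<open>(2 * pi) powr 2\<close> yields \<open>b j \<ge> 1\<close>, and
    \<open>4 / \<delta>\<close> yields \<open>v \<ge> 4 * ln j\<close>, hence
    \<open>exp (- (v / 2)) \<le> 1 / j\<^sup>2\<close>.\<close>
  obtain J0 where J0: "\<And>j. J0 \<le> j \<Longrightarrow> max ((2 * pi) powr 2) (4 / \<delta>) \<le> (2 * pi) powr (2 * b j) / ln (real j)"
    using lim unfolding filterlim_at_top eventually_sequentially by meson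
  define J where "J = max 3 J0"
  have coord: "(\<Sum>m=1..M. exp (- \<delta> * wt b j (int m))) \<le> 1 / (real j)\<^sup>2" if j: "J < j" for j M
  proof -
    have j3: "3 < j" "J0 \<le> j" using j by (auto simp: J_def)
    then have "ln 3 \<le> ln (real j)" by simp
    then have lnj: "1 < ln (real j)" using ln3_gt_1 by linarith
    have a: "max ((2 * pi) powr 2) (4 / \<delta>) * ln (real j) \<le> (2 * pi) powr (2 * b j)"
      using J0[OF j3(2)] lnj by (simp only: pos_le_divide_eq)
    have "0 \<le> max ((2 * pi) powr 2) (4 / \<delta>)" by (rule max.coboundedI1) simp
    then have "(2 * pi) powr 2 * 1 \<le> max ((2 * pi) powr 2) (4 / \<delta>) * ln (real j)"
      using lnj by (intro mult_mono max.cobounded1) auto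
    with a have "(2 * pi) powr 2 \<le> (2 * pi) powr (2 * b j)" by linarith
    then have bj: "1 \<le> b j" unfolding two_pi_powr_mono_iff by simp
    define v where "v = \<delta> * (2 * pi) powr (2 * b j)"
    have "4 / \<delta> * ln (real j) \<le> max ((2 * pi) powr 2) (4 / \<delta>) * ln (real j)"
      using lnj by (intro mult_right_mono) auto
    with a have "\<delta> * (4 / \<delta> * ln (real j)) \<le> v" using \<delta> unfolding v_def by (intro mult_left_mono) auto
    then have v: "4 * ln (real j) \<le> v" using \<delta> by simp
    have "(\<Sum>m=1..M. exp (- \<delta> * wt b j (int m))) \<le> (\<Sum>m=1..M. exp (- v * (real m)\<^sup>2))"
      unfolding v_def by (rule coordinate_sum_le[OF bj \<delta>])
    \<comment> \<open>One half of the exponent provides the decay in \<open>j\<close>, using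
      \<open>m \<ge> 1\<close>; the other half makes the sum over \<open>m\<close> converge.\<close>
    also have "\<dots> \<le> (\<Sum>m=1..M. exp (- (v / 2)) * exp (- (v / 2) * (real m)\<^sup>2))"
    proof (rule sum_mono)
      fix m assume "m \<in> {1..M}"
      then have "1 \<le> (real m)\<^sup>2" by (simp add: one_le_power)
      then have "v / 2 * 1 \<le> v / 2 * (real m)\<^sup>2" using v lnj by (intro mult_left_mono) auto
      then show "exp (- v * (real m)\<^sup>2) \<le> exp (- (v / 2)) * exp (- (v / 2) * (real m)\<^sup>2)"
        by (simp flip: exp_add)
    qed
    also have "\<dots> = exp (- (v / 2)) * (\<Sum>m=1..M. exp (- (v / 2) * (real m)\<^sup>2))"
      by (rule sum_distrib_left[symmetric])
    also have "\<dots> \<le> (1 / (real j)\<^sup>2) * 1"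
    proof (intro mult_mono sum_nonneg)
      have "exp (- (v / 2)) \<le> exp (- (2 * ln (real j)))" using v by simp
      also have "\<dots> = 1 / (real j)\<^sup>2"
        using j3 by (simp add: exp_minus exp_double divide_inverse)
      finally show "exp (- (v / 2)) \<le> 1 / (real j)\<^sup>2" .
      have "(\<Sum>m=1..M. exp (- (v / 2) * (real m)\<^sup>2)) \<le> 2 / (v / 2)"
        using v lnj by (intro sum_exp_squares_le) auto
      also have "\<dots> \<le> 1" using v lnj by simp
      finally show "(\<Sum>m=1..M. exp (- (v / 2) * (real m)\<^sup>2)) \<le> 1" .
    qed auto
    finally show ?thesis by simp
  qed
  show "\<exists>C J. \<forall>d\<ge>1. \<forall>y>1. \<exists>\<sigma>\<ge>0. \<exists>Q. \<sigma> * y\<^sup>2 + 2 * Q \<le> \<delta> * (y powr 2 + real d powr t) + C \<and>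
      (\<forall>M. (\<Sum>j\<in>{J<..d}. \<Sum>m=1..M. exp (- \<sigma> * wt b j (int m))) \<le> Q)"
  proof (rule exI[of _ 4], rule exI[of _ J], intro allI impI)
    fix d :: nat and y :: real assume dy: "1 \<le> d" "1 < y"
    have "(\<Sum>j\<in>{J<..d}. \<Sum>m=1..M. exp (- \<delta> * wt b j (int m))) \<le> 2" for M
    proof -
      have "(\<Sum>j\<in>{J<..d}. \<Sum>m=1..M. exp (- \<delta> * wt b j (int m))) \<le> (\<Sum>j\<in>{J<..d}. 1 / (real j)\<^sup>2)"
        by (intro sum_mono coord) auto
      also have "\<dots> \<le> (\<Sum>j=1..d. 1 / (real j)\<^sup>2)" by (intro sum_mono2) auto
      finally show ?thesis using sum_inverse_squares_le[of d] by linarith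
    qed
    moreover have "\<delta> * y\<^sup>2 + 2 * 2 \<le> \<delta> * (y powr 2 + real d powr t) + 4"
      using \<delta> dy by (simp add: distrib_left)
    ultimately show "\<exists>\<sigma>\<ge>0. \<exists>Q. \<sigma> * y\<^sup>2 + 2 * Q \<le> \<delta> * (y powr 2 + real d powr t) + 4 \<and>
        (\<forall>M. (\<Sum>j\<in>{J<..d}. \<Sum>m=1..M. exp (- \<sigma> * wt b j (int m))) \<le> Q)"
      using \<delta> by (intro exI[of _ \<delta>] conjI exI[of _ 2]) auto
  qed
qed (use t in auto)

text \<open>With \<open>\<sigma>\<close> proportional to \<open>y powr (s - 2)\<close> the price
  \<open>\<sigma> * y\<^sup>2\<close> is \<open>\<delta> / 2 * y powr s\<close>. The sum over all
  coordinates is bounded independently of \<open>d\<close> by a multiple of \<open>y powr s\<close>,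
  so every \<open>t > 0\<close> is covered.\<close>

lemma WT_s_t_if_power_growth:
  assumes s: "0 < s" "s < 2" and t: "0 < t"
    and lim: "filterlim (\<lambda>j. (2 * pi) powr (2 * b j) / real j powr ((2 - s) / s)) at_top sequentially"
  shows "WT_st b s t"
proof (rule WT_st_rankin[OF s(1) t])
  define \<gamma> where "\<gamma> = (2 - s) / s"
  have \<gamma>: "0 < \<gamma>" using s by (simp add: \<gamma>_def)
  obtain K where K: "K > 0" "\<And>x. 0 \<le> x \<Longrightarrow> exp (- 1 * x powr \<gamma>) \<le> K / (1 + x\<^sup>2)"
    using exp_powr_decay[of 1 \<gamma>] \<gamma> by auto
  fix \<delta> :: real assume \<delta>: "0 < \<delta>"
  \<comment> \<open>Calibrated to give \<open>pi * K / h = \<delta> / 4 * y powr s\<close> below;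
    doubled, it uses up the other half of \<open>\<delta>\<close>.\<close>
  define A where "A = 2 / \<delta> * (4 * pi * K / \<delta>) powr \<gamma>"
  have A: "0 < A" using \<delta> K(1) by (simp add: A_def)
  \<comment> \<open>The bound \<open>(2 * pi) powr (2 * \<gamma>)\<close> forces
    \<open>\<gamma> \<le> b j\<close>, so that powers of \<open>m\<close> in the weight may be
    lowered to exponent \<open>2 * \<gamma>\<close>.\<close>
  obtain J0 where J0: "\<And>j. J0 \<le> j \<Longrightarrow> max ((2 * pi) powr (2 * \<gamma>)) A \<le> (2 * pi) powr (2 * b j) / real j powr \<gamma>"
    using lim unfolding filterlim_at_top eventually_sequentially \<gamma>_def by meson
  have growth: "A * real j powr \<gamma> \<le> (2 * pi) powr (2 * b j)" "\<gamma> \<le> b j" if j: "max J0 1 < j" for j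
  proof -
    have j1: "1 \<le> real j powr \<gamma>" using j \<gamma> by (intro ge_one_powr_ge_zero) auto
    have a: "max ((2 * pi) powr (2 * \<gamma>)) A * real j powr \<gamma> \<le> (2 * pi) powr (2 * b j)"
    proof -
      have "0 < real j powr \<gamma>" using j1 by linarith
      then show ?thesis using J0[of j] j by (simp only: pos_le_divide_eq)
    qed
    have "A * real j powr \<gamma> \<le> max ((2 * pi) powr (2 * \<gamma>)) A * real j powr \<gamma>"
      by (intro mult_right_mono) auto
    with a show "A * real j powr \<gamma> \<le> (2 * pi) powr (2 * b j)" by linarith
    have "(2 * pi) powr (2 * \<gamma>) * 1 \<le> max ((2 * pi) powr (2 * \<gamma>)) A * real j powr \<gamma>"
      using j1 A by (intro mult_mono max.cobounded1) auto
    with a have "(2 * pi) powr (2 * \<gamma>) \<le> (2 * pi) powr (2 * b j)" by linarith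
    then show "\<gamma> \<le> b j" unfolding two_pi_powr_mono_iff by simp
  qed
  define J where "J = max J0 1"
  show "\<exists>C J. \<forall>d\<ge>1. \<forall>y>1. \<exists>\<sigma>\<ge>0. \<exists>Q. \<sigma> * y\<^sup>2 + 2 * Q \<le> \<delta> * (y powr s + real d powr t) + C \<and>
      (\<forall>M. (\<Sum>j\<in>{J<..d}. \<Sum>m=1..M. exp (- \<sigma> * wt b j (int m))) \<le> Q)"
  proof (rule exI[of _ 0], rule exI[of _ J], intro allI impI)
    fix d :: nat and y :: real assume dy: "1 \<le> d" "1 < y"
    define \<sigma> where "\<sigma> = \<delta> / 2 * y powr (s - 2)"
    define h where "h = (\<sigma> * A) powr (1 / \<gamma>)"
    have \<sigma>: "0 < \<sigma>" using \<delta> dy by (simp add: \<sigma>_def)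
    have h: "0 < h" "h powr \<gamma> = \<sigma> * A" using \<sigma> A \<gamma> by (simp_all add: h_def powr_powr)
    have \<sigma>y: "\<sigma> * y\<^sup>2 = \<delta> / 2 * y powr s"
    proof -
      have "y powr s = y powr ((s - 2) + 2)" by simp
      also have "\<dots> = y powr (s - 2) * y\<^sup>2" using dy by (subst powr_add) simp
      finally show ?thesis by (simp add: \<sigma>_def)
    qed
    have h_eq: "pi * K / h = \<delta> / 4 * y powr s"
    proof -
      have "\<sigma> * A = y powr (s - 2) * (4 * pi * K / \<delta>) powr \<gamma>"
        using \<delta> by (simp add: \<sigma>_def A_def)
      then have "h = (y powr (s - 2)) powr (1 / \<gamma>) * ((4 * pi * K / \<delta>) powr \<gamma>) powr (1 / \<gamma>)"
        by (simp only: h_def powr_mult)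
      also have "\<dots> = y powr ((s - 2) / \<gamma>) * (4 * pi * K / \<delta>)"
        using \<gamma> K(1) \<delta> by (simp add: powr_powr)
      also have "(s - 2) / \<gamma> = - s" using s by (simp add: \<gamma>_def field_simps)
      finally show ?thesis using K(1) \<delta> by (simp add: powr_minus field_simps)
    qed
    have "(\<Sum>j\<in>{J<..d}. \<Sum>m=1..M. exp (- \<sigma> * wt b j (int m))) \<le> pi * K / h" for M
    proof -
      have summand: "exp (- \<sigma> * wt b j (int m)) \<le> K / (1 + (h * (real m)\<^sup>2 * real j)\<^sup>2)"
        if "j \<in> {J<..d}" "m \<in> {1..M}" for j m
      proof -
        have jm: "max J0 1 < j" "1 \<le> m" using that by (auto simp: J_def)
        \<comment> \<open>Merges both indices into one variable. For fixed \<open>m\<close> the sum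
          over \<open>j\<close> is Lorentzian with step \<open>h * m\<^sup>2\<close>, and the
          resulting \<open>1 / m\<^sup>2\<close> is summable.\<close>
        define x where "x = h * (real m)\<^sup>2 * real j"
        have "x powr \<gamma> = \<sigma> * (A * real j powr \<gamma> * real m powr (2 * \<gamma>))"
          using h(2) jm by (simp add: x_def powr_mult powr_powr mult_ac flip: powr_numeral)
        also have "\<dots> \<le> \<sigma> * ((2 * pi) powr (2 * b j) * real m powr (2 * \<gamma>))"
          using \<sigma> growth(1)[OF jm(1)] by (intro mult_left_mono mult_right_mono) auto
        also have "\<dots> \<le> \<sigma> * wt b j (int m)"
          using \<sigma> growth(2)[OF jm(1)] jm by (intro mult_left_mono wt_ge_power) auto
        finally have "exp (- \<sigma> * wt b j (int m)) \<le> exp (- 1 * x powr \<gamma>)" by simp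
        also have "\<dots> \<le> K / (1 + x\<^sup>2)" using h by (intro K(2)) (auto simp: x_def)
        finally show ?thesis by (simp add: x_def)
      qed
      have "(\<Sum>j\<in>{J<..d}. \<Sum>m=1..M. exp (- \<sigma> * wt b j (int m)))
          \<le> (\<Sum>j\<in>{J<..d}. \<Sum>m=1..M. K / (1 + (h * (real m)\<^sup>2 * real j)\<^sup>2))"
        by (intro sum_mono summand)
      also have "\<dots> \<le> (\<Sum>j=1..d. \<Sum>m=1..M. K / (1 + (h * (real m)\<^sup>2 * real j)\<^sup>2))"
        using K(1) by (intro sum_mono2 sum_nonneg) (auto intro!: divide_nonneg_nonneg)
      also have "\<dots> = (\<Sum>m=1..M. K * (\<Sum>j=1..d. 1 / (1 + (h * (real m)\<^sup>2 * real j)\<^sup>2)))"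
        by (subst sum.swap) (simp add: sum_distrib_left)
      also have "\<dots> \<le> (\<Sum>m=1..M. K * (pi / 2 / (h * (real m)\<^sup>2)))"
        using K(1) h(1) by (intro sum_mono mult_left_mono sum_lorentzian_le) auto
      also have "\<dots> = K * pi / 2 / h * (\<Sum>m=1..M. 1 / (real m)\<^sup>2)"
        by (simp add: sum_distrib_left mult.assoc)
      also have "\<dots> \<le> K * pi / 2 / h * 2"
        using K(1) h(1) sum_inverse_squares_le by (intro mult_left_mono) auto
      finally show ?thesis by (simp add: mult.commute)
    qed
    moreover have "\<sigma> * y\<^sup>2 + 2 * (pi * K / h) \<le> \<delta> * (y powr s + real d powr t) + 0"
      unfolding \<sigma>y h_eq using \<delta> by (simp add: distrib_left)
    ultimately show "\<exists>\<sigma>\<ge>0. \<exists>Q. \<sigma> * y\<^sup>2 + 2 * Q \<le> \<delta> * (y powr s + real d powr t) + 0 \<and>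
        (\<forall>M. (\<Sum>j\<in>{J<..d}. \<Sum>m=1..M. exp (- \<sigma> * wt b j (int m))) \<le> Q)"
      using \<sigma> by (intro exI[of _ \<sigma>] conjI exI[of _ "pi * K / h"]) auto
  qed
qed

text \<open>Applies even to constant \<open>b\<close>. With \<open>\<sigma> = 2 * ln (d + 1)\<close>
  each coordinate costs \<open>O(1 / d)\<close>, so the coordinates together cost a constant, while
  \<open>\<sigma> * y\<^sup>2\<close> is affordable because \<open>s > 2\<close>.\<close>

lemma WT_s_t_if_s_gt_2:
  assumes s: "2 < s" and t: "0 < t"
  shows "WT_st b s t"
proof (rule WT_st_rankin)
  fix \<delta> :: real assume \<delta>: "0 < \<delta>"
  obtain K where K: "K > 0" "\<And>x. 0 \<le> x \<Longrightarrow> exp (- ln 2 * x powr (2 * b 1)) \<le> K / (1 + x\<^sup>2)"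
    using exp_powr_decay[of "ln 2" "2 * b 1"] pos by auto
  obtain C where C: "\<And>x y. 1 \<le> x \<Longrightarrow> 1 \<le> y \<Longrightarrow> 2 * ln (x + 1) * y\<^sup>2 \<le> \<delta> * (y powr s + x powr t) + C"
    using ln_dim_tradeoff[of 2 \<delta> s t] \<delta> s t by auto
  show "\<exists>C J. \<forall>d\<ge>1. \<forall>y>1. \<exists>\<sigma>\<ge>0. \<exists>Q. \<sigma> * y\<^sup>2 + 2 * Q \<le> \<delta> * (y powr s + real d powr t) + C \<and>
      (\<forall>M. (\<Sum>j\<in>{J<..d}. \<Sum>m=1..M. exp (- \<sigma> * wt b j (int m))) \<le> Q)"
  proof (rule exI[of _ "C + 4 * K"], rule exI[of _ 0], intro allI impI)
    fix d :: nat and y :: real assume dy: "1 \<le> d" "1 < y"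
    define L where "L = ln (real d + 1)"
    have L: "ln 2 \<le> L" "0 < L" using dy by (simp_all add: L_def)
    have summand: "exp (- (2 * L) * wt b j (int m)) \<le> K / (real d + 1) * (1 / (real m)\<^sup>2)"
      if "1 \<le> j" "1 \<le> m" for j m
    proof -
      define u where "u = real m powr (2 * b 1)"
      have u: "1 \<le> u" using that pos unfolding u_def by (intro ge_one_powr_ge_zero) auto
      have "1 * u \<le> (2 * pi) powr (2 * b j) * real m powr (2 * b 1)"
        unfolding u_def using b_pos[OF that(1)] two_pi_gt_6
        by (intro mult_right_mono ge_one_powr_ge_zero) auto
      also have "\<dots> \<le> wt b j (int m)" using that b_mono[of 1 j] by (intro wt_ge_power) auto
      \<comment> \<open>Of the two copies of \<open>L\<close>, one gives the factor
        \<open>1 / (d + 1)\<close> through \<open>wt \<ge> 1\<close>; the other is lowered to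
        \<open>ln 2\<close> and gives decay in \<open>m\<close> independent of \<open>j\<close> and
        \<open>d\<close>.\<close>
      finally have "L * 1 + ln 2 * u \<le> L * wt b j (int m) + L * wt b j (int m)"
        using L u by (intro add_mono mult_mono) auto
      then have "exp (- (2 * L) * wt b j (int m)) \<le> exp (- L + - ln 2 * u)" by simp
      also have "\<dots> = exp (- L) * exp (- ln 2 * u)" by (rule exp_add)
      also have "\<dots> \<le> 1 / (real d + 1) * (K / (1 + (real m)\<^sup>2))"
        unfolding u_def using dy K(2)[of "real m"]
        by (intro mult_mono) (auto simp: L_def exp_minus divide_inverse)
      also have "\<dots> \<le> 1 / (real d + 1) * (K / (real m)\<^sup>2)"
        using K(1) that by (intro mult_left_mono divide_left_mono) (auto simp: add_pos_nonneg)
      finally show ?thesis by simp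
    qed
    have "(\<Sum>j\<in>{0<..d}. \<Sum>m=1..M. exp (- (2 * L) * wt b j (int m))) \<le> 2 * K" for M
    proof -
      have "(\<Sum>m=1..M. exp (- (2 * L) * wt b j (int m))) \<le> K / (real d + 1) * 2" if "j \<in> {0<..d}" for j
      proof -
        have "(\<Sum>m=1..M. exp (- (2 * L) * wt b j (int m)))
            \<le> (\<Sum>m=1..M. K / (real d + 1) * (1 / (real m)\<^sup>2))"
          using that by (intro sum_mono summand) auto
        also have "\<dots> = K / (real d + 1) * (\<Sum>m=1..M. 1 / (real m)\<^sup>2)"
          by (rule sum_distrib_left[symmetric])
        also have "\<dots> \<le> K / (real d + 1) * 2"
          using K(1) sum_inverse_squares_le by (intro mult_left_mono) auto
        finally show ?thesis .
      qed
      then have "(\<Sum>j\<in>{0<..d}. \<Sum>m=1..M. exp (- (2 * L) * wt b j (int m)))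
          \<le> real (card {0<..d}) * (K / (real d + 1) * 2)"
        by (rule sum_bounded_above)
      also have "\<dots> = real d / (real d + 1) * (2 * K)" by simp
      also have "\<dots> \<le> 1 * (2 * K)" using K(1) by (intro mult_right_mono) auto
      finally show ?thesis by simp
    qed
    moreover have "2 * L * y\<^sup>2 + 2 * (2 * K) \<le> \<delta> * (y powr s + real d powr t) + (C + 4 * K)"
      using C[of "real d" y] dy by (simp add: L_def)
    ultimately show "\<exists>\<sigma>\<ge>0. \<exists>Q. \<sigma> * y\<^sup>2 + 2 * Q \<le> \<delta> * (y powr s + real d powr t) + (C + 4 * K) \<and>
        (\<forall>M. (\<Sum>j\<in>{0<..d}. \<Sum>m=1..M. exp (- \<sigma> * wt b j (int m))) \<le> Q)"
      using L by (intro exI[of _ "2 * L"] conjI exI[of _ "2 * K"]) auto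
  qed
qed (use s t in auto)

text \<open>The crude bound \<open>d * ln y / b 1\<close> on the logarithm of the count suffices,
  since \<open>d powr t\<close> outgrows \<open>d\<close> by a power.\<close>

lemma WT_s_t_if_t_gt_1:
  assumes s: "0 < s" and t: "1 < t"
  shows "WT_st b s t"
proof (rule WT_stI)
  fix \<delta> :: real assume \<delta>: "0 < \<delta>"
  obtain C where C: "\<And>x y. 1 \<le> x \<Longrightarrow> 1 \<le> y \<Longrightarrow> 1 / b 1 * x * ln y \<le> \<delta> * (y powr s + x powr t) + C"
    using dim_ln_tradeoff[of "1 / b 1" \<delta> s t] \<delta> s t pos by auto
  have "ln (cnt d y) \<le> \<delta> * (y powr s + real d powr t) + C + 0 * ln y" if dy: "1 \<le> d" "1 < y" for d y
  proof -
    have "(\<Sum>j=1..d. 1 / b j) \<le> (\<Sum>j=1..d. 1 / b 1)"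
    proof (intro sum_mono divide_left_mono)
      fix j assume "j \<in> {1..d}"
      then show "b 1 \<le> b j" "0 < b j * b 1" using b_mono[of 1 j] b_pos[of j] pos by auto
    qed simp
    then have "ln y * (\<Sum>j=1..d. 1 / b j) \<le> ln y * (real d / b 1)"
      using dy by (intro mult_left_mono) auto
    then have "ln (cnt d y) \<le> 1 / b 1 * real d * ln y"
      using ln_cnt_le_sum[OF dy(2), of d] by (simp add: mult.commute)
    also have "\<dots> \<le> \<delta> * (y powr s + real d powr t) + C" using dy by (intro C) auto
    finally show ?thesis by simp
  qed
  then show "\<exists>C D. 0 \<le> D \<and> (\<forall>d\<ge>1. \<forall>y>1. ln (cnt d y) \<le> \<delta> * (y powr s + real d powr t) + C + D * ln y)"
    by (intro exI[of _ C] exI[of _ 0]) auto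
qed (use s t in auto)

section \<open>Uniform weak tractability and the combined result\<close>

lemma WT_st_iff_power_growth:
  assumes "0 < s" "s < 2" "0 < t" "t \<le> 1"
  shows "WT_st b s t \<longleftrightarrow>
    filterlim (\<lambda>j. (2 * pi) powr (2 * b j) / real j powr ((2 - s) / s)) at_top sequentially"
  using necessary_power_growth[of s t] WT_s_t_if_power_growth[of s t] assms by auto

text \<open>As \<open>s\<close> runs through \<open>(0, 2)\<close>, the exponent
  \<open>(2 - s) / s\<close> takes every positive value. Power growth of
  \<open>(2 * pi) powr (2 * b j)\<close> with every exponent is, after taking logarithms,
  superlogarithmic growth of \<open>b j\<close>.\<close>

lemma UWT_iff:
  "UWT b \<longleftrightarrow> filterlim (\<lambda>j. b j / ln (real j)) at_top sequentially"
proof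
  assume uwt: "UWT b"
  show "filterlim (\<lambda>j. b j / ln (real j)) at_top sequentially"
    unfolding filterlim_at_top_gt[where c=0]
  proof (intro allI impI)
    fix Z :: real assume Z: "0 < Z"
    \<comment> \<open>Taking logarithms in
      \<open>j powr \<gamma> \<le> (2 * pi) powr (2 * b j)\<close> then gives exactly
      \<open>Z * ln j \<le> b j\<close>.\<close>
    define \<gamma> where "\<gamma> = 2 * Z * ln (2 * pi)"
    have \<gamma>: "0 < \<gamma>" unfolding \<gamma>_def using Z ln_two_pi_ge_1 by (intro mult_pos_pos) linarith+
    define s where "s = 2 / (1 + \<gamma>)"
    have s: "0 < s" "s < 2" "(2 - s) / s = \<gamma>" using \<gamma> by (simp_all add: s_def field_simps)
    have "filterlim (\<lambda>j. (2 * pi) powr (2 * b j) / real j powr \<gamma>) at_top sequentially"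
      using WT_st_iff_power_growth[of s 1] s uwt unfolding UWT_def by simp
    then have "eventually (\<lambda>j. 1 \<le> (2 * pi) powr (2 * b j) / real j powr \<gamma>) sequentially"
      unfolding filterlim_at_top by blast
    then show "eventually (\<lambda>j. Z \<le> b j / ln (real j)) sequentially"
      using eventually_gt_at_top[of 1]
    proof eventually_elim
      case (elim j)
      then have "real j powr \<gamma> \<le> (2 * pi) powr (2 * b j)" by (simp add: pos_le_divide_eq)
      then have "ln (real j powr \<gamma>) \<le> ln ((2 * pi) powr (2 * b j))" using elim by (intro ln_mono) auto
      then have "\<gamma> * ln (real j) \<le> 2 * b j * ln (2 * pi)" using elim by (simp add: ln_powr)
      then have "2 * ln (2 * pi) * (Z * ln (real j)) \<le> 2 * ln (2 * pi) * b j"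
        by (simp add: \<gamma>_def mult_ac)
      moreover have "0 < 2 * ln (2 * pi)" using ln_two_pi_ge_1 by linarith
      ultimately have "Z * ln (real j) \<le> b j" by (simp only: mult_le_cancel_left_pos)
      then show ?case using elim by (simp add: pos_le_divide_eq)
    qed
  qed
next
  assume lim: "filterlim (\<lambda>j. b j / ln (real j)) at_top sequentially"
  show "UWT b"
    unfolding UWT_def
  proof (intro allI impI)
    fix \<alpha> \<beta> :: real assume \<alpha>\<beta>: "0 < \<alpha>" "0 < \<beta>"
    \<comment> \<open>The minimum keeps \<open>s\<close> below 2; monotonicity in \<open>s\<close>
      returns to \<open>\<alpha>\<close>.\<close>
    define s where "s = min \<alpha> 1"
    define \<gamma> where "\<gamma> = (2 - s) / s"
    have s: "0 < s" "s < 2" "s \<le> \<alpha>" using \<alpha>\<beta> by (auto simp: s_def)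
    then have \<gamma>: "0 < \<gamma>" by (simp add: \<gamma>_def)
    have "eventually (\<lambda>j. \<gamma> \<le> b j / ln (real j)) sequentially"
      using lim unfolding filterlim_at_top by blast
    \<comment> \<open>Since \<open>ln (2 * pi) \<ge> 1\<close>, the weight is at least
      \<open>j powr (2 * \<gamma>)\<close>. One factor \<open>j powr \<gamma>\<close> survives the
      division and drives the quotient to infinity.\<close>
    then have ev: "eventually (\<lambda>j. real j powr \<gamma> \<le> (2 * pi) powr (2 * b j) / real j powr \<gamma>) sequentially"
      using eventually_gt_at_top[of 1]
    proof eventually_elim
      case (elim j)
      then have "\<gamma> * ln (real j) \<le> b j" by (simp add: pos_le_divide_eq)
      then have "2 * (\<gamma> * ln (real j)) * 1 \<le> 2 * b j * ln (2 * pi)"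
        using \<gamma> elim ln_two_pi_ge_1 b_pos[of j] by (intro mult_mono) auto
      then have "exp (2 * (\<gamma> * ln (real j))) \<le> exp (2 * b j * ln (2 * pi))" by simp
      then have "real j powr \<gamma> * real j powr \<gamma> \<le> (2 * pi) powr (2 * b j)"
        using elim by (simp add: powr_def flip: exp_add)
      then show ?case using elim by (simp add: pos_le_divide_eq)
    qed
    have "filterlim (\<lambda>j. real j powr \<gamma>) at_top sequentially"
      using \<gamma> by real_asymp
    then have "filterlim (\<lambda>j. (2 * pi) powr (2 * b j) / real j powr \<gamma>) at_top sequentially"
      using ev by (rule filterlim_at_top_mono)
    then have "WT_st b s \<beta>"
      unfolding \<gamma>_def using s \<alpha>\<beta> by (intro WT_s_t_if_power_growth) auto
    then show "WT_st b \<alpha> \<beta>" by (rule WT_st_mono) (use s in auto)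
  qed
qed

end

theorem theorem2p9:
  fixes b :: "nat \<Rightarrow> real"
  assumes pos: "0 < b 1"
    and mono: "\<And>j. j \<ge> 1 \<Longrightarrow> b j \<le> b (Suc j)"
  shows "((SPT b \<longleftrightarrow> PT b) \<and> (PT b \<longleftrightarrow> summable (\<lambda>j. 1 / b (Suc j))))
    \<and> (QPT b \<longleftrightarrow> bdd_above {(\<Sum>j=1..d. 1 / b j) / (1 + ln (real d)) | d. d \<ge> 1})
    \<and> (UWT b \<longleftrightarrow> filterlim (\<lambda>j. b j / ln (real j)) at_top sequentially)
    \<and> (WT b \<longleftrightarrow> filterlim (\<lambda>j. (2 * pi) powr (2 * b j) / real j) at_top sequentially)
    \<and> (\<forall>s t. s > 0 \<longrightarrow> t > 0 \<longrightarrow> max (s / 2) t > 1 \<longrightarrow> WT_st b s t)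
    \<and> (WT_st b 2 1 \<longleftrightarrow> filterlim b at_top sequentially)
    \<and> (\<forall>t. 0 < t \<longrightarrow> t < 1 \<longrightarrow>
           (WT_st b 2 t \<longleftrightarrow> filterlim (\<lambda>j. (2 * pi) powr (2 * b j) / ln (real j)) at_top sequentially))
    \<and> (\<forall>s t. 0 < s \<longrightarrow> s < 2 \<longrightarrow> 0 < t \<longrightarrow> t \<le> 1 \<longrightarrow>
           (WT_st b s t \<longleftrightarrow>
              filterlim (\<lambda>j. (2 * pi) powr (2 * b j) / real j powr ((2 - s) / s)) at_top sequentially))"
proof -
  interpret smoothness b by standard (fact pos, fact mono)
  have "WT b \<longleftrightarrow> filterlim (\<lambda>j. (2 * pi) powr (2 * b j) / real j) at_top sequentially"
    unfolding WT_def using WT_st_iff_power_growth[of 1 1] by simp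
  moreover have "WT_st b 2 1 \<longleftrightarrow> filterlim b at_top sequentially"
  proof
    assume "WT_st b 2 1"
    then have "filterlim (\<lambda>j. (2 * pi) powr (2 * b j) / real j powr ((2 - 2) / 2)) at_top sequentially"
      by (rule necessary_power_growth) auto
    \<comment> \<open>At \<open>s = 2\<close> the exponent is 0. Positive \<open>j\<close> are
      singled out because \<open>0 powr 0\<close> is 0.\<close>
    moreover have "eventually (\<lambda>j. (2 * pi) powr (2 * b j) / real j powr ((2 - 2) / 2) = (2 * pi) powr (2 * b j)) sequentially"
      using eventually_gt_at_top[of 0] by eventually_elim simp
    ultimately have lim: "filterlim (\<lambda>j. (2 * pi) powr (2 * b j)) at_top sequentially"
      by (subst (asm) filterlim_cong[OF refl refl]) auto
    show "filterlim b at_top sequentially"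
      unfolding filterlim_at_top
    proof
      fix Z
      have "eventually (\<lambda>j. (2 * pi) powr (2 * Z) \<le> (2 * pi) powr (2 * b j)) sequentially"
        using lim unfolding filterlim_at_top by blast
      then show "eventually (\<lambda>j. Z \<le> b j) sequentially"
        unfolding two_pi_powr_mono_iff by simp
    qed
  qed (rule WT_2_1_if_unbounded)
  moreover have "WT_st b s t" if "s > 0" "t > 0" "max (s / 2) t > 1" for s t
    using that WT_s_t_if_s_gt_2[of s t] WT_s_t_if_t_gt_1[of s t] by (auto simp: max_def split: if_splits)
  moreover have "SPT b \<longleftrightarrow> PT b" "PT b \<longleftrightarrow> summable (\<lambda>j. 1 / b (Suc j))"
    using SPT_if_summable PT_if_SPT summable_if_PT by blast+
  moreover have "WT_st b 2 t \<longleftrightarrow> filterlim (\<lambda>j. (2 * pi) powr (2 * b j) / ln (real j)) at_top sequentially"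
    if "0 < t" "t < 1" for t
    using necessary_log_growth[OF _ that] WT_2_t_if_log_growth[OF _ that(1)] by (rule iffI)
  ultimately show ?thesis
    using QPT_iff_bdd UWT_iff WT_st_iff_power_growth by (intro conjI allI impI)
qed

end
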